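(* Fix $T>0$. If $\gamma>\frac12$, the processes $(R^\epsilon(t))_{t\in[0,T]}$ defined in the context converge weakly, as $\epsilon\to0$, to the Bessel process of dimension $2\gamma+1$ with initial condition $1$.
   Context: $(\omega_k)_{k\in\mathbb{N}}$ is a family of i.i.d. real random variables with $\mathbb{E}(\omega_k)=0$, $\mathbb{E}(\omega_k^2)=1$ and $|\omega_k|\le M$ for some $M\ge1$. $F:(0,+\infty)\times[-M,M]\to(0,+\infty)$ is a measurable function for which there exist $\gamma\in\mathbb{R}$, $0<\xi_-<\xi_+$, $\alpha>0$, $\beta>1$ such that $F$ is continuous on $[\xi_-,+\infty)\times[-M,M]$ and, for all $\xi>\xi_+$, $$F(\xi,\omega)=\xi+\omega+\frac{\gamma}{\xi}+G_0(\xi,\omega)+G_1(\xi,\omega),$$ where, as $\xi\to+\infty$, $\sup_\omega|G_0(\xi,\omega)|=O(\xi^{-\alpha})$ and $\sup_\omega|G_1(\xi,\omega)|=O(\xi^{-\beta})$, and where $\mathbb{E}(G_0(\xi,\omega_k))=0$. For $\epsilon>0$ small, let $(\xi_n)_{n\in\mathbb{N}}$ be the Markov chain $\xi_{n+1}=F(\xi_n,\omega_n)$ started at $\xi_0=\epsilon^{-1}$, and set $R^\epsilon_n=\epsilon\,\xi_n$ (so $R^\epsilon_0=1$). With $t_n=n\epsilon^2$, define the continuous-time process by linear interpolation: for $t\in[t_n,t_{n+1}]$, $$R^\epsilon(t)=\frac{t_{n+1}-t}{\epsilon^2}R^\epsilon_n+\frac{t-t_n}{\epsilon^2}R^\epsilon_{n+1}.$$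 Weak convergence means convergence in distribution in the space of continuous functions $C([0,T],\mathbb{R}_+)$ with the supremum norm. The Bessel process of dimension $2\gamma+1$ is the solution of $dR_t=dB_t+\frac{\gamma}{R_t}dt$, with $B$ a standard Brownian motion. *)

theory Defs
  imports "HOL-Probability.Probability"
begin

section \<open>The rescaled Markov chain\<close>

primrec chain :: "(real \<Rightarrow> real \<Rightarrow> real) \<Rightarrow> (nat \<Rightarrow> 'a \<Rightarrow> real) \<Rightarrow> real \<Rightarrow> nat \<Rightarrow> 'a \<Rightarrow> real" where
  "chain F \<omega> \<epsilon> 0 x = 1 / \<epsilon>"
| "chain F \<omega> \<epsilon> (Suc n) x = F (chain F \<omega> \<epsilon> n x) (\<omega> n x)"

text \<open>The linear interpolation of the points \<open>(n \<epsilon>\<^sup>2, \<epsilon> \<xi>\<^sub>n)\<close>; for \<open>t \<ge> 0\<close> the index below is the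
  one with \<open>n \<epsilon>\<^sup>2 \<le> t < (n + 1) \<epsilon>\<^sup>2\<close>. At a common endpoint the formulas of two neighbouring
  intervals agree.\<close>

definition interp_chain ::
  "(real \<Rightarrow> real \<Rightarrow> real) \<Rightarrow> (nat \<Rightarrow> 'a \<Rightarrow> real) \<Rightarrow> real \<Rightarrow> real \<Rightarrow> 'a \<Rightarrow> real" where
  "interp_chain F \<omega> \<epsilon> t x =
     (let n = nat \<lfloor>t / \<epsilon>\<^sup>2\<rfloor> in
        (real (Suc n) * \<epsilon>\<^sup>2 - t) / \<epsilon>\<^sup>2 * (\<epsilon> * chain F \<omega> \<epsilon> n x)
      + (t - real n * \<epsilon>\<^sup>2) / \<epsilon>\<^sup>2 * (\<epsilon> * chain F \<omega> \<epsilon> (Suc n) x))"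

text \<open>\<open>sup\<^sub>w |G(\<xi>, w)| = O(\<xi>\<^sup>-\<^sup>a)\<close> as \<open>\<xi> \<rightarrow> \<infinity>\<close>. The supremum of an unbounded set of reals is
  unspecified, hence the explicit boundedness.\<close>

definition sup_bigo :: "real set \<Rightarrow> (real \<Rightarrow> real \<Rightarrow> real) \<Rightarrow> real \<Rightarrow> bool" where
  "sup_bigo S G a \<longleftrightarrow>
     (\<forall>\<^sub>F \<xi> in at_top. bdd_above ((\<lambda>w. \<bar>G \<xi> w\<bar>) ` S)) \<and>
     (\<lambda>\<xi>. SUP w\<in>S. \<bar>G \<xi> w\<bar>) \<in> O[at_top](\<lambda>\<xi>. \<xi> powr (- a))"


section \<open>Convergence in distribution in a metric space\<close>

definition metric_borel :: "'c metric \<Rightarrow> 'c measure" where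
  "metric_borel m = sigma (mspace m) {U. openin (mtopology_of m) U}"

text \<open>Random elements \<open>X i\<close> of \<open>m\<close>, all on the probability space \<open>P\<close>, converge in distribution
  along the filter \<open>L\<close> to the random element \<open>Y\<close>, which may live on another space \<open>N\<close>.\<close>

definition converges_in_distribution ::
  "'c metric \<Rightarrow> 'i filter \<Rightarrow> 'a measure \<Rightarrow> ('i \<Rightarrow> 'a \<Rightarrow> 'c) \<Rightarrow> 'b measure \<Rightarrow> ('b \<Rightarrow> 'c) \<Rightarrow> bool" where
  "converges_in_distribution m L P X N Y \<longleftrightarrow>
     (\<forall>\<^sub>F i in L. X i \<in> measurable P (metric_borel m)) \<and>
     Y \<in> measurable N (metric_borel m) \<and>
     (\<forall>\<Phi> :: 'c \<Rightarrow> real.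
        continuous_map (mtopology_of m) euclideanreal \<Phi> \<and> bounded (\<Phi> ` mspace m) \<longrightarrow>
        ((\<lambda>i. \<integral>x. \<Phi> (X i x) \<partial>P) \<longlongrightarrow> (\<integral>y. \<Phi> (Y y) \<partial>N)) L)"

text \<open>\<open>C([0,T], [0,\<infinity>))\<close> with the supremum distance; its elements are extensional on \<open>[0,T]\<close>.\<close>

definition path_space :: "real \<Rightarrow> (real \<Rightarrow> real) metric" where
  "path_space T = cfunspace (top_of_set {0..T}) (submetric euclidean_metric {0..})"


section \<open>Brownian motion and Bessel processes\<close>

text \<open>Time is \<open>[0,\<infinity>)\<close>. A filtration indexed by nonnegative times is extended to all reals, as
  the library locale demands, by its value at \<open>0\<close>.\<close>

definition brownian_motion ::
  "'b measure \<Rightarrow> (real \<Rightarrow> 'b measure) \<Rightarrow> (real \<Rightarrow> 'b \<Rightarrow> real) \<Rightarrow> bool" where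
  "brownian_motion N \<F> B \<longleftrightarrow>
     prob_space N \<and> filtration (space N) \<F> \<and> (\<forall>t. subalgebra N (\<F> t)) \<and>
     (\<forall>t\<ge>0. B t \<in> borel_measurable (\<F> t)) \<and>
     (\<forall>y\<in>space N. B 0 y = 0 \<and> continuous_on {0..} (\<lambda>t. B t y)) \<and>
     (\<forall>s t. 0 \<le> s \<and> s < t \<longrightarrow>
        distributed N lborel (\<lambda>y. B t y - B s y) (normal_density 0 (sqrt (t - s))) \<and>
        prob_space.indep_set N (sets (\<F> s))
          {(\<lambda>y. B t y - B s y) -` A \<inter> space N | A. A \<in> sets borel})"

text \<open>The Bessel process of dimension \<open>\<delta>\<close> started at \<open>r\<close>: a continuous adapted solution with
  values in \<open>[0,\<infinity>)\<close> of \<open>dR = dB + (\<delta> - 1) / (2 R) dt\<close>. Since the noise is additive, the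
  integral form involves no stochastic integral. The drift must be integrable in time; as
  \<open>inverse 0 = \<infinity>\<close> in \<^typ>\<open>ennreal\<close>, this forces \<open>R s > 0\<close> for almost every \<open>s\<close>, but
  it is not assumed that \<open>R\<close> avoids \<open>0\<close>.\<close>

definition bessel_process ::
  "real \<Rightarrow> real \<Rightarrow> 'b measure \<Rightarrow> (real \<Rightarrow> 'b measure) \<Rightarrow> (real \<Rightarrow> 'b \<Rightarrow> real) \<Rightarrow> (real \<Rightarrow> 'b \<Rightarrow> real) \<Rightarrow> bool"
where
  "bessel_process \<delta> r N \<F> B R \<longleftrightarrow>
     brownian_motion N \<F> B \<and>
     (\<forall>t\<ge>0. R t \<in> borel_measurable (\<F> t)) \<and>
     (\<forall>y\<in>space N. continuous_on {0..} (\<lambda>t. R t y) \<and> (\<forall>t\<ge>0. 0 \<le> R t y)) \<and>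
     (AE y in N. \<forall>t\<ge>0.
        (\<integral>\<^sup>+s\<in>{0..t}. inverse (ennreal (R s y)) \<partial>lborel) < \<infinity> \<and>
        R t y = r + B t y + (LINT s:{0..t}|lborel. (\<delta> - 1) / (2 * R s y)))"

end

theory Submission
  imports Defs "HOL-Real_Asymp.Real_Asymp"
begin

text \<open>
The noise of the Bessel equation is additive, so both processes are driven in the same way. On the one
hand \<open>R\<^sub>t = 1 + B\<^sub>t + \<integral>\<^sub>0\<^sup>t \<gamma> / R\<^sub>s ds\<close>; on the other hand the rescaled chain satisfies
\<open>R\<^sub>n\<^sub>+\<^sub>1 = R\<^sub>n + \<epsilon> \<omega>\<^sub>n + \<epsilon>\<^sup>2 \<gamma> / R\<^sub>n\<close> up to small corrections. Cut \<open>[0,T]\<close> into \<open>m\<close> pieces and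
truncate the drift to \<open>\<gamma> / max r \<delta>\<close>, which is bounded and Lipschitz. The resulting Euler scheme
(\<open>euler\<close>) is a continuous function of \<open>m\<close> real increments, and the proof compares both processes to
this same scheme, once fed with the increments of the random walk \<open>\<epsilon> \<Sum> \<omega>\<^sub>j\<close> and once with
those of \<open>B\<close>. The joint law of the increments of the walk converges, by the central limit theorem in
each coordinate and independence (\<open>increments_converge\<close>).

Three estimates carry the comparison.

\<^item> The chain does not approach the origin. As \<open>\<gamma> > 1/2\<close>, the function \<open>\<xi>\<^sup>-\<^sup>p\<close> with a small \<open>p > 0\<close> is
superharmonic for the chain far from the origin (\<open>lyapunov\<close>), and the maximal inequality for
nonnegative supermartingales bounds by \<open>\<delta>\<^sup>p\<close> the probability that the rescaled chain ever goes below
\<open>\<delta>\<close> (\<open>prob_chain_low\<close>). So with high probability the chain stays where the expansion of \<open>F\<close> is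
accurate.

\<^item> The corrections vanish and the walk oscillates little within a piece. Both are instances of one
maximal Azuma-Hoeffding inequality (\<open>azuma_maximal\<close>): the part with mean zero has increments that
tend to zero, and for the walk the Gaussian tail beats the number \<open>m\<close> of pieces. A discrete Gronwall
argument (\<open>euler_perturbation\<close>) then gives that the chain tracks its Euler scheme with probability
close to one (\<open>chain_near_euler\<close>).

\<^item> The Bessel process tracks its Euler scheme pathwise, by uniform continuity, as long as the scheme
stays above \<open>2 \<delta>\<close> (\<open>integral_equation_euler_path\<close>). That this has probability close to one is a
statement about \<open>B\<close> alone, and it is inherited from the chain in the limit \<open>\<epsilon> \<rightarrow> 0\<close>. So the
Bessel process owes its positivity to the bound for the chain.

Weak convergence needs to be tested on bounded Lipschitz functionals only
(\<open>converges_in_distributionI_Lipschitz\<close>), and for these the three estimates suffice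
(\<open>chain_converges_to_bessel\<close>).
\<close>

section \<open>Weak convergence in a metric space\<close>

text \<open>The infimal convolution of \<open>\<Phi>\<close>, restricted to \<open>S\<close>, with \<open>k\<close> times the distance. It serves twice: for
\<open>\<Phi> = 0\<close> it is the distance to \<open>S\<close>, and for large \<open>k\<close> it approximates a continuous \<open>\<Phi>\<close> from below by
Lipschitz functions.\<close>

definition inf_conv :: "'c metric \<Rightarrow> 'c set \<Rightarrow> ('c \<Rightarrow> real) \<Rightarrow> real \<Rightarrow> 'c \<Rightarrow> real" where
  "inf_conv m S \<Phi> k y = (INF z\<in>S. \<Phi> z + k * mdist m y z)"

lemma inf_conv_bdd_below:
  assumes "\<And>z. z \<in> S \<Longrightarrow> c \<le> \<Phi> z" "k \<ge> 0"
  shows "bdd_below ((\<lambda>z. \<Phi> z + k * mdist m y z) ` S)"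
  using assms by (intro bdd_belowI2[of _ c]) (metis add_increasing2 mdist_nonneg mult_nonneg_nonneg)

lemma inf_conv_Lipschitz:
  assumes "S \<subseteq> mspace m" "S \<noteq> {}" "\<And>z. z \<in> S \<Longrightarrow> c \<le> \<Phi> z" "k \<ge> 0"
    and x: "x \<in> mspace m" and y: "y \<in> mspace m"
  shows "\<bar>inf_conv m S \<Phi> k x - inf_conv m S \<Phi> k y\<bar> \<le> k * mdist m x y"
proof -
  have *: "inf_conv m S \<Phi> k x \<le> inf_conv m S \<Phi> k y + k * mdist m x y"
    if xy: "x \<in> mspace m" "y \<in> mspace m" for x y
  proof -
    have "inf_conv m S \<Phi> k x - k * mdist m x y \<le> \<Phi> z + k * mdist m y z" if z: "z \<in> S" for z
    proof -
      have "inf_conv m S \<Phi> k x \<le> \<Phi> z + k * mdist m x z"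
        unfolding inf_conv_def by (rule cINF_lower[OF inf_conv_bdd_below z]) (use assms in auto)
      moreover have "mdist m x z \<le> mdist m x y + mdist m y z"
        using xy z assms by (intro mdist_triangle) auto
      ultimately show ?thesis
        using mult_left_mono[of "mdist m x z" "mdist m x y + mdist m y z" k] assms
        by (simp add: distrib_left)
    qed
    then have "inf_conv m S \<Phi> k x - k * mdist m x y \<le> inf_conv m S \<Phi> k y"
      unfolding inf_conv_def[of m S \<Phi> k y] by (intro cINF_greatest assms) auto
    then show ?thesis by simp
  qed
  show ?thesis using *[OF x y] *[OF y x] by (simp add: mdist_commute abs_le_iff)
qed

lemma inf_conv_bounds:
  assumes "S \<subseteq> mspace m" "\<And>z. z \<in> S \<Longrightarrow> c \<le> \<Phi> z" "k \<ge> 0" "y \<in> S"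
  shows "c \<le> inf_conv m S \<Phi> k y" "inf_conv m S \<Phi> k y \<le> \<Phi> y"
proof -
  show "c \<le> inf_conv m S \<Phi> k y"
    unfolding inf_conv_def using assms
    by (intro cINF_greatest) (auto intro!: add_increasing2 mult_nonneg_nonneg)
  have "inf_conv m S \<Phi> k y \<le> \<Phi> y + k * mdist m y y"
    unfolding inf_conv_def by (rule cINF_lower[OF inf_conv_bdd_below]) (use assms in auto)
  moreover have "y \<in> mspace m" using assms by auto
  then have "mdist m y y = 0" by simp
  ultimately show "inf_conv m S \<Phi> k y \<le> \<Phi> y" by simp
qed

lemma borel_measurable_metric_borel_continuous:
  assumes "continuous_map (mtopology_of m) euclideanreal \<Phi>"
  shows "\<Phi> \<in> borel_measurable (metric_borel m)"
proof (rule borel_measurableI)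
  fix U :: "real set" assume "open U"
  have sp: "space (metric_borel m) = mspace m"
    unfolding metric_borel_def by (intro space_measure_of) (auto dest!: openin_subset)
  have "openin (mtopology_of m) {x \<in> topspace (mtopology_of m). \<Phi> x \<in> U}"
    by (rule openin_continuous_map_preimage[OF assms]) (use \<open>open U\<close> in simp)
  then show "\<Phi> -` U \<inter> space (metric_borel m) \<in> sets (metric_borel m)"
    unfolding sp unfolding metric_borel_def
    by (subst sets_measure_of) (auto dest!: openin_subset intro!: sigma_sets.Basic simp: vimage_def Int_def conj_commute)
qed

lemma space_metric_borel: "space (metric_borel m) = mspace m"
  unfolding metric_borel_def by (intro space_measure_of) (auto dest!: openin_subset)

lemma Lipschitz_imp_continuous_map_real:
  fixes \<Phi> :: "'c \<Rightarrow> real"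
  assumes "\<And>x y. x \<in> mspace m \<Longrightarrow> y \<in> mspace m \<Longrightarrow> \<bar>\<Phi> x - \<Phi> y\<bar> \<le> K * mdist m x y"
  shows "continuous_map (mtopology_of m) euclideanreal \<Phi>"
proof -
  have "Lipschitz_continuous_map m euclidean_metric \<Phi>"
    unfolding Lipschitz_continuous_map_def using assms by (auto simp: dist_real_def)
  from Lipschitz_continuous_imp_continuous_map[OF this] show ?thesis by simp
qed

lemma Lipschitz_measurable:
  fixes \<Phi> :: "'c \<Rightarrow> real"
  assumes "\<And>x y. x \<in> mspace m \<Longrightarrow> y \<in> mspace m \<Longrightarrow> \<bar>\<Phi> x - \<Phi> y\<bar> \<le> K * mdist m x y"
  shows "\<Phi> \<in> borel_measurable (metric_borel m)"
  using borel_measurable_metric_borel_continuous[OF Lipschitz_imp_continuous_map_real[OF assms]] .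

text \<open>An open set is where the distance to its complement is positive, and this distance is Lipschitz;
hence the Lipschitz functions generate the Borel sets of a metric space.\<close>

lemma measurable_metric_borelI:
  assumes sp: "\<And>x. x \<in> space N \<Longrightarrow> X x \<in> mspace m"
    and lip: "\<And>\<Phi>::'c \<Rightarrow> real. (\<And>x y. x \<in> mspace m \<Longrightarrow> y \<in> mspace m \<Longrightarrow> \<bar>\<Phi> x - \<Phi> y\<bar> \<le> mdist m x y)
        \<Longrightarrow> (\<lambda>x. \<Phi> (X x)) \<in> borel_measurable N"
  shows "X \<in> measurable N (metric_borel m)"
  unfolding metric_borel_def
proof (rule measurable_measure_of)
  show "{U. openin (mtopology_of m) U} \<subseteq> Pow (mspace m)" by (auto dest!: openin_subset)
  show "X \<in> space N \<rightarrow> mspace m" using sp by auto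
  fix U assume "U \<in> {U. openin (mtopology_of m) U}"
  then have U: "openin (mtopology_of m) U" by simp
  interpret Metric_space "mspace m" "mdist m" by (rule Metric_space_mspace_mdist)
  show "X -` U \<inter> space N \<in> sets N"
  proof (cases "mspace m - U = {}")
    case True
    then have "X -` U \<inter> space N = space N" using sp by auto
    then show ?thesis by simp
  next
    case False
    define g where "g = inf_conv m (mspace m - U) (\<lambda>_. 0) 1"
    have gl: "\<bar>g x - g y\<bar> \<le> mdist m x y" if "x \<in> mspace m" "y \<in> mspace m" for x y
      unfolding g_def using inf_conv_Lipschitz[of "mspace m - U" m 0 "\<lambda>_. 0" 1] False that by auto
    have meas: "(\<lambda>x. g (X x)) \<in> borel_measurable N" by (rule lip) (rule gl)
    have "g x > 0 \<longleftrightarrow> x \<in> U" if x: "x \<in> mspace m" for x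
    proof
      assume "x \<in> U"
      then obtain r where r: "r > 0" "mball x r \<subseteq> U"
        using U x by (metis mtopology_of_def openin_mtopology)
      have "r \<le> g x" unfolding g_def inf_conv_def
        using False r x by (intro cINF_greatest) (auto simp: in_mball subset_iff not_less intro: leI)
      then show "g x > 0" using r by simp
    next
      assume "g x > 0"
      then show "x \<in> U"
        using inf_conv_bounds(2)[of "mspace m - U" m 0 "\<lambda>_. 0" 1 x] x unfolding g_def by force
    qed
    then have "X -` U \<inter> space N = (\<lambda>x. g (X x)) -` {0<..} \<inter> space N" using sp by auto
    then show ?thesis using measurable_sets[OF meas, of "{0<..}"] by simp
  qed
qed

text \<open>A random path with measurable values is measurable for this reason: it is the limit of paths that are
continuous functions of finitely many of its values.\<close>

lemma measurable_metric_borel_LIMSEQ: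
  assumes Xk: "\<And>k. Xk k \<in> measurable N (metric_borel m)"
    and sp: "\<And>x. x \<in> space N \<Longrightarrow> X x \<in> mspace m"
    and lim: "\<And>x. x \<in> space N \<Longrightarrow> (\<lambda>k. mdist m (Xk k x) (X x)) \<longlonglongrightarrow> 0"
  shows "X \<in> measurable N (metric_borel m)"
proof (rule measurable_metric_borelI[OF sp])
  fix \<Phi> :: "'b \<Rightarrow> real"
  assume lip: "\<And>x y. x \<in> mspace m \<Longrightarrow> y \<in> mspace m \<Longrightarrow> \<bar>\<Phi> x - \<Phi> y\<bar> \<le> mdist m x y"
  have m: "\<Phi> \<in> borel_measurable (metric_borel m)" by (rule Lipschitz_measurable[of _ _ 1]) (use lip in simp)
  show "(\<lambda>x. \<Phi> (X x)) \<in> borel_measurable N"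
  proof (rule borel_measurable_LIMSEQ_real)
    show "(\<lambda>x. \<Phi> (Xk k x)) \<in> borel_measurable N" for k using measurable_compose[OF Xk m] .
    fix x assume x: "x \<in> space N"
    have "Xk k x \<in> mspace m" for k using measurable_space[OF Xk x] by (simp add: space_metric_borel)
    then have "\<bar>\<Phi> (Xk k x) - \<Phi> (X x)\<bar> \<le> mdist m (Xk k x) (X x)" for k using lip sp x by auto
    then have "(\<lambda>k. \<Phi> (Xk k x) - \<Phi> (X x)) \<longlonglongrightarrow> 0"
      by (intro Lim_null_comparison[OF _ lim[OF x]]) auto
    then show "(\<lambda>k. \<Phi> (Xk k x)) \<longlonglongrightarrow> \<Phi> (X x)" by (rule LIM_zero_cancel)
  qed
qed simp

text \<open>A bounded continuous \<open>\<Phi>\<close> is the increasing limit of its infimal convolutions, so the convergence for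
Lipschitz functions gives a lower bound for the integrals of \<open>\<Phi>\<close>; applied to \<open>\<Phi>\<close> and \<open>- \<Phi>\<close>, it
gives the limit.\<close>

lemma converges_in_distributionI_Lipschitz:
  fixes m :: "'c metric"
  assumes P: "prob_space P" and N: "prob_space N"
    and X: "\<forall>\<^sub>F i in L. X i \<in> measurable P (metric_borel m)"
    and Y: "Y \<in> measurable N (metric_borel m)"
    and lip: "\<And>(\<Phi>::'c \<Rightarrow> real) C K. (\<And>x. x \<in> mspace m \<Longrightarrow> \<bar>\<Phi> x\<bar> \<le> C) \<Longrightarrow>
        (\<And>x y. x \<in> mspace m \<Longrightarrow> y \<in> mspace m \<Longrightarrow> \<bar>\<Phi> x - \<Phi> y\<bar> \<le> K * mdist m x y) \<Longrightarrow>
        ((\<lambda>i. \<integral>x. \<Phi> (X i x) \<partial>P) \<longlongrightarrow> (\<integral>y. \<Phi> (Y y) \<partial>N)) L"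
  shows "converges_in_distribution m L P X N Y"
proof -
  interpret P: prob_space P by fact
  interpret N: prob_space N by fact
  interpret Metric_space "mspace m" "mdist m" by (rule Metric_space_mspace_mdist)
  have int: "integrable Q (\<lambda>x. \<Phi> (Z x))"
    if "finite_measure Q" "Z \<in> measurable Q (metric_borel m)" "\<Phi> \<in> borel_measurable (metric_borel m)"
      "\<And>x. x \<in> mspace m \<Longrightarrow> \<bar>\<Phi> x\<bar> \<le> C" for Q :: "'z measure" and Z and \<Phi> :: "'c \<Rightarrow> real" and C
    using that measurable_compose[OF that(2,3)] measurable_space[OF that(2)]
    by (intro finite_measure.integrable_const_bound[where B=C]) (auto simp: space_metric_borel)
  have half: "\<forall>\<^sub>F i in L. (\<integral>y. \<Phi> (Y y) \<partial>N) - \<kappa> < (\<integral>x. \<Phi> (X i x) \<partial>P)"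
    if cont: "continuous_map (mtopology_of m) euclideanreal \<Phi>"
      and bd: "\<And>x. x \<in> mspace m \<Longrightarrow> \<bar>\<Phi> x\<bar> \<le> C" and \<kappa>: "\<kappa> > 0" for \<Phi> :: "'c \<Rightarrow> real" and C \<kappa>
  proof -
    define f where "f k = inf_conv m (mspace m) \<Phi> (real k)" for k
    have bdl: "-C \<le> \<Phi> z" if "z \<in> mspace m" for z using bd[OF that] by auto
    have fl: "\<bar>f k x - f k y\<bar> \<le> real k * mdist m x y" if "x \<in> mspace m" "y \<in> mspace m" for k x y
      unfolding f_def using inf_conv_Lipschitz[of "mspace m" m "-C" \<Phi> "real k" x y] that bdl by auto
    have fb: "-C \<le> f k y" "f k y \<le> \<Phi> y" if "y \<in> mspace m" for k y
      unfolding f_def using inf_conv_bounds[of "mspace m" m "-C" \<Phi> "real k" y] that bdl by auto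
    have fC: "\<bar>f k y\<bar> \<le> C" if "y \<in> mspace m" for k y
      using fb[OF that, of k] bd[OF that] by auto
    have fm: "f k \<in> borel_measurable (metric_borel m)" for k
      by (rule Lipschitz_measurable[OF fl])
    have \<Phi>m: "\<Phi> \<in> borel_measurable (metric_borel m)"
      by (rule borel_measurable_metric_borel_continuous[OF cont])
    have conv: "(\<lambda>k. f k y) \<longlonglongrightarrow> \<Phi> y" if y: "y \<in> mspace m" for y
    proof (rule LIMSEQ_I)
      fix r :: real assume r: "r > 0"
      have "openin (mtopology_of m) {x \<in> topspace (mtopology_of m). \<Phi> x \<in> {\<Phi> y - r / 2<..}}"
        by (rule openin_continuous_map_preimage[OF cont]) auto
      then have "openin mtopology {x \<in> mspace m. \<Phi> x \<in> {\<Phi> y - r / 2<..}}"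
        by (simp add: mtopology_of_def)
      then obtain s where s: "s > 0" "mball y s \<subseteq> {x \<in> mspace m. \<Phi> x \<in> {\<Phi> y - r / 2<..}}"
        unfolding openin_mtopology using y r by force
      obtain k0 :: nat where k0: "real k0 * s > 2 * C" using reals_Archimedean3[OF s(1)] by blast
      have "norm (f k y - \<Phi> y) < r" if k: "k \<ge> k0" for k
      proof -
        have "\<Phi> y - r / 2 \<le> \<Phi> z + real k * mdist m y z" if z: "z \<in> mspace m" for z
        proof (cases "mdist m y z < s")
          case True
          then have "\<Phi> z > \<Phi> y - r / 2" using s y z by (auto simp: subset_iff)
          then show ?thesis by (simp add: add_increasing2 less_imp_le)
        next
          case False
          then have "real k0 * s \<le> real k * mdist m y z" using k s by (intro mult_mono) auto
          then show ?thesis using k0 bd[OF y] bd[OF z] r by auto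
        qed
        then have "\<Phi> y - r / 2 \<le> f k y" unfolding f_def inf_conv_def
          using y by (intro cINF_greatest) auto
        then show ?thesis using fb[OF y, of k] r by auto
      qed
      then show "\<exists>no. \<forall>n\<ge>no. norm (f n y - \<Phi> y) < r" by blast
    qed
    have Ysp: "Y y \<in> mspace m" if "y \<in> space N" for y
      using measurable_space[OF Y that] by (simp add: space_metric_borel)
    have "(\<lambda>k. \<integral>y. f k (Y y) \<partial>N) \<longlonglongrightarrow> (\<integral>y. \<Phi> (Y y) \<partial>N)"
      by (rule integral_dominated_convergence[where w="\<lambda>_. C"])
         (use measurable_compose[OF Y \<Phi>m] measurable_compose[OF Y fm] Ysp conv fC in auto)
    then have "\<forall>\<^sub>F k in sequentially. (\<integral>y. \<Phi> (Y y) \<partial>N) - \<kappa> / 2 < (\<integral>y. f k (Y y) \<partial>N)"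
      by (rule order_tendstoD) (use \<kappa> in simp)
    then obtain k where k: "(\<integral>y. \<Phi> (Y y) \<partial>N) - \<kappa> / 2 < (\<integral>y. f k (Y y) \<partial>N)"
      by (auto simp: eventually_sequentially)
    have "((\<lambda>i. \<integral>x. f k (X i x) \<partial>P) \<longlongrightarrow> (\<integral>y. f k (Y y) \<partial>N)) L"
      by (rule lip[OF fC fl])
    then have "\<forall>\<^sub>F i in L. (\<integral>y. f k (Y y) \<partial>N) - \<kappa> / 2 < (\<integral>x. f k (X i x) \<partial>P)"
      by (rule order_tendstoD) (use \<kappa> in simp)
    with X show ?thesis
    proof eventually_elim
      case (elim i)
      have "(\<integral>x. f k (X i x) \<partial>P) \<le> (\<integral>x. \<Phi> (X i x) \<partial>P)"
        using measurable_space[OF elim(1)] fb(2)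
        by (intro integral_mono int[OF P.finite_measure_axioms elim(1) fm fC]
             int[OF P.finite_measure_axioms elim(1) \<Phi>m bd]) (auto simp: space_metric_borel)
      then show ?case using elim k by simp
    qed
  qed
  show ?thesis unfolding converges_in_distribution_def
  proof (intro conjI allI impI X Y)
    fix \<Phi> :: "'c \<Rightarrow> real"
    assume "continuous_map (mtopology_of m) euclideanreal \<Phi> \<and> bounded (\<Phi> ` mspace m)"
    then obtain C where cont: "continuous_map (mtopology_of m) euclideanreal \<Phi>"
      and bd: "\<And>x. x \<in> mspace m \<Longrightarrow> \<bar>\<Phi> x\<bar> \<le> C" unfolding bounded_iff by auto
    have cont': "continuous_map (mtopology_of m) euclideanreal (\<lambda>x. - \<Phi> x)"
      using cont by (rule continuous_map_minus)
    show "((\<lambda>i. \<integral>x. \<Phi> (X i x) \<partial>P) \<longlongrightarrow> (\<integral>y. \<Phi> (Y y) \<partial>N)) L"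
    proof (rule tendstoI)
      fix e :: real assume e: "e > 0"
      have "\<forall>\<^sub>F i in L. (\<integral>y. - \<Phi> (Y y) \<partial>N) - e < (\<integral>x. - \<Phi> (X i x) \<partial>P)"
        by (rule half[OF cont' _ e, of C]) (use bd in simp)
      moreover have "\<forall>\<^sub>F i in L. (\<integral>y. \<Phi> (Y y) \<partial>N) - e < (\<integral>x. \<Phi> (X i x) \<partial>P)"
        by (rule half[OF cont _ e, of C]) (use bd in simp)
      ultimately show "\<forall>\<^sub>F i in L. dist (\<integral>x. \<Phi> (X i x) \<partial>P) (\<integral>y. \<Phi> (Y y) \<partial>N) < e"
        by eventually_elim (auto simp: dist_real_def)
    qed
  qed
qed

section \<open>Random continuous paths\<close>

lemma mspace_path_space:
  "f \<in> mspace (path_space T) \<longleftrightarrow>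
     f \<in> extensional {0..T} \<and> continuous_on {0..T} f \<and> (\<forall>t\<in>{0..T}. 0 \<le> f t)"
proof -
  have "compactin (top_of_set {0..T}) (topspace (top_of_set {0..T}))"
    by (simp add: compactin_subtopology)
  from compactin_mspace_cfunspace[OF this, of "submetric euclidean_metric {0..}"]
  show ?thesis unfolding path_space_def
    by (auto simp: mtopology_of_submetric continuous_map_in_subtopology)
qed

lemma restrict_in_path_space:
  assumes "continuous_on {0..T} f" "\<And>t. t \<in> {0..T} \<Longrightarrow> 0 \<le> f t"
  shows "restrict f {0..T} \<in> mspace (path_space T)"
proof -
  have "continuous_on {0..T} (restrict f {0..T})"
    using assms(1) by (rule continuous_on_cong[THEN iffD2, rotated -1]) simp_all
  then show ?thesis unfolding mspace_path_space using assms(2) by simp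
qed

lemma nat_floor_bounds:
  fixes x :: real
  assumes "x \<ge> 0"
  shows "real (nat \<lfloor>x\<rfloor>) \<le> x" "x < real (nat \<lfloor>x\<rfloor>) + 1"
  using assms by linarith+

lemma mdist_path_space_le:
  assumes "\<And>t. t \<in> {0..T} \<Longrightarrow> \<bar>f t - g t\<bar> \<le> c" "c \<ge> 0"
  shows "mdist (path_space T) f g \<le> c"
  unfolding path_space_def using assms by (intro mdist_cfunspace_le) (auto simp: dist_real_def)

text \<open>Linear interpolation of the points \<open>(n h, v n)\<close>. Interpolated chains and interpolated Euler schemes are
both of this form.\<close>

definition lin_interp :: "real \<Rightarrow> (nat \<Rightarrow> real) \<Rightarrow> real \<Rightarrow> real" where
  "lin_interp h v t = (let n = nat \<lfloor>t / h\<rfloor> in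
     (real (Suc n) - t / h) * v n + (t / h - real n) * v (Suc n))"

lemma interp_chain_eq_lin_interp:
  assumes "\<epsilon> > 0"
  shows "interp_chain F \<omega> \<epsilon> t x = lin_interp (\<epsilon>\<^sup>2) (\<lambda>n. \<epsilon> * chain F \<omega> \<epsilon> n x) t"
  using assms unfolding interp_chain_def lin_interp_def Let_def by (simp add: diff_divide_distrib)

lemma lin_interp_near:
  assumes "h > 0" "t \<ge> 0"
    and "\<bar>v (nat \<lfloor>t / h\<rfloor>) - c\<bar> \<le> r" "\<bar>v (Suc (nat \<lfloor>t / h\<rfloor>)) - c\<bar> \<le> r"
  shows "\<bar>lin_interp h v t - c\<bar> \<le> r"
proof -
  define n where "n = nat \<lfloor>t / h\<rfloor>"
  define a where "a = t / h - real n"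
  have a: "0 \<le> a" "a \<le> 1" using nat_floor_bounds[of "t / h"] divide_nonneg_pos[OF assms(2,1)] unfolding a_def n_def by linarith+
  have "lin_interp h v t - c = (1 - a) * (v n - c) + a * (v (Suc n) - c)"
    unfolding lin_interp_def Let_def n_def[symmetric] a_def by (simp add: algebra_simps)
  also have "\<bar>\<dots>\<bar> \<le> (1 - a) * \<bar>v n - c\<bar> + a * \<bar>v (Suc n) - c\<bar>"
    using a by (intro order.trans[OF abs_triangle_ineq]) (simp add: abs_mult)
  also have "\<dots> \<le> (1 - a) * r + a * r"
    using a assms(3,4) unfolding n_def[symmetric] by (intro add_mono mult_left_mono) auto
  finally show ?thesis by (simp add: algebra_simps)
qed

lemma lin_interp_nonneg:
  assumes "h > 0" "t \<ge> 0" "\<And>n. v n \<ge> 0"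
  shows "lin_interp h v t \<ge> 0"
proof -
  have "t / h - real (nat \<lfloor>t / h\<rfloor>) \<in> {0..1}" using nat_floor_bounds[of "t / h"] divide_nonneg_pos[OF assms(2,1)]
    unfolding atLeastAtMost_iff by linarith
  then show ?thesis unfolding lin_interp_def Let_def using assms(3)
    by (intro add_nonneg_nonneg mult_nonneg_nonneg) auto
qed

lemma lin_interp_diff:
  "lin_interp h v t - lin_interp h v' t = lin_interp h (\<lambda>n. v n - v' n) t"
  unfolding lin_interp_def Let_def by (simp add: algebra_simps)

text \<open>Written as a combination of hat functions, the interpolation is visibly continuous.\<close>

lemma lin_interp_hat:
  assumes "h > 0" "t \<ge> 0" "t / h < real K"
  shows "lin_interp h v t = (\<Sum>j\<le>K. v j * max 0 (1 - \<bar>t / h - real j\<bar>))"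
proof -
  define n where "n = nat \<lfloor>t / h\<rfloor>"
  have n: "real n \<le> t / h" "t / h < real n + 1" using nat_floor_bounds[of "t / h"] assms(1,2) unfolding n_def by simp_all
  then have nK: "Suc n \<le> K" using assms(3) by linarith
  have "(\<Sum>j\<le>K. v j * max 0 (1 - \<bar>t / h - real j\<bar>)) = (\<Sum>j\<in>{n, Suc n}. v j * max 0 (1 - \<bar>t / h - real j\<bar>))"
  proof (rule sum.mono_neutral_right)
    show "\<forall>i\<in>{..K} - {n, Suc n}. v i * max 0 (1 - \<bar>t / h - real i\<bar>) = 0"
    proof
      fix i assume "i \<in> {..K} - {n, Suc n}"
      then have "i + 1 \<le> n \<or> n + 2 \<le> i" by auto
      then have "1 - \<bar>t / h - real i\<bar> \<le> 0" using n by linarith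
      then show "v i * max 0 (1 - \<bar>t / h - real i\<bar>) = 0" by simp
    qed
  qed (use nK in auto)
  also have "\<dots> = v n * max 0 (1 - \<bar>t / h - real n\<bar>) + v (Suc n) * max 0 (1 - \<bar>t / h - real (Suc n)\<bar>)" by simp
  also have "1 - \<bar>t / h - real n\<bar> = real (Suc n) - t / h" using n by simp
  also have "1 - \<bar>t / h - real (Suc n)\<bar> = t / h - real n" using n by simp
  finally show ?thesis unfolding lin_interp_def Let_def n_def[symmetric] using n by (simp add: algebra_simps max_def)
qed

lemma continuous_on_lin_interp:
  assumes "h > 0"
  shows "continuous_on {0..T} (lin_interp h v)"
proof -
  obtain K :: nat where K: "T / h < real K" using reals_Archimedean2 by blast
  have "continuous_on {0..T} (\<lambda>t. \<Sum>j\<le>K. v j * max 0 (1 - \<bar>t / h - real j\<bar>))"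
    by (intro continuous_intros) (use assms in auto)
  then show ?thesis
  proof (rule continuous_on_cong[THEN iffD1, rotated -1])
    fix t assume t: "t \<in> {0..T}"
    then have "t / h \<le> T / h" using assms by (simp add: divide_right_mono)
    then show "(\<Sum>j\<le>K. v j * max 0 (1 - \<bar>t / h - real j\<bar>)) = lin_interp h v t"
      using lin_interp_hat[of h t K v] assms t K by auto
  qed simp
qed

abbreviation interp_path :: "real \<Rightarrow> real \<Rightarrow> (nat \<Rightarrow> real) \<Rightarrow> real \<Rightarrow> real" where
  "interp_path T h v \<equiv> restrict (lin_interp h v) {0..T}"

lemma interp_path_in_path_space:
  assumes "h > 0" "\<And>n. v n \<ge> 0"
  shows "interp_path T h v \<in> mspace (path_space T)"
  using assms by (intro restrict_in_path_space continuous_on_lin_interp lin_interp_nonneg) auto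

lemma mdist_interp_path_le:
  assumes "h > 0" "c \<ge> 0" "\<And>n. real n \<le> T / h + 1 \<Longrightarrow> \<bar>v n - v' n\<bar> \<le> c"
  shows "mdist (path_space T) (interp_path T h v) (interp_path T h v') \<le> c"
proof (rule mdist_path_space_le)
  fix t assume t: "t \<in> {0..T}"
  have *: "t / h \<le> T / h" using assms t by (simp add: divide_right_mono)
  have "0 \<le> t / h" using assms t by simp
  then have "real (nat \<lfloor>t / h\<rfloor>) \<le> t / h" using nat_floor_bounds(1) by auto
  with * have n: "real (nat \<lfloor>t / h\<rfloor>) \<le> T / h + 1" "real (Suc (nat \<lfloor>t / h\<rfloor>)) \<le> T / h + 1" by simp_all
  have "\<bar>lin_interp h (\<lambda>n. v n - v' n) t - 0\<bar> \<le> c"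
    using t assms(1) assms(3)[OF n(1)] assms(3)[OF n(2)] by (intro lin_interp_near) auto
  then show "\<bar>interp_path T h v t - interp_path T h v' t\<bar> \<le> c" using t lin_interp_diff[of h v t v'] by simp
qed fact

lemma tendsto_mdist_interp_path:
  assumes "h > 0" "\<And>n. real n \<le> T / h + 1 \<Longrightarrow> ((\<lambda>k. v k n) \<longlongrightarrow> v' n) F"
  shows "((\<lambda>k. mdist (path_space T) (interp_path T h (v k)) (interp_path T h v')) \<longlongrightarrow> 0) F"
proof (rule tendstoI)
  fix e :: real assume e: "e > 0"
  have fin: "finite {n::nat. real n \<le> T / h + 1}"
    by (rule finite_subset[of _ "{..nat \<lfloor>T / h + 1\<rfloor>}"]) (auto, linarith)
  have "\<forall>\<^sub>F k in F. \<forall>n\<in>{n::nat. real n \<le> T / h + 1}. \<bar>v k n - v' n\<bar> < e / 2"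
    using tendstoD[OF assms(2), of _ "e / 2"] e by (intro eventually_ball_finite[OF fin]) (auto simp: dist_real_def)
  then show "\<forall>\<^sub>F k in F. dist (mdist (path_space T) (interp_path T h (v k)) (interp_path T h v')) 0 < e"
  proof eventually_elim
    case (elim k)
    have "mdist (path_space T) (interp_path T h (v k)) (interp_path T h v') \<le> e / 2"
      using elim e by (intro mdist_interp_path_le[OF assms(1)]) auto
    then show ?case using e by (simp add: dist_real_def)
  qed
qed

text \<open>The path depends continuously, for the product topology, on the sequence of its nodes.\<close>

lemma measurable_interp_path:
  fixes v :: "'a \<Rightarrow> nat \<Rightarrow> real"
  assumes h: "h > 0" and v: "\<And>n. (\<lambda>x. v x n) \<in> borel_measurable N" and nn: "\<And>x n. x \<in> space N \<Longrightarrow> v x n \<ge> 0"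
  shows "(\<lambda>x. interp_path T h (v x)) \<in> measurable N (metric_borel (path_space T))"
proof (rule measurable_metric_borelI)
  show "interp_path T h (v x) \<in> mspace (path_space T)" if "x \<in> space N" for x
    using interp_path_in_path_space[OF h nn] that by auto
  fix \<Phi> :: "(real \<Rightarrow> real) \<Rightarrow> real"
  assume lip: "\<And>x y. x \<in> mspace (path_space T) \<Longrightarrow> y \<in> mspace (path_space T) \<Longrightarrow>
      \<bar>\<Phi> x - \<Phi> y\<bar> \<le> mdist (path_space T) x y"
  define g where "g u = \<Phi> (interp_path T h (\<lambda>n. max 0 (u n)))" for u :: "nat \<Rightarrow> real"
  have "continuous_on UNIV g"
    unfolding continuous_on_def
  proof
    fix u :: "nat \<Rightarrow> real"
    have lim: "((\<lambda>w. mdist (path_space T) (interp_path T h (\<lambda>n. max 0 (w n))) (interp_path T h (\<lambda>n. max 0 (u n)))) \<longlongrightarrow> 0) (at u)"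
    proof (rule tendsto_mdist_interp_path[OF h])
      fix n :: nat
      have "continuous_on UNIV (\<lambda>w::nat \<Rightarrow> real. w n)" by (simp add: continuous_on_product_coordinates)
      then have "((\<lambda>w::nat \<Rightarrow> real. w n) \<longlongrightarrow> u n) (at u)" by (simp add: continuous_on_def)
      then show "((\<lambda>w. max 0 (w n)) \<longlongrightarrow> max 0 (u n)) (at u)" by (intro tendsto_max tendsto_const)
    qed
    have le: "\<bar>g w - g u\<bar> \<le> mdist (path_space T) (interp_path T h (\<lambda>n. max 0 (w n))) (interp_path T h (\<lambda>n. max 0 (u n)))" for w
      unfolding g_def by (intro lip interp_path_in_path_space h) auto
    have "((\<lambda>w. g w - g u) \<longlongrightarrow> 0) (at u)"
      by (rule Lim_null_comparison[OF _ lim]) (simp only: real_norm_def le eventually_True)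
    then show "(g \<longlongrightarrow> g u) (at u within UNIV)" by (simp add: LIM_zero_cancel)
  qed
  then have "g \<in> borel_measurable borel" by (rule borel_measurable_continuous_onI)
  moreover have "v \<in> measurable N borel"
    by (rule measurable_coordinatewise_then_product) (use v in auto)
  ultimately have "(\<lambda>x. g (v x)) \<in> borel_measurable N" by (rule measurable_compose[rotated])
  moreover have "\<Phi> (interp_path T h (v x)) = g (v x)" if "x \<in> space N" for x
    unfolding g_def using nn[OF that] by (simp add: max_def)
  ultimately show "(\<lambda>x. \<Phi> (interp_path T h (v x))) \<in> borel_measurable N"
    by (simp cong: measurable_cong)
qed

lemma floor_grid:
  fixes t h :: real
  assumes "h > 0" "t \<ge> 0"
  shows "real (nat \<lfloor>t / h\<rfloor>) * h \<le> t" "t < (real (nat \<lfloor>t / h\<rfloor>) + 1) * h"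
  using nat_floor_bounds[of "t / h"] divide_nonneg_pos[OF assms(2,1)] assms(1)
  by (simp_all only: pos_le_divide_eq pos_divide_less_eq)

lemma measurable_path:
  fixes R :: "real \<Rightarrow> 'a \<Rightarrow> real"
  assumes meas: "\<And>t. t \<ge> 0 \<Longrightarrow> R t \<in> borel_measurable N"
    and cont: "\<And>y. y \<in> space N \<Longrightarrow> continuous_on {0..} (\<lambda>t. R t y)"
    and nn: "\<And>y t. y \<in> space N \<Longrightarrow> t \<ge> 0 \<Longrightarrow> R t y \<ge> 0"
  shows "(\<lambda>y. restrict (\<lambda>t. R t y) {0..T}) \<in> measurable N (metric_borel (path_space T))"
proof (rule measurable_metric_borel_LIMSEQ)
  let ?h = "\<lambda>k. 1 / real (Suc k)"
  show "(\<lambda>y. interp_path T (?h k) (\<lambda>n. R (real n * ?h k) y)) \<in> measurable N (metric_borel (path_space T))" for k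
    using nn meas by (intro measurable_interp_path) auto
  fix y assume y: "y \<in> space N"
  show "restrict (\<lambda>t. R t y) {0..T} \<in> mspace (path_space T)"
    using nn[OF y] by (intro restrict_in_path_space continuous_on_subset[OF cont[OF y]]) auto
  show "(\<lambda>k. mdist (path_space T) (interp_path T (?h k) (\<lambda>n. R (real n * ?h k) y)) (restrict (\<lambda>t. R t y) {0..T})) \<longlonglongrightarrow> 0"
  proof (rule LIMSEQ_I)
    fix r :: real assume r: "r > 0"
    have "uniformly_continuous_on {0..T + 1} (\<lambda>t. R t y)"
      by (intro compact_uniformly_continuous continuous_on_subset[OF cont[OF y]]) auto
    then obtain d where d: "d > 0"
      "\<And>s t. s \<in> {0..T+1} \<Longrightarrow> t \<in> {0..T+1} \<Longrightarrow> dist t s < d \<Longrightarrow> dist (R t y) (R s y) < r / 2"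
      using r by (elim uniformly_continuous_onE[of _ _ "r/2"]) auto
    have key: "mdist (path_space T) (interp_path T h (\<lambda>n. R (real n * h) y)) (restrict (\<lambda>t. R t y) {0..T}) \<le> r / 2"
      if h: "h > 0" "h \<le> 1" "h < d / 2" for h
    proof (rule mdist_path_space_le)
      fix t assume t: "t \<in> {0..T}"
      define n where "n = nat \<lfloor>t / h\<rfloor>"
      have n: "real n * h \<le> t" "t < real n * h + h"
        unfolding n_def using floor_grid[of h t] h t by (auto simp: distrib_right)
      have n': "real (Suc n) * h = real n * h + h" by (simp add: distrib_right)
      have n0: "real n * h \<ge> 0" using h by simp
      have r1: "real n * h \<in> {0..T+1}" "\<bar>real n * h - t\<bar> < d" using n n0 h t by auto
      have r2: "real (Suc n) * h \<in> {0..T+1}" "\<bar>real (Suc n) * h - t\<bar> < d"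
        using n n0 t h unfolding n' by auto
      have "\<bar>R (real n * h) y - R t y\<bar> \<le> r / 2" "\<bar>R (real (Suc n) * h) y - R t y\<bar> \<le> r / 2"
        using d(2)[of t, OF _ r1(1)] d(2)[of t, OF _ r2(1)] r1(2) r2(2) t unfolding dist_real_def by auto
      then have "\<bar>lin_interp h (\<lambda>n. R (real n * h) y) t - R t y\<bar> \<le> r / 2"
        unfolding n_def by (intro lin_interp_near) (use h t in auto)
      then show "\<bar>interp_path T h (\<lambda>n. R (real n * h) y) t - restrict (\<lambda>t. R t y) {0..T} t\<bar> \<le> r / 2"
        using t by simp
    qed (use r in simp)
    obtain k0 where "inverse (real (Suc k0)) < d / 2"
      using reals_Archimedean[of "d / 2"] half_gt_zero[OF d(1)] by blast
    then have k0: "?h k0 < d / 2" by (simp only: inverse_eq_divide)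
    show "\<exists>no. \<forall>n\<ge>no. norm (mdist (path_space T) (interp_path T (?h n) (\<lambda>na. R (real na * ?h n) y)) (restrict (\<lambda>t. R t y) {0..T}) - 0) < r"
    proof (intro exI[of _ k0] allI impI)
      fix k assume k: "k0 \<le> k"
      have "?h k \<le> ?h k0" using k by (intro divide_left_mono) auto
      then have "?h k < d / 2" using k0 by (rule le_less_trans)
      moreover have "?h k > 0" "?h k \<le> 1" by simp_all
      ultimately have "mdist (path_space T) (interp_path T (?h k) (\<lambda>n. R (real n * ?h k) y)) (restrict (\<lambda>t. R t y) {0..T}) \<le> r / 2"
        by (intro key)
      also have "r / 2 < r" using r by simp
      finally show "norm (mdist (path_space T) (interp_path T (?h k) (\<lambda>n. R (real n * ?h k) y)) (restrict (\<lambda>t. R t y) {0..T}) - 0) < r"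
        by (simp only: real_norm_def diff_zero abs_of_nonneg mdist_nonneg)
    qed
  qed
qed

section \<open>Maximal inequalities for bounded independent noise\<close>

text \<open>Ville's inequality. The supermartingale property is only asked for on the event that the level \<open>l\<close>
has not been reached, which is what a function that is superharmonic in part of the state space
provides. The induction carries along the mass that has not yet reached the level.\<close>

lemma maximal_inequality_supermartingale:
  fixes X :: "nat \<Rightarrow> 'a \<Rightarrow> ennreal"
  assumes [measurable]: "\<And>k. X k \<in> borel_measurable P"
    and step: "\<And>k. (\<integral>\<^sup>+x. X (Suc k) x * indicator {x. \<forall>j\<le>k. X j x < l} x \<partial>P)
                  \<le> (\<integral>\<^sup>+x. X k x * indicator {x. \<forall>j\<le>k. X j x < l} x \<partial>P)"
  shows "l * emeasure P {x\<in>space P. \<exists>k\<le>n. l \<le> X k x} \<le> (\<integral>\<^sup>+x. X 0 x \<partial>P)"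
proof -
  have split: "l * emeasure P {x\<in>space P. Q x \<and> l \<le> Y x} + (\<integral>\<^sup>+x. Y x * indicator {x. Q x \<and> Y x < l} x \<partial>P)
      \<le> (\<integral>\<^sup>+x. Y x * indicator {x. Q x} x \<partial>P)"
    if [measurable]: "Y \<in> borel_measurable P" "Measurable.pred P Q" for Y Q
  proof -
    have "l * emeasure P {x\<in>space P. Q x \<and> l \<le> Y x} = (\<integral>\<^sup>+x. l * indicator {x\<in>space P. Q x \<and> l \<le> Y x} x \<partial>P)"
      by (subst nn_integral_cmult_indicator) auto
    then have "l * emeasure P {x\<in>space P. Q x \<and> l \<le> Y x} + (\<integral>\<^sup>+x. Y x * indicator {x. Q x \<and> Y x < l} x \<partial>P)
      = (\<integral>\<^sup>+x. l * indicator {x\<in>space P. Q x \<and> l \<le> Y x} x + Y x * indicator {x. Q x \<and> Y x < l} x \<partial>P)"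
      by (simp add: nn_integral_add)
    also have "\<dots> \<le> (\<integral>\<^sup>+x. Y x * indicator {x. Q x} x \<partial>P)"
      by (intro nn_integral_mono) (auto simp: indicator_def)
    finally show ?thesis .
  qed
  have "l * emeasure P {x\<in>space P. \<exists>k\<le>n. l \<le> X k x} +
      (\<integral>\<^sup>+x. X n x * indicator {x. \<forall>j\<le>n. X j x < l} x \<partial>P) \<le> (\<integral>\<^sup>+x. X 0 x \<partial>P)" (is "?L n \<le> ?R")
  proof (induction n)
    case 0
    show ?case using split[of "X 0" "\<lambda>_. True"] by simp
  next
    case (Suc n)
    have "{x\<in>space P. \<exists>k\<le>Suc n. l \<le> X k x} =
      {x\<in>space P. \<exists>k\<le>n. l \<le> X k x} \<union> {x\<in>space P. (\<forall>j\<le>n. X j x < l) \<and> l \<le> X (Suc n) x}"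
      unfolding le_Suc_eq using not_le by blast
    then have "emeasure P {x\<in>space P. \<exists>k\<le>Suc n. l \<le> X k x} \<le>
      emeasure P {x\<in>space P. \<exists>k\<le>n. l \<le> X k x} + emeasure P {x\<in>space P. (\<forall>j\<le>n. X j x < l) \<and> l \<le> X (Suc n) x}"
      by (simp only:) (rule emeasure_subadditive; measurable)
    then have "l * emeasure P {x\<in>space P. \<exists>k\<le>Suc n. l \<le> X k x} \<le>
      l * emeasure P {x\<in>space P. \<exists>k\<le>n. l \<le> X k x} + l * emeasure P {x\<in>space P. (\<forall>j\<le>n. X j x < l) \<and> l \<le> X (Suc n) x}"
      unfolding distrib_left[symmetric] by (rule mult_left_mono) simp
    moreover have "{x. \<forall>j\<le>Suc n. X j x < l} = {x. (\<forall>j\<le>n. X j x < l) \<and> X (Suc n) x < l}"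
      by (auto simp: le_Suc_eq)
    ultimately have "?L (Suc n) \<le> l * emeasure P {x\<in>space P. \<exists>k\<le>n. l \<le> X k x} +
      (l * emeasure P {x\<in>space P. (\<forall>j\<le>n. X j x < l) \<and> l \<le> X (Suc n) x} +
       (\<integral>\<^sup>+x. X (Suc n) x * indicator {x. (\<forall>j\<le>n. X j x < l) \<and> X (Suc n) x < l} x \<partial>P))"
      by (simp add: add.assoc[symmetric] add_right_mono)
    also have "\<dots> \<le> l * emeasure P {x\<in>space P. \<exists>k\<le>n. l \<le> X k x} +
        (\<integral>\<^sup>+x. X (Suc n) x * indicator {x. \<forall>j\<le>n. X j x < l} x \<partial>P)"
      by (intro add_left_mono split) auto
    also have "\<dots> \<le> ?L n" by (intro add_left_mono step)
    finally show ?case using Suc.IH by (rule order.trans)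
  qed
  then show ?thesis by (rule order.trans[rotated]) simp
qed

locale bounded_iid = prob_space P for P :: "'a measure" +
  fixes w :: "nat \<Rightarrow> 'a \<Rightarrow> real" and M :: real
  assumes indep: "indep_vars (\<lambda>_. borel) w UNIV"
    and ident: "\<And>k. distr P borel (w k) = distr P borel (w 0)"
    and mean: "\<And>k. expectation (w k) = 0"
    and second_moment: "\<And>k. expectation (\<lambda>x. (w k x)\<^sup>2) = 1"
    and bounded: "\<And>k x. x \<in> space P \<Longrightarrow> \<bar>w k x\<bar> \<le> M"
begin

lemma w_measurable [measurable]: "w k \<in> borel_measurable P"
  using indep unfolding indep_vars_def by auto

lemma M_nonneg: "M \<ge> 0"
  using bounded not_empty by (metis abs_ge_zero all_not_in_conv order.trans)

lemma integrable_w: "integrable P (w k)" and integrable_w2: "integrable P (\<lambda>x. (w k x)\<^sup>2)"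
proof -
  show "integrable P (w k)"
    using bounded by (intro integrable_const_bound[of _ M]) auto
  show "integrable P (\<lambda>x. (w k x)\<^sup>2)"
    using bounded M_nonneg by (intro integrable_const_bound[of _ "M\<^sup>2"]) (auto simp: abs_le_square_iff[symmetric])
qed

text \<open>The sigma-algebra of the first \<open>k\<close> noise variables.\<close>

definition hist :: "nat \<Rightarrow> 'a measure" where
  "hist k = vimage_algebra (space P) (\<lambda>x. \<lambda>j\<in>{..<k}. w j x) (PiM {..<k} (\<lambda>_. borel))"

lemma space_hist [simp]: "space (hist k) = space P"
  unfolding hist_def by simp

lemma sets_hist: "sets (hist k) =
    {(\<lambda>x. \<lambda>j\<in>{..<k}. w j x) -` A \<inter> space P | A. A \<in> sets (PiM {..<k} (\<lambda>_. borel))}"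
  unfolding hist_def by (rule sets_vimage_algebra2) (auto simp: space_PiM)

lemma w_measurable_hist: "j < k \<Longrightarrow> w j \<in> borel_measurable (hist k)"
proof -
  assume j: "j < k"
  have "(\<lambda>x. \<lambda>j\<in>{..<k}. w j x) \<in> measurable (hist k) (PiM {..<k} (\<lambda>_. borel))"
    unfolding hist_def by (rule measurable_vimage_algebra1) (auto simp: space_PiM)
  from measurable_compose[OF this measurable_component_singleton, of j]
  show ?thesis using j by simp
qed

lemma measurable_hist_mono: "j \<le> k \<Longrightarrow> f \<in> measurable (hist j) S \<Longrightarrow> f \<in> measurable (hist k) S"
proof -
  assume jk: "j \<le> k" and f: "f \<in> measurable (hist j) S"
  have "(\<lambda>x. x) \<in> measurable (hist k) (hist j)"
    unfolding hist_def[of j]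
    by (rule measurable_vimage_algebra2)
       (use jk in \<open>auto intro!: measurable_restrict w_measurable_hist\<close>)
  from measurable_compose[OF this f] show ?thesis by simp
qed

lemma measurable_hist_imp: "f \<in> measurable (hist j) S \<Longrightarrow> f \<in> measurable P S"
proof -
  assume f: "f \<in> measurable (hist j) S"
  have "(\<lambda>x. x) \<in> measurable P (hist j)"
    unfolding hist_def by (rule measurable_vimage_algebra2) (auto intro!: measurable_restrict)
  from measurable_compose[OF this f] show ?thesis by simp
qed

text \<open>Independence of the past and the next noise variable. The past is represented by the sample point itself,
observed through the history; this makes every quantity that is determined by the past a function of the
first component.\<close>

lemma distr_hist_next:
  "distr P (hist k \<Otimes>\<^sub>M borel) (\<lambda>x. (x, w k x)) = distr P (hist k) (\<lambda>x. x) \<Otimes>\<^sub>M distr P borel (w k)"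
proof -
  have id [measurable]: "(\<lambda>x. x) \<in> measurable P (hist k)" using measurable_hist_imp[of "\<lambda>x. x" k "hist k"] by simp
  interpret Q: prob_space "distr P borel (w k)" by (rule prob_space_distr) simp
  interpret R: prob_space "distr P (hist k) (\<lambda>x. x)" by (rule prob_space_distr) simp
  have ind: "indep_var (PiM {..<k} (\<lambda>_. borel)) (\<lambda>x. \<lambda>j\<in>{..<k}. w j x) (PiM {k} (\<lambda>_. borel)) (\<lambda>x. \<lambda>j\<in>{k}. w j x)"
    by (rule indep_var_restrict[OF indep]) auto
  show ?thesis
  proof (rule pair_measure_eqI[symmetric])
    show "sigma_finite_measure (distr P (hist k) (\<lambda>x. x))" "sigma_finite_measure (distr P borel (w k))"
      by unfold_locales
    show "sets (distr P (hist k) (\<lambda>x. x) \<Otimes>\<^sub>M distr P borel (w k)) = sets (distr P (hist k \<Otimes>\<^sub>M borel) (\<lambda>x. (x, w k x)))"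
      by (simp cong: sets_pair_measure_cong)
    fix A B assume "A \<in> sets (distr P (hist k) (\<lambda>x. x))" and "B \<in> sets (distr P borel (w k))"
    then have A: "A \<in> sets (hist k)" and B [measurable]: "B \<in> sets borel" by simp_all
    have AP: "A \<in> sets P" using measurable_sets[OF id A] sets.sets_into_space[OF A] by (simp add: Int_absorb2)
    obtain A' where A': "A' \<in> sets (PiM {..<k} (\<lambda>_. borel))" "A = (\<lambda>x. \<lambda>j\<in>{..<k}. w j x) -` A' \<inter> space P"
      using A unfolding sets_hist by auto
    define B' where "B' = {h \<in> space (PiM {k} (\<lambda>_. borel :: real measure)). h k \<in> B}"
    have B': "B' \<in> sets (PiM {k} (\<lambda>_. borel))" unfolding B'_def by measurable
    have wB: "(\<lambda>x. \<lambda>j\<in>{k}. w j x) -` B' \<inter> space P = w k -` B \<inter> space P"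
      unfolding B'_def by (auto simp: space_PiM)
    have "prob (A \<inter> (w k -` B \<inter> space P)) = prob A * prob (w k -` B \<inter> space P)"
    proof -
      have "(\<lambda>x. (\<lambda>j\<in>{..<k}. w j x, \<lambda>j\<in>{k}. w j x)) -` (A' \<times> B') \<inter> space P =
          A \<inter> ((\<lambda>x. \<lambda>j\<in>{k}. w j x) -` B' \<inter> space P)" unfolding A'(2) by blast
      then show ?thesis
        using indep_varD[OF ind A'(1) B'] unfolding wB[symmetric] A'(2)[symmetric] by simp
    qed
    moreover have "(\<lambda>x. (x, w k x)) -` (A \<times> B) \<inter> space P = A \<inter> (w k -` B \<inter> space P)"
      using sets.sets_into_space[OF AP] by auto
    moreover have "A \<inter> space P = A" using sets.sets_into_space[OF AP] by auto
    ultimately show "emeasure (distr P (hist k) (\<lambda>x. x)) A * emeasure (distr P borel (w k)) B =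
        emeasure (distr P (hist k \<Otimes>\<^sub>M borel) (\<lambda>x. (x, w k x))) (A \<times> B)"
      using A B by (simp add: emeasure_distr emeasure_eq_measure ennreal_mult')
  qed
qed

text \<open>Conditioning on the history: the next noise variable is integrated out with the past frozen. Every
one-step estimate below goes through this identity.\<close>

lemma nn_integral_next:
  assumes f: "(\<lambda>(x, u). f x u) \<in> borel_measurable (hist k \<Otimes>\<^sub>M borel)"
  shows "(\<integral>\<^sup>+x. f x (w k x) \<partial>P) = (\<integral>\<^sup>+x. \<integral>\<^sup>+y. f x (w k y) \<partial>P \<partial>P)"
proof -
  have id: "(\<lambda>x. x) \<in> measurable P (hist k)" using measurable_hist_imp[of "\<lambda>x. x" k "hist k"] by simp
  interpret Q: prob_space "distr P borel (w k)" by (rule prob_space_distr) simp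
  have inner: "(\<lambda>x. \<integral>\<^sup>+u. f x u \<partial>distr P borel (w k)) \<in> borel_measurable (hist k)"
  proof -
    have "(\<lambda>(x, u). f x u) \<in> borel_measurable (hist k \<Otimes>\<^sub>M distr P borel (w k))"
      using f by (simp cong: measurable_cong_sets)
    then show ?thesis by (rule Q.borel_measurable_nn_integral)
  qed
  have fx: "f x \<in> borel_measurable borel" if "x \<in> space P" for x
    using measurable_compose[OF measurable_Pair1' f, of x] that by simp
  have "(\<integral>\<^sup>+x. f x (w k x) \<partial>P) = (\<integral>\<^sup>+z. (case z of (x, u) \<Rightarrow> f x u) \<partial>distr P (hist k \<Otimes>\<^sub>M borel) (\<lambda>x. (x, w k x)))"
    by (subst nn_integral_distr) (use f id in auto)
  also have "distr P (hist k \<Otimes>\<^sub>M borel) (\<lambda>x. (x, w k x)) = distr P (hist k) (\<lambda>x. x) \<Otimes>\<^sub>M distr P borel (w k)"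
    by (rule distr_hist_next)
  also have "(\<integral>\<^sup>+z. (case z of (x, u) \<Rightarrow> f x u) \<partial>(distr P (hist k) (\<lambda>x. x) \<Otimes>\<^sub>M distr P borel (w k)))
     = (\<integral>\<^sup>+x. \<integral>\<^sup>+u. f x u \<partial>distr P borel (w k) \<partial>distr P (hist k) (\<lambda>x. x))"
    using f by (subst Q.nn_integral_fst[symmetric]) (simp_all cong: measurable_cong_sets)
  also have "\<dots> = (\<integral>\<^sup>+x. \<integral>\<^sup>+u. f x u \<partial>distr P borel (w k) \<partial>P)"
    by (subst nn_integral_distr) (use id inner in auto)
  also have "\<dots> = (\<integral>\<^sup>+x. \<integral>\<^sup>+y. f x (w k y) \<partial>P \<partial>P)"
    by (intro nn_integral_cong nn_integral_distr) (use fx in auto)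
  finally show ?thesis .
qed

text \<open>The supermartingale property in the form in which it is checked: for a frozen past, integrating over the
next noise variable.\<close>

lemma maximal_inequality_adapted:
  fixes V :: "nat \<Rightarrow> 'a \<Rightarrow> ennreal" and F :: "nat \<Rightarrow> 'a \<Rightarrow> real \<Rightarrow> ennreal"
  assumes Vm: "\<And>k. V k \<in> borel_measurable (hist k)"
    and Fm: "\<And>k. (\<lambda>(x, u). F k x u) \<in> borel_measurable (hist k \<Otimes>\<^sub>M borel)"
    and evol: "\<And>k x. V (Suc k) x = F k x (w k x)"
    and drift: "\<And>k x. x \<in> space P \<Longrightarrow> V k x < L \<Longrightarrow> (\<integral>\<^sup>+y. F k x (w k y) \<partial>P) \<le> V k x"
  shows "L * emeasure P {x\<in>space P. \<exists>k\<le>n. L \<le> V k x} \<le> (\<integral>\<^sup>+x. V 0 x \<partial>P)"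
proof (rule maximal_inequality_supermartingale)
  show "V k \<in> borel_measurable P" for k by (rule measurable_hist_imp[OF Vm])
  fix k
  let ?B = "{x. \<forall>j\<le>k. V j x < L}"
  have "{x \<in> space (hist k). V j x < L} \<in> sets (hist k)" if "j \<in> {..k}" for j
  proof -
    have [measurable]: "V j \<in> borel_measurable (hist k)"
      by (rule measurable_hist_mono[OF _ Vm]) (use that in simp)
    show ?thesis by measurable
  qed
  then have "{x \<in> space (hist k). \<forall>j\<in>{..k}. V j x < L} \<in> sets (hist k)"
    by (rule sets.sets_Collect_finite_All') auto
  then have "{x \<in> space (hist k). x \<in> ?B} \<in> sets (hist k)"
    by (simp only: mem_Collect_eq Ball_def atMost_iff)
  then have Bm: "(\<lambda>x. indicator ?B x :: ennreal) \<in> borel_measurable (hist k)"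
    by (rule borel_measurable_indicator')
  have FBm: "(\<lambda>(x, u). F k x u * indicator ?B x) \<in> borel_measurable (hist k \<Otimes>\<^sub>M borel)"
    using borel_measurable_times_ennreal[OF Fm[of k] measurable_compose[OF measurable_fst Bm]]
    by (simp only: case_prod_beta')
  have "(\<integral>\<^sup>+x. V (Suc k) x * indicator ?B x \<partial>P) = (\<integral>\<^sup>+x. \<integral>\<^sup>+y. F k x (w k y) * indicator ?B x \<partial>P \<partial>P)"
    unfolding evol by (rule nn_integral_next[OF FBm])
  also have "\<dots> \<le> (\<integral>\<^sup>+x. V k x * indicator ?B x \<partial>P)"
  proof (rule nn_integral_mono)
    fix x assume x: "x \<in> space P"
    show "(\<integral>\<^sup>+y. F k x (w k y) * indicator ?B x \<partial>P) \<le> V k x * indicator ?B x"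
    proof (cases "x \<in> ?B")
      case True
      then have "V k x < L" by simp
      from drift[OF x this] show ?thesis using True by simp
    qed simp
  qed
  finally show "(\<integral>\<^sup>+x. V (Suc k) x * indicator ?B x \<partial>P) \<le> (\<integral>\<^sup>+x. V k x * indicator ?B x \<partial>P)" .
qed

text \<open>The exponential process \<open>exp (\<theta> S\<^sub>k - \<theta>\<^sup>2 \<Sum> c\<^sub>j\<^sup>2 / 2)\<close> is a supermartingale by Hoeffding's lemma, and
its maximal inequality with \<open>\<theta> = a / v\<close> is the claim. The bounds \<open>c\<close> may depend on the time, so that
sums over a block of times are covered by setting the other terms to zero.\<close>

lemma azuma_maximal:
  fixes \<phi> :: "nat \<Rightarrow> 'a \<Rightarrow> real \<Rightarrow> real"
  assumes meas: "\<And>k. (\<lambda>(x, u). \<phi> k x u) \<in> borel_measurable (hist k \<Otimes>\<^sub>M borel)"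
    and bd: "\<And>k x y. x \<in> space P \<Longrightarrow> y \<in> space P \<Longrightarrow> \<bar>\<phi> k x (w k y)\<bar> \<le> c k"
    and mean0: "\<And>k x. x \<in> space P \<Longrightarrow> expectation (\<lambda>y. \<phi> k x (w k y)) = 0"
    and v: "(\<Sum>k<n. (c k)\<^sup>2) \<le> v" "v > 0" and a: "a > 0"
  shows "prob {x\<in>space P. \<exists>k\<le>n. a \<le> (\<Sum>j<k. \<phi> j x (w j x))} \<le> exp (- a\<^sup>2 / (2 * v))"
proof -
  let ?S = "{x\<in>space P. \<exists>k\<le>n. a \<le> (\<Sum>j<k. \<phi> j x (w j x))}"
  define D where "D j x = \<phi> j x (w j x)" for j x
  have Dm: "D j \<in> borel_measurable (hist k)" if "j < k" for j k
  proof -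
    have "(\<lambda>x. x) \<in> measurable (hist k) (hist j)"
      using measurable_hist_mono[of j k "\<lambda>x. x" "hist j"] that by simp
    then have "(\<lambda>x. (x, w j x)) \<in> measurable (hist k) (hist j \<Otimes>\<^sub>M borel)"
      using w_measurable_hist[OF that] by (rule measurable_Pair)
    from measurable_compose[OF this meas[of j]] show ?thesis unfolding D_def by simp
  qed
  define \<theta> where "\<theta> = a / v"
  have \<theta>: "\<theta> > 0" unfolding \<theta>_def using a v by simp
  define E where "E k x = exp (\<theta> * (\<Sum>j<k. D j x) - \<theta>\<^sup>2 * (\<Sum>j<k. (c j)\<^sup>2) / 2)" for k x
  define X where "X k x = ennreal (E k x)" for k x
  have Em: "E j \<in> borel_measurable (hist k)" if "j \<le> k" for j k
  proof -
    have [measurable]: "(\<lambda>x. \<Sum>i<j. D i x) \<in> borel_measurable (hist k)"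
      by (rule borel_measurable_sum) (use Dm that in auto)
    show ?thesis unfolding E_def by measurable
  qed
  have Xm: "X j \<in> borel_measurable (hist k)" if "j \<le> k" for j k
    unfolding X_def using Em[OF that] by measurable
  define L where "L = ennreal (exp (\<theta> * a - \<theta>\<^sup>2 * v / 2))"
  have c0: "c k \<ge> 0" for k
    using bd[of _ _ k] not_empty by (metis abs_ge_zero all_not_in_conv order.trans)
  have hoeff: "(\<integral>\<^sup>+y. ennreal (exp (\<theta> * \<phi> k x (w k y))) \<partial>P) \<le> ennreal (exp (\<theta>\<^sup>2 * (c k)\<^sup>2 / 2))" if x: "x \<in> space P" for k x
  proof -
    have [measurable]: "\<phi> k x \<in> borel_measurable borel"
      using measurable_compose[OF measurable_Pair1' meas[of k], of x] x by simp
    interpret I: interval_bounded_random_variable P "\<lambda>y. \<phi> k x (w k y)" "- c k" "c k"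
    proof unfold_locales
      show "random_variable borel (\<lambda>y. \<phi> k x (w k y))" by measurable
      show "AE y in P. \<phi> k x (w k y) \<in> {- c k..c k}"
        using bd[OF x] by (intro AE_I2) (simp add: abs_le_iff minus_le_iff)
    qed
    have "\<theta>\<^sup>2 * (c k - - c k)\<^sup>2 / 8 = \<theta>\<^sup>2 * (c k)\<^sup>2 / 2" by (simp add: power2_eq_square)
    with I.Hoeffdings_lemma_nn_integral_0[OF \<theta> mean0[OF x]] show ?thesis by (simp only:)
  qed
  define f where "f k x u = X k x * ennreal (exp (- (\<theta>\<^sup>2 * (c k)\<^sup>2 / 2))) * ennreal (exp (\<theta> * \<phi> k x u))" for k x u
  have "L * emeasure P {x\<in>space P. \<exists>k\<le>n. L \<le> X k x} \<le> (\<integral>\<^sup>+x. X 0 x \<partial>P)"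
  proof (rule maximal_inequality_adapted[where F=f])
    fix k
    show Xk [measurable]: "X k \<in> borel_measurable (hist k)" by (rule Xm[OF order_refl])
    show "(\<lambda>(x, u). f k x u) \<in> borel_measurable (hist k \<Otimes>\<^sub>M borel)"
      unfolding f_def using meas[of k] by measurable
    fix x
    have "E (Suc k) x = E k x * exp (- (\<theta>\<^sup>2 * (c k)\<^sup>2 / 2)) * exp (\<theta> * D k x)"
      unfolding E_def exp_add[symmetric] by (simp add: algebra_simps add_divide_distrib)
    then show "X (Suc k) x = f k x (w k x)"
      unfolding f_def X_def E_def D_def by (simp add: ennreal_mult')
    assume x: "x \<in> space P"
    have [measurable]: "\<phi> k x \<in> borel_measurable borel"
      using measurable_compose[OF measurable_Pair1' meas[of k], of x] x by simp
    have "(\<integral>\<^sup>+y. f k x (w k y) \<partial>P) = X k x * ennreal (exp (- (\<theta>\<^sup>2 * (c k)\<^sup>2 / 2))) * (\<integral>\<^sup>+y. ennreal (exp (\<theta> * \<phi> k x (w k y))) \<partial>P)"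
      unfolding f_def by (rule nn_integral_cmult) measurable
    also have "\<dots> \<le> X k x * ennreal (exp (- (\<theta>\<^sup>2 * (c k)\<^sup>2 / 2))) * ennreal (exp (\<theta>\<^sup>2 * (c k)\<^sup>2 / 2))"
      by (intro mult_left_mono hoeff x) simp
    also have "\<dots> = X k x" by (simp add: mult.assoc ennreal_mult'[symmetric] exp_add[symmetric])
    finally show "(\<integral>\<^sup>+y. f k x (w k y) \<partial>P) \<le> X k x" .
  qed
  also have "(\<integral>\<^sup>+x. X 0 x \<partial>P) = 1" unfolding X_def E_def by (simp add: emeasure_space_1)
  finally have *: "L * emeasure P {x\<in>space P. \<exists>k\<le>n. L \<le> X k x} \<le> 1" .
  have [measurable]: "X k \<in> borel_measurable P" "D k \<in> borel_measurable P" for k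
    using Xm[of k k] Dm[of k "Suc k"] by (auto dest: measurable_hist_imp)
  have "?S \<subseteq> {x\<in>space P. \<exists>k\<le>n. L \<le> X k x}"
  proof clarsimp
    fix x k assume x: "x \<in> space P" and k: "k \<le> n" and "a \<le> (\<Sum>j<k. \<phi> j x (w j x))"
    then have ax: "a \<le> (\<Sum>j<k. D j x)" by (simp add: D_def)
    have "(\<Sum>j<k. (c j)\<^sup>2) \<le> v"
      using sum_mono2[of "{..<n}" "{..<k}" "\<lambda>j. (c j)\<^sup>2"] k v by fastforce
    then have "\<theta> * a - \<theta>\<^sup>2 * v / 2 \<le> \<theta> * (\<Sum>j<k. D j x) - \<theta>\<^sup>2 * (\<Sum>j<k. (c j)\<^sup>2) / 2"
      using ax \<theta> by (intro diff_mono divide_right_mono mult_left_mono) auto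
    then show "\<exists>k\<le>n. L \<le> X k x" unfolding L_def X_def E_def using k by (auto intro!: exI[of _ k] ennreal_leI)
  qed
  then have "emeasure P ?S \<le> emeasure P {x\<in>space P. \<exists>k\<le>n. L \<le> X k x}"
    by (rule emeasure_mono) measurable
  from order.trans[OF mult_left_mono[OF this zero_le] *]
  have "ennreal (exp (\<theta> * a - \<theta>\<^sup>2 * v / 2) * prob ?S) \<le> ennreal 1"
    unfolding L_def emeasure_eq_measure by (simp only: ennreal_mult' measure_nonneg exp_ge_zero ennreal_1)
  then have "exp (\<theta> * a - \<theta>\<^sup>2 * v / 2) * prob ?S \<le> 1"
    by (simp only: ennreal_le_iff zero_le_one)
  from mult_left_mono[OF this, of "exp (- (\<theta> * a - \<theta>\<^sup>2 * v / 2))"]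
  have "prob ?S \<le> exp (- (\<theta> * a - \<theta>\<^sup>2 * v / 2))"
    by (simp only: mult.assoc[symmetric] exp_add[symmetric] left_minus exp_zero mult_1 mult_1_right exp_ge_zero)
  also have "- (\<theta> * a - \<theta>\<^sup>2 * v / 2) = - a\<^sup>2 / (2 * v)"
    unfolding \<theta>_def using v by (simp add: field_simps power2_eq_square)
  finally show ?thesis .
qed

lemma azuma_maximal_abs:
  fixes \<phi> :: "nat \<Rightarrow> 'a \<Rightarrow> real \<Rightarrow> real"
  assumes meas: "\<And>k. (\<lambda>(x, u). \<phi> k x u) \<in> borel_measurable (hist k \<Otimes>\<^sub>M borel)"
    and bd: "\<And>k x y. x \<in> space P \<Longrightarrow> y \<in> space P \<Longrightarrow> \<bar>\<phi> k x (w k y)\<bar> \<le> c k"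
    and mean0: "\<And>k x. x \<in> space P \<Longrightarrow> expectation (\<lambda>y. \<phi> k x (w k y)) = 0"
    and v: "(\<Sum>k<n. (c k)\<^sup>2) \<le> v" "v > 0" and a: "a > 0"
  shows "{x\<in>space P. \<exists>k\<le>n. a \<le> \<bar>\<Sum>j<k. \<phi> j x (w j x)\<bar>} \<in> events"
    "prob {x\<in>space P. \<exists>k\<le>n. a \<le> \<bar>\<Sum>j<k. \<phi> j x (w j x)\<bar>} \<le> 2 * exp (- a\<^sup>2 / (2 * v))"
proof -
  have [measurable]: "(\<lambda>x. \<phi> j x (w j x)) \<in> borel_measurable P" for j
  proof -
    have "(\<lambda>x. x) \<in> measurable P (hist j)" using measurable_hist_imp[of "\<lambda>x. x" j "hist j"] by simp
    then have "(\<lambda>x. (x, w j x)) \<in> measurable P (hist j \<Otimes>\<^sub>M borel)" by (rule measurable_Pair) simp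
    from measurable_compose[OF this meas[of j]] show ?thesis by simp
  qed
  show "{x\<in>space P. \<exists>k\<le>n. a \<le> \<bar>\<Sum>j<k. \<phi> j x (w j x)\<bar>} \<in> events" by measurable
  have "{x\<in>space P. \<exists>k\<le>n. a \<le> \<bar>\<Sum>j<k. \<phi> j x (w j x)\<bar>} =
      {x\<in>space P. \<exists>k\<le>n. a \<le> (\<Sum>j<k. \<phi> j x (w j x))} \<union> {x\<in>space P. \<exists>k\<le>n. a \<le> (\<Sum>j<k. - \<phi> j x (w j x))}"
    (is "?A = ?B \<union> ?C")
  proof -
    have "a \<le> \<bar>s\<bar> \<longleftrightarrow> a \<le> s \<or> a \<le> - s" for s using a by (auto simp: abs_if)
    then show ?thesis unfolding sum_negf by blast
  qed
  then have "prob {x\<in>space P. \<exists>k\<le>n. a \<le> \<bar>\<Sum>j<k. \<phi> j x (w j x)\<bar>} \<le>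
     prob {x\<in>space P. \<exists>k\<le>n. a \<le> (\<Sum>j<k. \<phi> j x (w j x))} + prob {x\<in>space P. \<exists>k\<le>n. a \<le> (\<Sum>j<k. - \<phi> j x (w j x))}"
    by (simp add: measure_Un_le)
  moreover have "prob {x\<in>space P. \<exists>k\<le>n. a \<le> (\<Sum>j<k. \<phi> j x (w j x))} \<le> exp (- a\<^sup>2 / (2 * v))"
    by (rule azuma_maximal[OF meas bd mean0 v a])
  moreover have "prob {x\<in>space P. \<exists>k\<le>n. a \<le> (\<Sum>j<k. - \<phi> j x (w j x))} \<le> exp (- a\<^sup>2 / (2 * v))"
  proof (rule azuma_maximal[where \<phi>="\<lambda>k x u. - \<phi> k x u", OF _ _ _ v a])
    show "(\<lambda>(x, u). - \<phi> k x u) \<in> borel_measurable (hist k \<Otimes>\<^sub>M borel)" for k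
      using borel_measurable_uminus[OF meas[of k]] by (simp add: case_prod_beta')
  qed (use bd mean0 in auto)
  ultimately show "prob {x\<in>space P. \<exists>k\<le>n. a \<le> \<bar>\<Sum>j<k. \<phi> j x (w j x)\<bar>} \<le> 2 * exp (- a\<^sup>2 / (2 * v))"
    by linarith
qed

end

section \<open>The chain stays away from the origin\<close>

text \<open>Any constant above the second Taylor coefficient \<open>p (p + 1) / 2\<close> gives an upper bound near \<open>0\<close>.\<close>

lemma powr_neg_quadratic_bound:
  fixes p q :: real
  assumes p: "p > 0" and q: "p * (p + 1) / 2 < q"
  shows "\<exists>\<eta>>0. \<eta> < 1 \<and> (\<forall>u. \<bar>u\<bar> \<le> \<eta> \<longrightarrow> (1 + u) powr (-p) \<le> 1 - p * u + q * u\<^sup>2)"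
proof -
  let ?g = "\<lambda>u::real. ((1 + u) powr (-p) - 1 + p * u) / u\<^sup>2"
  have eq: "p * (p + 1) / 2 = - ((- p - 1) * p / 2)" by (simp add: field_simps)
  have R: "(?g \<longlongrightarrow> p * (p + 1) / 2) (at_right 0)" unfolding eq using p by real_asymp
  have L: "(?g \<longlongrightarrow> p * (p + 1) / 2) (at_left 0)" unfolding eq using p by real_asymp
  have "\<forall>\<^sub>F u in at 0. ?g u < q"
    using order_tendstoD(2)[OF R q] order_tendstoD(2)[OF L q] by (simp add: eventually_at_split)
  then obtain d where d: "d > 0" "\<And>u. u \<noteq> 0 \<Longrightarrow> dist u 0 < d \<Longrightarrow> ?g u < q"
    unfolding eventually_at by auto
  define \<eta> where "\<eta> = min (d / 2) (1 / 2)"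
  have "(1 + u) powr (-p) \<le> 1 - p * u + q * u\<^sup>2" if u: "\<bar>u\<bar> \<le> \<eta>" for u
  proof (cases "u = 0")
    case False
    have "dist u 0 < d" using u d(1) unfolding \<eta>_def by (auto simp: dist_real_def)
    from d(2)[OF False this] have "(1 + u) powr (-p) - 1 + p * u < q * u\<^sup>2"
      using False by (simp add: pos_divide_less_eq)
    then show ?thesis by simp
  qed simp
  then show ?thesis using d(1) by (intro exI[of _ \<eta>]) (auto simp: \<eta>_def)
qed

text \<open>The form of the step to which the theorem is reduced: the part \<open>D\<close> with mean zero is jointly measurable,
the remaining drift \<open>r\<close> does not depend on the noise, and \<open>f\<close> is defined and positive everywhere.\<close>

locale bessel_chain = bounded_iid +
  fixes f D :: "real \<Rightarrow> real \<Rightarrow> real" and r :: "real \<Rightarrow> real" and \<gamma> A C a b :: real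
  assumes f_meas: "(\<lambda>(\<xi>, u). f \<xi> u) \<in> borel_measurable (borel \<Otimes>\<^sub>M borel)"
    and f_pos: "\<And>\<xi> u. f \<xi> u > 0"
    and D_meas: "(\<lambda>(\<xi>, u). D \<xi> u) \<in> borel_measurable (borel \<Otimes>\<^sub>M borel)"
    and A_pos: "A > 0" and a_pos: "a > 0" and b_gt1: "b > 1" and gamma: "\<gamma> > 1 / 2" and C_nonneg: "C \<ge> 0"
    and f_eq: "\<And>\<xi> u. \<xi> \<ge> A \<Longrightarrow> \<bar>u\<bar> \<le> M \<Longrightarrow> f \<xi> u = \<xi> + u + \<gamma> / \<xi> + D \<xi> u + r \<xi>"
    and D_mean: "\<And>\<xi> k. \<xi> \<ge> A \<Longrightarrow> expectation (\<lambda>x. D \<xi> (w k x)) = 0"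
    and D_bound: "\<And>\<xi> u. \<xi> \<ge> A \<Longrightarrow> \<bar>u\<bar> \<le> M \<Longrightarrow> \<bar>D \<xi> u\<bar> \<le> C * \<xi> powr (-a)"
    and r_bound: "\<And>\<xi>. \<xi> \<ge> A \<Longrightarrow> \<bar>r \<xi>\<bar> \<le> C * \<xi> powr (-b)"
begin

abbreviation "X \<epsilon> n x \<equiv> chain f w \<epsilon> n x"

lemma chain_pos: "\<epsilon> > 0 \<Longrightarrow> X \<epsilon> n x > 0"
  using f_pos by (cases n) auto

lemma D_section_measurable: "D \<xi> \<in> borel_measurable borel"
  using measurable_compose[OF measurable_Pair1' D_meas, of \<xi>] by simp

lemma chain_measurable_hist: "k \<le> m \<Longrightarrow> X \<epsilon> k \<in> borel_measurable (hist m)"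
proof (induction k)
  case (Suc k)
  then have "(\<lambda>x. (X \<epsilon> k x, w k x)) \<in> measurable (hist m) (borel \<Otimes>\<^sub>M borel)"
    by (intro measurable_Pair w_measurable_hist) auto
  from measurable_compose[OF this f_meas] show ?case by simp
next
  case 0
  have "X \<epsilon> 0 = (\<lambda>x. 1 / \<epsilon>)" by (simp add: fun_eq_iff)
  then show ?case by simp
qed

lemma chain_measurable [measurable]: "X \<epsilon> k \<in> borel_measurable P"
  by (rule measurable_hist_imp[OF chain_measurable_hist[OF order_refl]])

lemma integrable_D: "\<xi> \<ge> A \<Longrightarrow> integrable P (\<lambda>x. D \<xi> (w k x))"
  using D_bound bounded D_section_measurable
  by (intro integrable_const_bound[of _ "C * \<xi> powr (-a)"]) auto

text \<open>With \<open>f \<xi> u = \<xi> (1 + U)\<close>, expanding \<open>(1 + U)\<^sup>-\<^sup>p\<close> to second order gives the expectation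
\<open>\<xi>\<^sup>-\<^sup>p (1 + (- p \<gamma> + p (p + 1) / 2 + o(1)) / \<xi>\<^sup>2)\<close>. The bracket is negative for large \<open>\<xi>\<close> if
\<open>(p + 1) / 2 < \<gamma>\<close>, and this is where \<open>\<gamma> > 1 / 2\<close> enters.\<close>

lemma lyapunov:
  "\<exists>p>0. \<exists>A'\<ge>A. \<forall>\<xi>\<ge>A'. \<forall>k.
     (\<integral>\<^sup>+x. ennreal (f \<xi> (w k x) powr (-p)) \<partial>P) \<le> ennreal (\<xi> powr (-p))"
proof -
  \<comment> \<open>the exponent satisfies \<open>(p + 1) / 2 < \<gamma>\<close>, and \<open>q\<close> is the midpoint of \<open>p (p + 1) / 2\<close> and \<open>p \<gamma>\<close>\<close>
  define p where "p = \<gamma> - 1 / 2"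
  define q where "q = p * ((p + 1) / 2 + \<gamma>) / 2"
  have p: "p > 0" using gamma by (simp add: p_def)
  have "(p + 1) / 2 < \<gamma>" using gamma by (simp add: p_def field_simps)
  then have q: "p * (p + 1) / 2 < q" "q < p * \<gamma>" "q > 0"
  proof -
    have 1: "p * ((p + 1) / 2) < p * \<gamma>" by (rule mult_strict_left_mono) fact+
    have 2: "p * ((p + 1) / 2) > 0" using p by (intro mult_pos_pos) auto
    have "q = (p * ((p + 1) / 2) + p * \<gamma>) / 2" unfolding q_def by (simp add: distrib_left)
    moreover have "x < (x + y) / 2 \<and> (x + y) / 2 < y \<and> 0 < (x + y) / 2" if "x < y" "0 < x" for x y :: real
      using that by simp
    ultimately show "p * (p + 1) / 2 < q" "q < p * \<gamma>" "q > 0"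
      using 1 2 unfolding times_divide_eq_right by metis+
  qed
  obtain \<eta> where \<eta>: "\<eta> > 0" "\<eta> < 1"
    "\<And>u. \<bar>u\<bar> \<le> \<eta> \<Longrightarrow> (1 + u) powr (-p) \<le> 1 - p * u + q * u\<^sup>2"
    using powr_neg_quadratic_bound[OF p q(1)] by blast
  \<comment> \<open>a bound for \<open>\<bar>f \<xi> u - \<xi> - u\<bar>\<close>\<close>
  define v0 where "v0 \<xi> = \<gamma> / \<xi> + C * \<xi> powr (-a) + C * \<xi> powr (-b)" for \<xi>
  have pw: "((\<lambda>\<xi>::real. C * \<xi> powr s) \<longlongrightarrow> 0) at_top" if "s < 0" for s
    using tendsto_mult_left[OF tendsto_neg_powr[OF that filterlim_ident], of C] by simp
  have "((\<lambda>\<xi>. \<gamma> * inverse \<xi> + C * \<xi> powr (-a) + C * \<xi> powr (-b)) \<longlongrightarrow> \<gamma> * 0 + 0 + 0) at_top"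
    using a_pos b_gt1 by (intro tendsto_intros pw tendsto_inverse_0_at_top filterlim_ident) auto
  then have v0_lim: "(v0 \<longlongrightarrow> 0) at_top" unfolding v0_def by (simp add: divide_inverse)
  have "((\<lambda>\<xi>. C * \<xi> powr (1 - b)) \<longlongrightarrow> 0) at_top" using b_gt1 by (intro pw) simp
  then have "((\<lambda>\<xi>. - (p * \<gamma>) + p * (C * \<xi> powr (1 - b)) + q * (1 + 2 * M * v0 \<xi> + (v0 \<xi>)\<^sup>2)) \<longlongrightarrow>
     - (p * \<gamma>) + p * 0 + q * (1 + 2 * M * 0 + 0\<^sup>2)) at_top"
    by (intro tendsto_intros v0_lim)
  then have e1: "\<forall>\<^sub>F \<xi> in at_top. - (p * \<gamma>) + p * (C * \<xi> powr (1 - b)) + q * (1 + 2 * M * v0 \<xi> + (v0 \<xi>)\<^sup>2) < 0"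
    by (rule order_tendstoD) (use q in simp)
  have "((\<lambda>\<xi>. (M + v0 \<xi>) * inverse \<xi>) \<longlongrightarrow> (M + 0) * 0) at_top"
    by (intro tendsto_intros v0_lim tendsto_inverse_0_at_top filterlim_ident)
  then have "\<forall>\<^sub>F \<xi> in at_top. (M + v0 \<xi>) * inverse \<xi> < \<eta>" by (rule order_tendstoD) (use \<eta> in simp)
  with e1 eventually_ge_at_top[of A]
  have "\<forall>\<^sub>F \<xi> in at_top. A \<le> \<xi> \<and> (M + v0 \<xi>) * inverse \<xi> < \<eta> \<and>
     - (p * \<gamma>) + p * (C * \<xi> powr (1 - b)) + q * (1 + 2 * M * v0 \<xi> + (v0 \<xi>)\<^sup>2) < 0"
    by eventually_elim auto
  then obtain A' where A': "\<And>\<xi>. \<xi> \<ge> A' \<Longrightarrow> A \<le> \<xi>" "\<And>\<xi>. \<xi> \<ge> A' \<Longrightarrow> (M + v0 \<xi>) * inverse \<xi> < \<eta>"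
     "\<And>\<xi>. \<xi> \<ge> A' \<Longrightarrow> - (p * \<gamma>) + p * (C * \<xi> powr (1 - b)) + q * (1 + 2 * M * v0 \<xi> + (v0 \<xi>)\<^sup>2) < 0"
    unfolding eventually_at_top_linorder by blast
  have "(\<integral>\<^sup>+x. ennreal (f \<xi> (w k x) powr (-p)) \<partial>P) \<le> ennreal (\<xi> powr (-p))" if \<xi>: "\<xi> \<ge> A'" for \<xi> k
  proof -
    have \<xi>A: "\<xi> \<ge> A" and \<xi>0: "\<xi> > 0" using A'(1)[OF \<xi>] A_pos by auto
    define e where "e = v0 \<xi>"
    have e0: "e \<ge> 0" unfolding e_def v0_def using gamma \<xi>0 C_nonneg by simp
    define h where "h x = \<xi> powr (-p) * (1 - p * ((w k x + \<gamma> / \<xi> + D \<xi> (w k x) + r \<xi>) / \<xi>)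
        + q * (((w k x)\<^sup>2 + 2 * M * e + e\<^sup>2) / \<xi>\<^sup>2))" for x
    have le: "f \<xi> (w k x) powr (-p) \<le> h x" if x: "x \<in> space P" for x
    proof -
      define u where "u = w k x"
      define v where "v = \<gamma> / \<xi> + D \<xi> u + r \<xi>"
      have u: "\<bar>u\<bar> \<le> M" unfolding u_def by (rule bounded[OF x])
      have ve: "\<bar>v\<bar> \<le> e"
      proof -
        have "\<bar>v\<bar> \<le> \<bar>\<gamma> / \<xi>\<bar> + \<bar>D \<xi> u\<bar> + \<bar>r \<xi>\<bar>" unfolding v_def by linarith
        also have "\<bar>\<gamma> / \<xi>\<bar> = \<gamma> / \<xi>" using gamma \<xi>0 by simp
        finally show ?thesis using D_bound[OF \<xi>A u] r_bound[OF \<xi>A] unfolding e_def v0_def by linarith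
      qed
      have "\<bar>(u + v) / \<xi>\<bar> \<le> (M + e) * inverse \<xi>"
        using u ve \<xi>0 by (simp add: divide_inverse abs_mult)
      then have small: "\<bar>(u + v) / \<xi>\<bar> \<le> \<eta>" using A'(2)[OF \<xi>] unfolding e_def by linarith
      have "f \<xi> u = \<xi> * (1 + (u + v) / \<xi>)"
        using f_eq[OF \<xi>A u] \<xi>0 unfolding v_def by (simp add: field_simps)
      moreover have "1 + (u + v) / \<xi> \<ge> 0" using small \<eta>(2) by linarith
      ultimately have "f \<xi> u powr (-p) = \<xi> powr (-p) * (1 + (u + v) / \<xi>) powr (-p)"
        using \<xi>0 by (simp add: powr_mult)
      also have "\<dots> \<le> \<xi> powr (-p) * (1 - p * ((u + v) / \<xi>) + q * ((u + v) / \<xi>)\<^sup>2)"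
        by (intro mult_left_mono \<eta>(3)[OF small]) simp
      also have "\<dots> \<le> \<xi> powr (-p) * (1 - p * ((u + v) / \<xi>) + q * ((u\<^sup>2 + 2 * M * e + e\<^sup>2) / \<xi>\<^sup>2))"
      proof (intro mult_left_mono add_left_mono)
        have "u * v \<le> M * e" using u ve e0 mult_mono[of "\<bar>u\<bar>" M "\<bar>v\<bar>" e] abs_le_D1[of "u * v"] by (simp add: abs_mult)
        moreover have "v\<^sup>2 \<le> e\<^sup>2" using ve e0 by (simp add: abs_le_square_iff[symmetric])
        ultimately have "(u + v)\<^sup>2 \<le> u\<^sup>2 + 2 * M * e + e\<^sup>2" by (simp add: power2_sum)
        then show "((u + v) / \<xi>)\<^sup>2 \<le> (u\<^sup>2 + 2 * M * e + e\<^sup>2) / \<xi>\<^sup>2"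
          unfolding power_divide by (rule divide_right_mono) simp
      qed (use q(3) in simp_all)
      finally show ?thesis unfolding h_def u_def[symmetric] v_def by (simp add: add.assoc)
    qed
    note [simp] = integrable_w integrable_w2 integrable_D[OF \<xi>A]
    have hi: "integrable P h" unfolding h_def by simp
    have "(\<integral>\<^sup>+x. ennreal (f \<xi> (w k x) powr (-p)) \<partial>P) \<le> (\<integral>\<^sup>+x. ennreal (h x) \<partial>P)"
      by (intro nn_integral_mono ennreal_leI le)
    also have "\<dots> = ennreal (expectation h)"
      using le by (intro nn_integral_eq_integral hi AE_I2) (meson order.trans powr_ge_zero)
    also have "\<dots> \<le> ennreal (\<xi> powr (-p))"
    proof (rule ennreal_leI)
    have "expectation h = \<xi> powr (-p) * (1 - p * ((\<gamma> / \<xi> + r \<xi>) / \<xi>) + q * ((1 + 2 * M * e + e\<^sup>2) / \<xi>\<^sup>2))"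
      unfolding h_def by (simp add: mean second_moment D_mean[OF \<xi>A] prob_space)
    also have "\<dots> \<le> \<xi> powr (-p) * 1"
    proof (rule mult_left_mono)
      have "\<bar>r \<xi>\<bar> * \<xi> \<le> C * \<xi> powr (-b) * \<xi>" using r_bound[OF \<xi>A] \<xi>0 by (intro mult_right_mono) auto
      also have "\<dots> = C * \<xi> powr (1 - b)" using \<xi>0 powr_add[of \<xi> 1 "-b"] by simp
      finally have "- (r \<xi> * \<xi>) \<le> C * \<xi> powr (1 - b)" 
        using abs_ge_minus_self[of "r \<xi> * \<xi>"] \<xi>0 by (simp add: abs_mult)
      then have "p * (- (r \<xi> * \<xi>)) \<le> p * (C * \<xi> powr (1 - b))" using p by (intro mult_left_mono) auto
      then have "- (p * \<gamma>) - p * (r \<xi> * \<xi>) + q * (1 + 2 * M * e + e\<^sup>2) \<le> 0"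
        using A'(3)[OF \<xi>] unfolding e_def by linarith
      then have "(- (p * \<gamma>) - p * (r \<xi> * \<xi>) + q * (1 + 2 * M * e + e\<^sup>2)) / \<xi>\<^sup>2 \<le> 0"
        by (rule divide_nonpos_nonneg) simp
      moreover have "1 - p * ((\<gamma> / \<xi> + r \<xi>) / \<xi>) + q * ((1 + 2 * M * e + e\<^sup>2) / \<xi>\<^sup>2) =
         1 + (- (p * \<gamma>) - p * (r \<xi> * \<xi>) + q * (1 + 2 * M * e + e\<^sup>2)) / \<xi>\<^sup>2"
        using \<xi>0 by (simp add: field_simps power2_eq_square)
      ultimately show "1 - p * ((\<gamma> / \<xi> + r \<xi>) / \<xi>) + q * ((1 + 2 * M * e + e\<^sup>2) / \<xi>\<^sup>2) \<le> 1" by linarith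
    qed simp
    finally show "expectation h \<le> \<xi> powr (-p)" by simp
    qed
    finally show ?thesis .
  qed
  then show ?thesis using p A' by (intro exI[of _ p] exI[of _ "max A A'"]) auto
qed

text \<open>The maximal inequality for \<open>\<xi>\<^sub>k\<^sup>-\<^sup>p\<close> with initial value \<open>\<epsilon>\<^sup>p\<close> and level \<open>(\<delta> / \<epsilon>)\<^sup>-\<^sup>p\<close>. The bound depends
neither on the number of steps nor on \<open>\<epsilon>\<close>.\<close>

lemma prob_chain_low:
  "\<exists>p>0. \<exists>A'\<ge>A. \<forall>\<epsilon> \<delta> n. \<epsilon> > 0 \<longrightarrow> \<delta> > 0 \<longrightarrow> \<delta> / \<epsilon> \<ge> A' \<longrightarrow>
     prob {x\<in>space P. \<exists>k\<le>n. X \<epsilon> k x \<le> \<delta> / \<epsilon>} \<le> \<delta> powr p"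
proof -
  obtain p A' where p: "p > 0" and A': "A' \<ge> A"
    and ly: "\<And>\<xi> k. \<xi> \<ge> A' \<Longrightarrow> (\<integral>\<^sup>+x. ennreal (f \<xi> (w k x) powr (-p)) \<partial>P) \<le> ennreal (\<xi> powr (-p))"
    using lyapunov by blast
  have "prob {x\<in>space P. \<exists>k\<le>n. X \<epsilon> k x \<le> \<delta> / \<epsilon>} \<le> \<delta> powr p"
    if \<epsilon>: "\<epsilon> > 0" and \<delta>: "\<delta> > 0" and low: "\<delta> / \<epsilon> \<ge> A'" for \<epsilon> \<delta> n
  proof -
    let ?S = "{x\<in>space P. \<exists>k\<le>n. X \<epsilon> k x \<le> \<delta> / \<epsilon>}"
    define V where "V k x = ennreal (X \<epsilon> k x powr (-p))" for k x
    define L where "L = ennreal ((\<delta> / \<epsilon>) powr (-p))"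
    have LV: "L \<le> V k x \<longleftrightarrow> X \<epsilon> k x \<le> \<delta> / \<epsilon>" for k x
      using powr_mono2'[of "-p" "X \<epsilon> k x" "\<delta> / \<epsilon>"] powr_less_mono2_neg[of "-p" "\<delta> / \<epsilon>" "X \<epsilon> k x"]
        chain_pos[OF \<epsilon>, of k x] divide_pos_pos[OF \<delta> \<epsilon>] p
      unfolding L_def V_def by (cases "X \<epsilon> k x \<le> \<delta> / \<epsilon>") (auto simp: not_le)
    have "L * emeasure P {x\<in>space P. \<exists>k\<le>n. L \<le> V k x} \<le> (\<integral>\<^sup>+x. V 0 x \<partial>P)"
    proof (rule maximal_inequality_adapted[where F="\<lambda>k x u. ennreal (f (X \<epsilon> k x) u powr (-p))"])
      fix k
      have [measurable]: "X \<epsilon> k \<in> borel_measurable (hist k)" by (rule chain_measurable_hist[OF order_refl])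
      show "V k \<in> borel_measurable (hist k)" unfolding V_def by measurable
      have 1: "(\<lambda>(x, u). (X \<epsilon> k x, u)) \<in> measurable (hist k \<Otimes>\<^sub>M borel) (borel \<Otimes>\<^sub>M borel)" by measurable
      have [measurable]: "(\<lambda>z. f (X \<epsilon> k (fst z)) (snd z)) \<in> borel_measurable (hist k \<Otimes>\<^sub>M borel)"
        using measurable_compose[OF 1 f_meas] by (simp add: case_prod_beta')
      show "(\<lambda>(x, u). ennreal (f (X \<epsilon> k x) u powr (-p))) \<in> borel_measurable (hist k \<Otimes>\<^sub>M borel)"
        unfolding case_prod_beta' by measurable
      fix x
      show "V (Suc k) x = ennreal (f (X \<epsilon> k x) (w k x) powr (-p))" unfolding V_def by (simp only: chain.simps)
      assume "V k x < L"
      then have "\<not> L \<le> V k x" by (simp add: not_le)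
      then have "X \<epsilon> k x \<ge> A'" using LV low by force
      from ly[OF this] show "(\<integral>\<^sup>+y. ennreal (f (X \<epsilon> k x) (w k y) powr (-p)) \<partial>P) \<le> V k x" unfolding V_def .
    qed
    also have "(\<integral>\<^sup>+x. V 0 x \<partial>P) = ennreal ((1 / \<epsilon>) powr (-p))" unfolding V_def by (simp add: emeasure_space_1)
    finally have "ennreal ((\<delta> / \<epsilon>) powr (-p) * prob ?S) \<le> ennreal ((1 / \<epsilon>) powr (-p))"
      unfolding LV unfolding L_def emeasure_eq_measure by (simp only: ennreal_mult' measure_nonneg powr_ge_zero)
    then have "(\<delta> / \<epsilon>) powr (-p) * prob ?S \<le> (1 / \<epsilon>) powr (-p)"
      by (simp only: ennreal_le_iff powr_ge_zero)
    from mult_left_mono[OF this, of "(\<delta> / \<epsilon>) powr p"]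
    have "(\<delta> / \<epsilon>) powr p * (\<delta> / \<epsilon>) powr (-p) * prob ?S
        \<le> (\<delta> / \<epsilon>) powr p * (1 / \<epsilon>) powr (-p)"
      by (simp only: mult.assoc powr_ge_zero)
    also have "(\<delta> / \<epsilon>) powr p * (\<delta> / \<epsilon>) powr (-p) = 1" using \<delta> \<epsilon> by (simp add: powr_add[symmetric])
    also have "(\<delta> / \<epsilon>) powr p * (1 / \<epsilon>) powr (-p) = \<delta> powr p"
      using \<delta> \<epsilon> by (simp add: powr_divide powr_minus)
    finally show ?thesis by simp
  qed
  then show ?thesis using p A' by blast
qed

end

section \<open>Joint convergence of the walk increments\<close>

lemma distr_indep_sequence_eq:
  fixes X :: "nat \<Rightarrow> 'a \<Rightarrow> real" and Y :: "nat \<Rightarrow> 'b \<Rightarrow> real"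
  assumes P: "prob_space P" and Q: "prob_space Q"
    and X: "prob_space.indep_vars P (\<lambda>_. borel) X UNIV"
    and Y: "prob_space.indep_vars Q (\<lambda>_. borel) Y UNIV"
    and eq: "\<And>i. distr P borel (X i) = distr Q borel (Y i)"
  shows "distr P (PiM UNIV (\<lambda>_. borel)) (\<lambda>x i. X i x) = distr Q (PiM UNIV (\<lambda>_. borel)) (\<lambda>y i. Y i y)"
proof -
  have *: "distr R (PiM UNIV (\<lambda>_. borel)) (\<lambda>x i. Z i x) = PiM UNIV (\<lambda>i. distr R borel (Z i))"
    if "prob_space R" "prob_space.indep_vars R (\<lambda>_. borel) Z UNIV" for R :: "'c measure" and Z :: "nat \<Rightarrow> 'c \<Rightarrow> real"
  proof -
    interpret prob_space R by fact
    have "random_variable borel (Z i)" for i using that(2) unfolding indep_vars_def by simp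
    from indep_vars_iff_distr_eq_PiM[of UNIV Z "\<lambda>_. borel", OF UNIV_not_empty this] that(2)
    have "distr R (PiM UNIV (\<lambda>_. borel)) (\<lambda>x. \<lambda>i\<in>UNIV. Z i x) = PiM UNIV (\<lambda>i. distr R borel (Z i))" by simp
    moreover have "(\<lambda>x. \<lambda>i\<in>UNIV. Z i x) = (\<lambda>x i. Z i x)" by (simp add: fun_eq_iff)
    ultimately show ?thesis by (simp only:)
  qed
  show ?thesis unfolding *[OF P X] *[OF Q Y] eq ..
qed

lemma indep_vars_PiM_coordinates:
  fixes \<Omega> :: "real measure"
  assumes "prob_space \<Omega>"
  shows "prob_space.indep_vars (PiM (UNIV :: nat set) (\<lambda>_. \<Omega>)) (\<lambda>_. \<Omega>) (\<lambda>i u. u i) UNIV"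
proof -
  interpret Q: prob_space "PiM (UNIV :: nat set) (\<lambda>_. \<Omega>)"
    by (rule prob_space_PiM) (rule assms)
  have "distr (PiM UNIV (\<lambda>_. \<Omega>)) \<Omega> (\<lambda>u. u i) = \<Omega>" for i :: nat
    using distr_PiM_component[of UNIV "\<lambda>_. \<Omega>" i] assms by simp
  moreover have "(\<lambda>u. \<lambda>i\<in>UNIV. u i) = (\<lambda>u :: nat \<Rightarrow> real. u)" by (simp add: fun_eq_iff)
  ultimately have "distr (PiM UNIV (\<lambda>_. \<Omega>)) (PiM UNIV (\<lambda>_. \<Omega>)) (\<lambda>u. \<lambda>i\<in>UNIV. u i) =
      PiM UNIV (\<lambda>i. distr (PiM (UNIV::nat set) (\<lambda>_. \<Omega>)) \<Omega> (\<lambda>u. u i))"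
    by (simp add: distr_id)
  then show ?thesis
    by (subst Q.indep_vars_iff_distr_eq_PiM) auto
qed

context bounded_iid
begin

lemma indep_blocks:
  assumes n: "mono n"
  shows "indep_vars (\<lambda>_. borel) (\<lambda>i x. c * (\<Sum>j\<in>{n i..<n (Suc i)}. w j x)) UNIV"
proof -
  have "disjoint_family_on (\<lambda>i. {n i..<n (Suc i)}) UNIV"
    unfolding disjoint_family_on_def
  proof (intro ballI impI)
    fix i j :: nat assume "i \<noteq> j"
    then consider "Suc i \<le> j" | "Suc j \<le> i" by linarith
    then show "{n i..<n (Suc i)} \<inter> {n j..<n (Suc j)} = {}"
      by cases (use monoD[OF n] in fastforce)+
  qed
  then have "indep_vars (\<lambda>i. PiM {n i..<n (Suc i)} (\<lambda>_. borel)) (\<lambda>i x. restrict (\<lambda>j. w j x) {n i..<n (Suc i)}) UNIV"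
    by (intro indep_vars_restrict[OF indep]) auto
  then have "indep_vars (\<lambda>_. borel) (\<lambda>i x. c * (\<Sum>j\<in>{n i..<n (Suc i)}. restrict (\<lambda>j. w j x) {n i..<n (Suc i)} j)) UNIV"
    by (rule indep_vars_compose2) measurable
  then show ?thesis by simp
qed

text \<open>By stationarity, only the length of a block matters for the law of its sum.\<close>

lemma distr_block: "distr P borel (\<lambda>x. c * (\<Sum>j\<in>{s..<s+k}. w j x)) = distr P borel (\<lambda>x. c * (\<Sum>j<k. w j x))"
proof -
  have "indep_vars (\<lambda>i. PiM {s + i} (\<lambda>_. borel)) (\<lambda>i x. restrict (\<lambda>j. w j x) {s + i}) UNIV"
    by (intro indep_vars_restrict[OF indep]) (auto simp: disjoint_family_on_def)
  then have "indep_vars (\<lambda>_. borel) (\<lambda>i x. restrict (\<lambda>j. w j x) {s + i} (s + i)) UNIV"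
    by (rule indep_vars_compose2) measurable
  then have ind: "indep_vars (\<lambda>_. borel) (\<lambda>i. w (s + i)) UNIV" by simp
  have "distr P borel (w (s + i)) = distr P borel (w i)" for i using ident[of "s + i"] ident[of i] by simp
  from distr_indep_sequence_eq[OF prob_space_axioms prob_space_axioms ind indep this]
  have eq: "distr P (PiM UNIV (\<lambda>_. borel)) (\<lambda>x i. w (s + i) x) = distr P (PiM UNIV (\<lambda>_. borel)) (\<lambda>x i. w i x)" .
  have gm: "(\<lambda>h. c * (\<Sum>j<k. h j :: real)) \<in> borel_measurable (PiM UNIV (\<lambda>_. borel))" by measurable
  have *: "distr P borel (\<lambda>x. c * (\<Sum>j<k. Z j x)) = distr (distr P (PiM UNIV (\<lambda>_. borel)) (\<lambda>x i. Z i x)) borel (\<lambda>h. c * (\<Sum>j<k. h j))"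
    if "\<And>j. Z j \<in> borel_measurable P" for Z :: "nat \<Rightarrow> 'a \<Rightarrow> real"
    by (subst distr_distr[OF gm]) (auto intro!: measurable_PiM_single' that simp: comp_def)
  have "(\<Sum>j\<in>{s..<s+k}. w j x) = (\<Sum>j<k. w (s + j) x)" for x
    by (rule sum.reindex_bij_witness[of _ "\<lambda>j. s + j" "\<lambda>j. j - s"]) auto
  then show ?thesis using *[of "\<lambda>i. w (s + i)"] *[of w] eq by simp
qed

text \<open>The last step of the chain, which lives at times \<open>n \<epsilon>\<^sup>2\<close>, not after the time \<open>i h\<close>.\<close>

definition grid_index :: "real \<Rightarrow> real \<Rightarrow> nat \<Rightarrow> nat" where
  "grid_index h \<epsilon> i = nat \<lfloor>real i * h / \<epsilon>\<^sup>2\<rfloor>"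

definition increment :: "real \<Rightarrow> real \<Rightarrow> nat \<Rightarrow> 'a \<Rightarrow> real" where
  "increment h \<epsilon> i x = \<epsilon> * (\<Sum>j\<in>{grid_index h \<epsilon> i..<grid_index h \<epsilon> (Suc i)}. w j x)"

lemma increment_measurable [measurable]: "increment h \<epsilon> i \<in> borel_measurable P"
  unfolding increment_def by measurable

lemma grid_index_mono: "h \<ge> 0 \<Longrightarrow> mono (grid_index h \<epsilon>)"
  unfolding grid_index_def mono_def
  by (intro allI impI nat_mono floor_mono divide_right_mono mult_right_mono) auto

lemma grid_index_bounds:
  assumes "h \<ge> 0" "\<epsilon> > 0"
  shows "\<epsilon>\<^sup>2 * real (grid_index h \<epsilon> i) \<le> real i * h" "real i * h - \<epsilon>\<^sup>2 < \<epsilon>\<^sup>2 * real (grid_index h \<epsilon> i)"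
proof -
  have 0: "0 \<le> real i * h / \<epsilon>\<^sup>2" using assms by simp
  have e: "0 < \<epsilon>\<^sup>2" using assms by simp
  have "real (grid_index h \<epsilon> i) \<le> real i * h / \<epsilon>\<^sup>2" "real i * h / \<epsilon>\<^sup>2 < real (grid_index h \<epsilon> i) + 1"
    unfolding grid_index_def using nat_floor_bounds[OF 0] by auto
  then show "\<epsilon>\<^sup>2 * real (grid_index h \<epsilon> i) \<le> real i * h" "real i * h - \<epsilon>\<^sup>2 < \<epsilon>\<^sup>2 * real (grid_index h \<epsilon> i)"
    using e unfolding pos_le_divide_eq[OF e] pos_divide_less_eq[OF e] by (simp_all add: algebra_simps)
qed

text \<open>The central limit theorem turned by Skorohod's theorem into pointwise convergence. A block sum of length
\<open>k\<close> has the law of \<open>sqrt k * Ys k\<close>, also for \<open>k = 0\<close>.\<close>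

lemma clt_coupling:
  obtains \<Omega> :: "real measure" and Ys :: "nat \<Rightarrow> real \<Rightarrow> real" and Y :: "real \<Rightarrow> real" where
    "prob_space \<Omega>" "\<And>k. Ys k \<in> borel_measurable \<Omega>" "Y \<in> borel_measurable \<Omega>"
    "\<And>k c. distr \<Omega> borel (\<lambda>u. c * sqrt (real k) * Ys k u) = distr P borel (\<lambda>x. c * (\<Sum>j<k. w j x))"
    "distr \<Omega> borel Y = std_normal_distribution"
    "\<And>u. u \<in> space \<Omega> \<Longrightarrow> (\<lambda>k. Ys k u) \<longlonglongrightarrow> Y u"
proof -
  have var: "variance (w n) = 1\<^sup>2" for n using mean[of n] second_moment[of n] by simp
  have "weak_conv_m (\<lambda>n. distr P borel (\<lambda>x. (\<Sum>i<n. w i x) / sqrt (real n * 1\<^sup>2))) std_normal_distribution"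
    by (rule central_limit_theorem_zero_mean[OF indep mean _ integrable_w2 var ident]) simp
  then have wc: "weak_conv_m (\<lambda>n. distr P borel (\<lambda>x. (\<Sum>i<n. w i x) / sqrt (real n))) std_normal_distribution" by simp
  have rd: "real_distribution (distr P borel (\<lambda>x. (\<Sum>i<n. w i x) / sqrt (real n)))" for n
    by (rule real_distribution_distr) measurable
  obtain \<Omega> :: "real measure" and Ys :: "nat \<Rightarrow> real \<Rightarrow> real" and Y :: "real \<Rightarrow> real" where
    S: "prob_space \<Omega>" "\<And>n. Ys n \<in> measurable \<Omega> borel"
      "\<And>n. distr \<Omega> borel (Ys n) = distr P borel (\<lambda>x. (\<Sum>i<n. w i x) / sqrt (real n))"
      "Y \<in> measurable \<Omega> lborel" "distr \<Omega> borel Y = std_normal_distribution"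
      "\<And>u. u \<in> space \<Omega> \<Longrightarrow> (\<lambda>n. Ys n u) \<longlonglongrightarrow> Y u"
    using Skorohod[OF rd real_dist_normal_dist wc] by blast
  have Ym: "Y \<in> borel_measurable \<Omega>" using S(4) by simp
  have "distr \<Omega> borel (\<lambda>u. c * sqrt (real k) * Ys k u) = distr P borel (\<lambda>x. c * (\<Sum>j<k. w j x))" for k c
  proof -
    have "distr \<Omega> borel (\<lambda>u. c * sqrt (real k) * Ys k u) = distr (distr \<Omega> borel (Ys k)) borel (\<lambda>t. c * sqrt (real k) * t)"
      using S(2) by (subst distr_distr) (auto simp: comp_def)
    also have "\<dots> = distr P borel (\<lambda>x. c * sqrt (real k) * ((\<Sum>i<k. w i x) / sqrt (real k)))"
      unfolding S(3) by (subst distr_distr) (auto simp: comp_def)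
    also have "(\<lambda>x. c * sqrt (real k) * ((\<Sum>i<k. w i x) / sqrt (real k))) = (\<lambda>x. c * (\<Sum>j<k. w j x))"
      by (cases "k = 0") (auto simp: fun_eq_iff)
    finally show ?thesis .
  qed
  then show ?thesis using that S Ym by blast
qed

text \<open>On a product of copies of the Skorohod space, all increments of the walk, and those of the limit, are
realized together and independently, one in each coordinate. There the convergence is pointwise, and it
is preserved by every bounded function that is continuous for pointwise convergence of sequences. The
number of noise variables in a block is about \<open>h / \<epsilon>\<^sup>2\<close>, which produces the variance \<open>h\<close>.\<close>

lemma increments_converge:
  fixes g :: "(nat \<Rightarrow> real) \<Rightarrow> real" and Z :: "nat \<Rightarrow> 'b \<Rightarrow> real"
  assumes h: "h > 0" and N: "prob_space N"
    and Z: "prob_space.indep_vars N (\<lambda>_. borel) Z UNIV"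
    and Zd: "\<And>i. distributed N lborel (Z i) (normal_density 0 (sqrt h))"
    and gm: "g \<in> borel_measurable (PiM UNIV (\<lambda>_. borel))"
    and gb: "\<And>d. \<bar>g d\<bar> \<le> K"
    and gc: "\<And>d d'. (\<And>i. (\<lambda>k. d k i) \<longlonglongrightarrow> d' i) \<Longrightarrow> (\<lambda>k. g (d k)) \<longlonglongrightarrow> g d'"
  shows "((\<lambda>\<epsilon>. \<integral>x. g (\<lambda>i. increment h \<epsilon> i x) \<partial>P) \<longlongrightarrow> (\<integral>y. g (\<lambda>i. Z i y) \<partial>N)) (at_right 0)"
proof (rule tendsto_at_right_sequentially[of 0 1])
  fix E :: "nat \<Rightarrow> real" assume E0: "\<And>n. 0 < E n" and E: "E \<longlonglongrightarrow> 0"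
  obtain \<Omega> :: "real measure" and Ys :: "nat \<Rightarrow> real \<Rightarrow> real" and Y :: "real \<Rightarrow> real" where
    S: "prob_space \<Omega>" "\<And>k. Ys k \<in> borel_measurable \<Omega>" "Y \<in> borel_measurable \<Omega>"
    "\<And>k c. distr \<Omega> borel (\<lambda>u. c * sqrt (real k) * Ys k u) = distr P borel (\<lambda>x. c * (\<Sum>j<k. w j x))"
    "distr \<Omega> borel Y = std_normal_distribution"
    "\<And>u. u \<in> space \<Omega> \<Longrightarrow> (\<lambda>k. Ys k u) \<longlonglongrightarrow> Y u"
    using clt_coupling by metis
  note [measurable] = S(2,3)
  let ?Q = "PiM (UNIV :: nat set) (\<lambda>_. \<Omega>)"
  interpret Q: prob_space ?Q by (rule prob_space_PiM) (rule S(1))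
  define len where "len n i = grid_index h (E n) (Suc i) - grid_index h (E n) i" for n i
  define U where "U n i u = E n * sqrt (real (len n i)) * Ys (len n i) (u i)" for n i and u :: "nat \<Rightarrow> real"
  define V where "V i u = sqrt h * Y (u i)" for i and u :: "nat \<Rightarrow> real"
  have comp: "distr ?Q borel (\<lambda>u. \<psi> (u i)) = distr \<Omega> borel \<psi>" if [measurable]: "\<psi> \<in> borel_measurable \<Omega>" for \<psi> :: "real \<Rightarrow> real" and i
  proof -
    have "distr ?Q borel (\<lambda>u. \<psi> (u i)) = distr (distr ?Q \<Omega> (\<lambda>u. u i)) borel \<psi>"
      by (subst distr_distr) (auto simp: comp_def)
    then show ?thesis using distr_PiM_component[of UNIV "\<lambda>_. \<Omega>" i] S(1) by simp
  qed
  have indc: "Q.indep_vars (\<lambda>_. borel) (\<lambda>i u. \<psi> i (u i)) UNIV" if "\<And>i. \<psi> i \<in> borel_measurable \<Omega>" for \<psi> :: "nat \<Rightarrow> real \<Rightarrow> real"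
    by (rule Q.indep_vars_compose2[OF indep_vars_PiM_coordinates[OF S(1)]]) (use that in auto)
  have gint: "(\<integral>x. g (\<lambda>i. A i x) \<partial>R) = (\<integral>d. g d \<partial>distr R (PiM UNIV (\<lambda>_. borel)) (\<lambda>x i. A i x))"
    if "\<And>i. A i \<in> borel_measurable R" for R :: "'c measure" and A :: "nat \<Rightarrow> 'c \<Rightarrow> real"
    by (subst integral_distr) (auto intro!: measurable_PiM_single' that gm)
  \<comment> \<open>transfer of the increments of the walk to the product space\<close>
  have PU: "(\<integral>x. g (\<lambda>i. increment h (E n) i x) \<partial>P) = (\<integral>u. g (\<lambda>i. U n i u) \<partial>?Q)" for n
  proof -
    have le: "grid_index h (E n) i \<le> grid_index h (E n) (Suc i)" for i
      using monoD[OF grid_index_mono, of h i "Suc i"] h by simp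
    have "indep_vars (\<lambda>_. borel) (increment h (E n)) UNIV"
      unfolding increment_def by (rule indep_blocks[OF grid_index_mono]) (use h in simp)
    moreover have "Q.indep_vars (\<lambda>_. borel) (U n) UNIV" unfolding U_def by (rule indc) measurable
    moreover have "distr P borel (increment h (E n) i) = distr ?Q borel (U n i)" for i
    proof -
      have "{grid_index h (E n) i..<grid_index h (E n) (Suc i)} = {grid_index h (E n) i..<grid_index h (E n) i + len n i}"
        unfolding len_def using le[of i] by simp
      then have "distr P borel (increment h (E n) i) = distr P borel (\<lambda>x. E n * (\<Sum>j<len n i. w j x))"
        unfolding increment_def distr_block[symmetric, where s="grid_index h (E n) i"] by simp
      also have "\<dots> = distr ?Q borel (U n i)" unfolding U_def S(4)[symmetric] by (rule comp[symmetric]) measurable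
      finally show ?thesis .
    qed
    ultimately have "distr P (PiM UNIV (\<lambda>_. borel)) (\<lambda>x i. increment h (E n) i x) = distr ?Q (PiM UNIV (\<lambda>_. borel)) (\<lambda>u i. U n i u)"
      by (intro distr_indep_sequence_eq prob_space_axioms Q.prob_space_axioms)
    moreover have "U n i \<in> borel_measurable ?Q" for i unfolding U_def by measurable
    ultimately show ?thesis using gint[of "increment h (E n)" P] gint[of "U n" ?Q] by simp
  qed
  have Vm: "V i \<in> borel_measurable ?Q" for i unfolding V_def by measurable
  \<comment> \<open>transfer of the Gaussian increments to the product space\<close>
  have NV: "(\<integral>y. g (\<lambda>i. Z i y) \<partial>N) = (\<integral>u. g (\<lambda>i. V i u) \<partial>?Q)"
  proof -
    have Zm: "Z i \<in> borel_measurable N" for i using distributed_measurable[OF Zd[of i]] by simp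
    have "Q.indep_vars (\<lambda>_. borel) V UNIV" unfolding V_def by (rule indc) measurable
    moreover have "distr N borel (Z i) = distr ?Q borel (V i)" for i
    proof -
      have "distributed \<Omega> lborel Y (normal_density 0 1)"
      proof -
        have "distr \<Omega> lborel Y = distr \<Omega> borel Y" by (rule distr_cong) auto
        then show ?thesis unfolding distributed_def using S(5) by simp
      qed
      then have "distributed \<Omega> lborel (\<lambda>u. 0 + sqrt h * Y u) (normal_density (0 + sqrt h * 0) (\<bar>sqrt h\<bar> * 1))"
        using prob_space.normal_density_affine[OF S(1), of Y 0 1 "sqrt h" 0] h by simp
      then have "distr \<Omega> lborel (\<lambda>u. sqrt h * Y u) = density lborel (normal_density 0 (sqrt h))"
        using distributed_distr_eq_density h by fastforce
      moreover have "distr N lborel (Z i) = density lborel (normal_density 0 (sqrt h))"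
        by (rule distributed_distr_eq_density[OF Zd])
      moreover have "distr N lborel (Z i) = distr N borel (Z i)" by (rule distr_cong) auto
      moreover have "distr \<Omega> lborel (\<lambda>u. sqrt h * Y u) = distr \<Omega> borel (\<lambda>u. sqrt h * Y u)" by (rule distr_cong) auto
      ultimately have "distr N borel (Z i) = distr \<Omega> borel (\<lambda>u. sqrt h * Y u)" by simp
      also have "\<dots> = distr ?Q borel (V i)" unfolding V_def by (rule comp[symmetric]) measurable
      finally show ?thesis .
    qed
    ultimately have "distr N (PiM UNIV (\<lambda>_. borel)) (\<lambda>x i. Z i x) = distr ?Q (PiM UNIV (\<lambda>_. borel)) (\<lambda>u i. V i u)"
      by (intro distr_indep_sequence_eq N Q.prob_space_axioms Z)
    then show ?thesis using gint[of Z N] gint[of V ?Q] Zm Vm by simp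
  qed
  have sq: "(\<lambda>n. (E n)\<^sup>2) \<longlonglongrightarrow> 0" using tendsto_power[OF E, of 2] by simp
  have grid: "(\<lambda>n. (E n)\<^sup>2 * real (grid_index h (E n) i)) \<longlonglongrightarrow> real i * h" for i
  proof (rule tendsto_sandwich)
    show "(\<lambda>n. real i * h - (E n)\<^sup>2) \<longlonglongrightarrow> real i * h" using tendsto_diff[OF tendsto_const sq, of "real i * h"] by simp
    show "\<forall>\<^sub>F n in sequentially. real i * h - (E n)\<^sup>2 \<le> (E n)\<^sup>2 * real (grid_index h (E n) i)"
      using grid_index_bounds(2)[of h "E _" i] h E0 by (intro always_eventually) (auto simp: less_imp_le)
    show "\<forall>\<^sub>F n in sequentially. (E n)\<^sup>2 * real (grid_index h (E n) i) \<le> real i * h"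
      using grid_index_bounds(1)[of h "E _" i] h E0 by (intro always_eventually) auto
  qed simp
  have lenl: "(\<lambda>n. (E n)\<^sup>2 * real (len n i)) \<longlonglongrightarrow> h" for i
  proof -
    have "(E n)\<^sup>2 * real (len n i) = (E n)\<^sup>2 * real (grid_index h (E n) (Suc i)) - (E n)\<^sup>2 * real (grid_index h (E n) i)" for n
      unfolding len_def using monoD[OF grid_index_mono, of h i "Suc i" "E n"] h
      by (simp add: of_nat_diff right_diff_distrib)
    moreover have "real (Suc i) * h - real i * h = h" by (simp add: distrib_right)
    ultimately show ?thesis using tendsto_diff[OF grid[of "Suc i"] grid[of i]] by (simp only:)
  qed
  have len_inf: "filterlim (\<lambda>n. len n i) at_top sequentially" for i
  proof -
    have "filterlim (\<lambda>n. (E n)\<^sup>2) (at_right 0) sequentially"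
      unfolding filterlim_at using sq E0 by (auto simp: less_le)
    then have "filterlim (\<lambda>n. inverse ((E n)\<^sup>2)) at_top sequentially"
      by (rule filterlim_compose[OF filterlim_inverse_at_top_right])
    from filterlim_tendsto_pos_mult_at_top[OF lenl[of i] h this]
    have "filterlim (\<lambda>n. real (len n i)) at_top sequentially"
      using E0 by (simp add: field_simps less_imp_neq[symmetric])
    then show ?thesis by (simp add: filterlim_sequentially_iff_filterlim_real)
  qed
  have conv: "(\<lambda>n. U n i u) \<longlonglongrightarrow> V i u" if u: "u \<in> space ?Q" for i u
  proof -
    have "(\<lambda>n. sqrt ((E n)\<^sup>2 * real (len n i))) \<longlonglongrightarrow> sqrt h" by (intro tendsto_intros lenl)
    then have "(\<lambda>n. E n * sqrt (real (len n i))) \<longlonglongrightarrow> sqrt h"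
      using E0 by (simp add: real_sqrt_mult less_imp_le)
    moreover have "(\<lambda>n. Ys (len n i) (u i)) \<longlonglongrightarrow> Y (u i)"
      using filterlim_compose[OF S(6)[of "u i"] len_inf[of i]] u by (auto simp: space_PiM)
    ultimately show ?thesis unfolding U_def V_def by (rule tendsto_mult)
  qed
  have "(\<lambda>n. \<integral>u. g (\<lambda>i. U n i u) \<partial>?Q) \<longlonglongrightarrow> (\<integral>u. g (\<lambda>i. V i u) \<partial>?Q)"
  proof (rule integral_dominated_convergence[where w="\<lambda>_. K"])
    have "U n i \<in> borel_measurable ?Q" for n i unfolding U_def by measurable
    then show "(\<lambda>u. g (\<lambda>i. U n i u)) \<in> borel_measurable ?Q" for n
      by (intro measurable_compose[OF _ gm] measurable_PiM_single') auto
    show "(\<lambda>u. g (\<lambda>i. V i u)) \<in> borel_measurable ?Q"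
      using Vm by (intro measurable_compose[OF _ gm] measurable_PiM_single') auto
  qed (use conv gc gb in auto)
  then show "(\<lambda>n. \<integral>x. g (\<lambda>i. increment h (E n) i x) \<partial>P) \<longlonglongrightarrow> (\<integral>y. g (\<lambda>i. Z i y) \<partial>N)"
    unfolding PU NV .
qed simp

end

section \<open>Increments of Brownian motion\<close>

text \<open>The definition of Brownian motion makes a single increment independent of the past; by induction
along the grid, the increments are independent as a family.\<close>

lemma brownian_increments:
  assumes bm: "brownian_motion N \<F> B" and h: "h > 0"
  shows "prob_space.indep_vars N (\<lambda>_. borel) (\<lambda>i y. B (real (Suc i) * h) y - B (real i * h) y) UNIV"
    and "\<And>i. distributed N lborel (\<lambda>y. B (real (Suc i) * h) y - B (real i * h) y) (normal_density 0 (sqrt h))"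
proof -
  interpret prob_space N using bm unfolding brownian_motion_def by simp
  have sp: "space (\<F> t) = space N" and sub: "s \<le> t \<Longrightarrow> sets (\<F> s) \<subseteq> sets (\<F> t)" and subN: "subalgebra N (\<F> t)"
    and Bm: "t \<ge> 0 \<Longrightarrow> B t \<in> borel_measurable (\<F> t)" for s t
    using bm unfolding brownian_motion_def filtration_def by auto
  have ind: "indep_set (sets (\<F> s)) {(\<lambda>y. B t y - B s y) -` A \<inter> space N | A. A \<in> sets borel}"
    and dis: "distributed N lborel (\<lambda>y. B t y - B s y) (normal_density 0 (sqrt (t - s)))"
    if "0 \<le> s" "s < t" for s t
    using bm that unfolding brownian_motion_def by auto
  define Z where "Z i y = B (real (Suc i) * h) y - B (real i * h) y" for i y
  have t: "real (Suc i) * h - real i * h = h" "0 \<le> real i * h" "real i * h < real (Suc i) * h" for i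
    using h by (simp_all add: distrib_right)
  show dZ: "distributed N lborel (\<lambda>y. B (real (Suc i) * h) y - B (real i * h) y) (normal_density 0 (sqrt h))" for i
    using dis[OF t(2,3)[of i]] unfolding t(1) .
  have Zm [measurable]: "Z i \<in> borel_measurable N" for i
    using distributed_measurable[OF dZ[of i]] unfolding Z_def by simp
  have ZF: "Z j \<in> borel_measurable (\<F> (real n * h))" if "j < n" for j n
  proof -
    have "B s \<in> borel_measurable (\<F> (real n * h))" if "0 \<le> s" "s \<le> real n * h" for s
      by (rule measurable_from_subalg[OF _ Bm[OF that(1)]]) (use sub[OF that(2)] sp in \<open>simp add: subalgebra_def\<close>)
    then have 1: "B (real (Suc j) * h) \<in> borel_measurable (\<F> (real n * h))" "B (real j * h) \<in> borel_measurable (\<F> (real n * h))"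
      using that h by (auto intro!: mult_right_mono simp del: of_nat_Suc)
    show ?thesis unfolding Z_def using 1 by (rule borel_measurable_diff)
  qed
  have prod: "prob {y\<in>space N. \<forall>j<n. Z j y \<in> A j} = (\<Prod>j<n. prob (Z j -` A j \<inter> space N))"
    if A: "\<And>j. A j \<in> sets borel" for n and A :: "nat \<Rightarrow> real set"
  proof (induction n)
    case (Suc n)
    have "{y\<in>space N. \<forall>j<n. Z j y \<in> A j} = {y\<in>space (\<F> (real n * h)). \<forall>j\<in>{..<n}. Z j y \<in> A j}" using sp by auto
    also have "\<dots> \<in> sets (\<F> (real n * h))"
    proof (rule sets.sets_Collect_finite_All)
      fix j assume "j \<in> {..<n}"
      then have "Z j -` A j \<inter> space (\<F> (real n * h)) \<in> sets (\<F> (real n * h))"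
        using ZF A by (intro measurable_sets[OF ZF]) auto
      then show "{y \<in> space (\<F> (real n * h)). Z j y \<in> A j} \<in> sets (\<F> (real n * h))"
        by (simp add: vimage_def Int_def conj_commute)
    qed simp
    finally have a: "{y\<in>space N. \<forall>j<n. Z j y \<in> A j} \<in> sets (\<F> (real n * h))" .
    have b: "Z n -` A n \<inter> space N \<in> {(\<lambda>y. B (real (Suc n) * h) y - B (real n * h) y) -` A \<inter> space N | A. A \<in> sets borel}"
      unfolding Z_def using A[of n] by blast
    have "{y\<in>space N. \<forall>j<Suc n. Z j y \<in> A j} = {y\<in>space N. \<forall>j<n. Z j y \<in> A j} \<inter> (Z n -` A n \<inter> space N)"
      unfolding less_Suc_eq by blast
    then have "prob {y\<in>space N. \<forall>j<Suc n. Z j y \<in> A j} = prob {y\<in>space N. \<forall>j<n. Z j y \<in> A j} * prob (Z n -` A n \<inter> space N)"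
      using indep_setD[OF ind[OF t(2,3)] a b] by simp
    then show ?case using Suc.IH by simp
  qed (simp add: prob_space)
  have "indep_vars (\<lambda>_. borel) Z UNIV"
    unfolding indep_vars_def2 indep_sets_def
  proof (intro conjI ballI allI impI)
    show "{Z i -` A \<inter> space N |A. A \<in> sets borel} \<subseteq> events" for i by (auto intro: measurable_sets[OF Zm])
    fix J :: "nat set" and E assume J: "J \<noteq> {}" "finite J" and E: "E \<in> (\<Pi> i\<in>J. {Z i -` A \<inter> space N |A. A \<in> sets borel})"
    have "\<forall>i\<in>J. \<exists>A. E i = Z i -` A \<inter> space N \<and> A \<in> sets borel" using E by (auto simp: Pi_iff)
    then obtain A0 where A0: "\<And>i. i \<in> J \<Longrightarrow> E i = Z i -` A0 i \<inter> space N" "\<And>i. i \<in> J \<Longrightarrow> A0 i \<in> sets borel"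
      by metis
    define A where "A i = (if i \<in> J then A0 i else UNIV)" for i
    obtain n where n: "J \<subseteq> {..<n}" using J(2) finite_nat_set_iff_bounded by auto
    have "(\<Inter>j\<in>J. E j) = {y\<in>space N. \<forall>j<n. Z j y \<in> A j}"
    proof (intro set_eqI iffI)
      fix y assume y: "y \<in> (\<Inter>j\<in>J. E j)"
      then have "y \<in> Z j -` A0 j \<inter> space N" if "j \<in> J" for j using A0(1)[OF that] that by blast
      then show "y \<in> {y\<in>space N. \<forall>j<n. Z j y \<in> A j}" using J(1) unfolding A_def by auto
    next
      fix y assume "y \<in> {y\<in>space N. \<forall>j<n. Z j y \<in> A j}"
      then have y: "y \<in> space N" "\<And>j. j < n \<Longrightarrow> Z j y \<in> A j" by auto
      show "y \<in> (\<Inter>j\<in>J. E j)"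
      proof
        fix j assume j: "j \<in> J"
        then have "Z j y \<in> A0 j" using y(2)[of j] n unfolding A_def by auto
        then show "y \<in> E j" unfolding A0(1)[OF j] using y(1) by simp
      qed
    qed
    then have "prob (\<Inter>j\<in>J. E j) = (\<Prod>j<n. prob (Z j -` A j \<inter> space N))"
      using prod[of A n] A0(2) by (simp add: A_def)
    also have "\<dots> = (\<Prod>j\<in>J. prob (E j))"
      using n A0(1) by (intro prod.mono_neutral_cong_right) (auto simp: A_def prob_space)
    finally show "prob (\<Inter>j\<in>J. E j) = (\<Prod>j\<in>J. prob (E j))" .
  qed measurable
  then show "indep_vars (\<lambda>_. borel) (\<lambda>i y. B (real (Suc i) * h) y - B (real i * h) y) UNIV"
    unfolding Z_def .
qed

section \<open>The Euler scheme with a truncated drift\<close>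

primrec euler :: "(real \<Rightarrow> real) \<Rightarrow> real \<Rightarrow> (nat \<Rightarrow> real) \<Rightarrow> nat \<Rightarrow> real" where
  "euler b h d 0 = 1"
| "euler b h d (Suc i) = euler b h d i + d i + h * b (euler b h d i)"

definition cut_drift :: "real \<Rightarrow> real \<Rightarrow> real \<Rightarrow> real" where
  "cut_drift \<gamma> \<delta> x = \<gamma> / max x \<delta>"

lemma cut_drift_Lipschitz:
  assumes "\<gamma> \<ge> 0" "\<delta> > 0"
  shows "\<bar>cut_drift \<gamma> \<delta> x - cut_drift \<gamma> \<delta> y\<bar> \<le> \<gamma> / \<delta>\<^sup>2 * \<bar>x - y\<bar>"
proof -
  define u v where "u = max x \<delta>" and "v = max y \<delta>"
  have uv: "u \<ge> \<delta>" "v \<ge> \<delta>" "u > 0" "v > 0" using assms unfolding u_def v_def by auto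
  have "cut_drift \<gamma> \<delta> x - cut_drift \<gamma> \<delta> y = \<gamma> * (v - u) / (u * v)"
    using uv unfolding cut_drift_def u_def[symmetric] v_def[symmetric] by (simp add: field_simps)
  then have "\<bar>cut_drift \<gamma> \<delta> x - cut_drift \<gamma> \<delta> y\<bar> = \<gamma> * \<bar>v - u\<bar> / (u * v)"
    using uv assms by (simp add: abs_mult)
  also have "\<dots> \<le> \<gamma> * \<bar>v - u\<bar> / (\<delta> * \<delta>)"
    using uv assms by (intro divide_left_mono mult_mono) auto
  also have "\<dots> \<le> \<gamma> * \<bar>x - y\<bar> / (\<delta> * \<delta>)"
    using assms by (intro divide_right_mono mult_left_mono) (auto simp: u_def v_def)
  finally show ?thesis by (simp add: power2_eq_square)
qed

lemma continuous_on_cut_drift: "\<delta> > 0 \<Longrightarrow> continuous_on S (cut_drift \<gamma> \<delta>)"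
  unfolding cut_drift_def by (intro continuous_intros) (auto simp: max_def)

lemma cut_drift_bounds: "\<gamma> \<ge> 0 \<Longrightarrow> \<delta> > 0 \<Longrightarrow> 0 \<le> cut_drift \<gamma> \<delta> x" "\<gamma> \<ge> 0 \<Longrightarrow> \<delta> > 0 \<Longrightarrow> cut_drift \<gamma> \<delta> x \<le> \<gamma> / \<delta>"
  unfolding cut_drift_def by (auto intro!: divide_left_mono divide_nonneg_pos)

lemma cut_drift_eq: "x \<ge> \<delta> \<Longrightarrow> cut_drift \<gamma> \<delta> x = \<gamma> / x"
  unfolding cut_drift_def by simp

lemma euler_sum: "euler b h d i = 1 + (\<Sum>l<i. d l + h * b (euler b h d l))"
  by (induction i) auto

text \<open>Discrete Gronwall inequality. The accumulated error \<open>e\<close> is bounded, rather than the error of each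
step, so that errors with mean zero may cancel.\<close>

lemma euler_perturbation:
  assumes b: "\<And>x y. \<bar>b x - b y\<bar> \<le> L * \<bar>x - y\<bar>" and L: "L \<ge> 0" and h: "h \<ge> 0"
    and x: "\<And>i. i \<le> n \<Longrightarrow> \<bar>x i - (1 + (\<Sum>l<i. d l + h * b (x l)))\<bar> \<le> e" and i: "i \<le> n"
  shows "\<bar>x i - euler b h d i\<bar> \<le> e * exp (h * L * real i)"
proof -
  have geo: "(1 + h * L) ^ i = 1 + h * L * (\<Sum>l<i. (1 + h * L) ^ l)" for i
    by (induction i) (auto simp: algebra_simps)
  have e: "e \<ge> 0" using x[of 0] by force
  have "\<bar>x i - euler b h d i\<bar> \<le> e * (1 + h * L) ^ i"
    using i
  proof (induction i rule: less_induct)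
    case (less i)
    have "x i - euler b h d i = (x i - (1 + (\<Sum>l<i. d l + h * b (x l)))) + (\<Sum>l<i. h * (b (x l) - b (euler b h d l)))"
      unfolding euler_sum[of b h d i] by (simp add: sum.distrib sum_subtractf right_diff_distrib)
    also have "\<bar>\<dots>\<bar> \<le> e + (\<Sum>l<i. h * (L * (e * (1 + h * L) ^ l)))"
    proof (rule order.trans[OF abs_triangle_ineq add_mono[OF x[OF less.prems] order.trans[OF sum_abs sum_mono]]])
      fix l assume l: "l \<in> {..<i}"
      have "\<bar>b (x l) - b (euler b h d l)\<bar> \<le> L * \<bar>x l - euler b h d l\<bar>" by (rule b)
      also have "\<dots> \<le> L * (e * (1 + h * L) ^ l)" using l less by (intro mult_left_mono L less.IH) auto
      finally show "\<bar>h * (b (x l) - b (euler b h d l))\<bar> \<le> h * (L * (e * (1 + h * L) ^ l))"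
        using h by (simp add: abs_mult mult_left_mono)
    qed
    also have "\<dots> = e * (1 + h * L) ^ i"
      unfolding geo[of i] by (simp add: sum_distrib_left algebra_simps)
    finally show ?case .
  qed
  also have "(1 + h * L) ^ i \<le> exp (h * L) ^ i"
    using exp_ge_add_one_self[of "h * L"] h L by (intro power_mono) auto
  also have "exp (h * L) ^ i = exp (h * L * real i)" by (simp add: exp_of_nat_mult[symmetric] mult.commute)
  finally show ?thesis using e by (simp add: mult_left_mono)
qed

lemma lin_interp_grid: "h > 0 \<Longrightarrow> lin_interp h v (real n * h) = v n"
  unfolding lin_interp_def Let_def by simp

text \<open>The end point \<open>T\<close> is the node with index \<open>m\<close>, for which the interpolation formula gives the weight \<open>0\<close>
to the node with index \<open>m + 1\<close>; so it is enough that the nodes up to \<open>m\<close> are close.\<close>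

lemma lin_interp_close:
  assumes m: "m > 0" and T: "T > 0" and h: "h = T / real m"
    and near: "\<And>i t. i < m \<Longrightarrow> t \<in> {real i * h..real (Suc i) * h} \<Longrightarrow> \<bar>v i - x t\<bar> \<le> c \<and> \<bar>v (Suc i) - x t\<bar> \<le> c"
    and t: "t \<in> {0..T}"
  shows "\<bar>lin_interp h v t - x t\<bar> \<le> c"
proof -
  have h0: "h > 0" and mh: "real m * h = T" using m T h by auto
  show ?thesis
  proof (cases "t = T")
    case True
    have "\<bar>v (Suc (m - 1)) - x T\<bar> \<le> c" using near[of "m - 1" T] m mh h0 by (auto intro!: mult_right_mono)
    then show ?thesis using True m lin_interp_grid[OF h0, of v m] mh by simp
  next
    case False
    define n where "n = nat \<lfloor>t / h\<rfloor>"
    have n: "real n * h \<le> t" "t < (real n + 1) * h" unfolding n_def using floor_grid[of h t] h0 t by auto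
    have "real n * h < real m * h" using n mh t False by auto
    then have "n < m" using h0 by simp
    from near[OF this, of t] n have "\<bar>v n - x t\<bar> \<le> c" "\<bar>v (Suc n) - x t\<bar> \<le> c" by (auto simp: add.commute)
    then show ?thesis unfolding n_def by (intro lin_interp_near) (use h0 t in auto)
  qed
qed

text \<open>As long as the solution stays above \<open>\<delta>\<close>, the truncation of the drift is not seen, and freezing the drift
at the left end of each interval costs at most \<open>h * L * \<rho>\<close>, where \<open>\<rho>\<close> is the modulus of continuity.\<close>

lemma integral_equation_euler:
  fixes x W :: "real \<Rightarrow> real"
  assumes \<gamma>: "\<gamma> \<ge> 0" and \<delta>: "\<delta> > 0" and h: "h > 0" and T: "real i * h \<le> T"
    and cont: "continuous_on {0..} x" and W0: "W 0 = 0"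
    and eq: "\<And>t. t \<ge> 0 \<Longrightarrow> x t = 1 + W t + (LINT s:{0..t}|lborel. \<gamma> / x s)"
    and low: "\<And>s. s \<in> {0..real i * h} \<Longrightarrow> x s \<ge> \<delta>"
    and modulus: "\<And>s t. s \<in> {0..T} \<Longrightarrow> t \<in> {0..T} \<Longrightarrow> \<bar>s - t\<bar> \<le> h \<Longrightarrow> \<bar>x s - x t\<bar> \<le> \<rho>"
  defines "d \<equiv> (\<lambda>l. W (real (Suc l) * h) - W (real l * h))"
    and "L \<equiv> \<gamma> / \<delta>\<^sup>2"
  shows "\<bar>x (real i * h) - euler (cut_drift \<gamma> \<delta>) h d i\<bar> \<le> T * L * \<rho> * exp (L * T)"
proof -
  have L: "L \<ge> 0" unfolding L_def using \<gamma> by simp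
  have T0: "T \<ge> 0" using T h by (meson mult_nonneg_nonneg of_nat_0_le_iff less_imp_le order.trans)
  have \<rho>: "\<rho> \<ge> 0" using modulus[of 0 0] T0 h by simp
  have cx: "continuous_on {u..v} (\<lambda>s. \<gamma> / x s)" if "0 \<le> u" "v \<le> real i * h" for u v
  proof (intro continuous_intros continuous_on_subset[OF cont] ballI)
    fix s assume "s \<in> {u..v}"
    then have "x s \<ge> \<delta>" using that by (intro low) auto
    then show "x s \<noteq> 0" using \<delta> by simp
  qed (use that in auto)
  have eqI: "x t = 1 + W t + integral {0..t} (\<lambda>s. \<gamma> / x s)" if "0 \<le> t" "t \<le> real i * h" for t
    using eq[OF that(1)] set_borel_integral_eq_integral(2)[OF borel_integrable_atLeastAtMost'[OF cx[OF order_refl that(2)]]] by simp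
  have err: "\<bar>x (real j * h) - (1 + (\<Sum>l<j. d l + h * cut_drift \<gamma> \<delta> (x (real l * h))))\<bar> \<le> real j * h * (L * \<rho>)"
    if "j \<le> i" for j
    using that
  proof (induction j)
    case 0
    have "x 0 = 1 + W 0 + integral {0..0} (\<lambda>s. \<gamma> / x s)" using h by (intro eqI) auto
    then show ?case using W0 by simp
  next
    case (Suc j)
    let ?u = "real j * h" and ?v = "real (Suc j) * h"
    have uv: "0 \<le> ?u" "?u \<le> ?v" "?v \<le> real i * h" "?v - ?u = h" using h Suc.prems by (auto simp: distrib_right intro!: mult_right_mono simp del: of_nat_Suc, simp_all add: distrib_right)
    have int: "(\<lambda>s. \<gamma> / x s) integrable_on {0..?v}" by (intro integrable_continuous_real cx) (use uv in auto)
    have "x ?v - x ?u - d j = integral {?u..?v} (\<lambda>s. \<gamma> / x s)"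
      using eqI[of ?v] eqI[of ?u] uv Henstock_Kurzweil_Integration.integral_combine[OF uv(1,2) int]
      unfolding d_def by simp
    also have "\<dots> - h * cut_drift \<gamma> \<delta> (x ?u) = integral {?u..?v} (\<lambda>s. \<gamma> / x s - cut_drift \<gamma> \<delta> (x ?u))"
      using uv cx[of ?u ?v] by (subst Henstock_Kurzweil_Integration.integral_diff) (auto intro!: integrable_continuous_real)
    finally have "x ?v - x ?u - d j - h * cut_drift \<gamma> \<delta> (x ?u) = integral {?u..?v} (\<lambda>s. \<gamma> / x s - cut_drift \<gamma> \<delta> (x ?u))" by simp
    moreover have "norm (integral {?u..?v} (\<lambda>s. \<gamma> / x s - cut_drift \<gamma> \<delta> (x ?u))) \<le> L * \<rho> * (?v - ?u)"
    proof (rule integral_bound)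
      show "continuous_on {?u..?v} (\<lambda>s. \<gamma> / x s - cut_drift \<gamma> \<delta> (x ?u))"
        by (intro continuous_intros cx) (use uv in auto)
      fix s assume s: "s \<in> {?u..?v}"
      then have s': "s \<in> {0..T}" "?u \<in> {0..T}" "\<bar>s - ?u\<bar> \<le> h" using uv T unfolding atLeastAtMost_iff by linarith+
      have "\<gamma> / x s = cut_drift \<gamma> \<delta> (x s)" using low[of s] s uv unfolding atLeastAtMost_iff by (subst cut_drift_eq) (linarith, simp)
      then have "\<bar>\<gamma> / x s - cut_drift \<gamma> \<delta> (x ?u)\<bar> \<le> L * \<bar>x s - x ?u\<bar>"
        unfolding L_def using cut_drift_Lipschitz[OF \<gamma> \<delta>] by simp
      also have "\<dots> \<le> L * \<rho>" by (intro mult_left_mono L modulus s')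
      finally show "norm (\<gamma> / x s - cut_drift \<gamma> \<delta> (x ?u)) \<le> L * \<rho>" by simp
    qed (use uv in simp)
    ultimately have "\<bar>x ?v - x ?u - d j - h * cut_drift \<gamma> \<delta> (x ?u)\<bar> \<le> L * \<rho> * h" using uv(4) by simp
    moreover have "real (Suc j) * h * (L * \<rho>) = real j * h * (L * \<rho>) + L * \<rho> * h" by (simp add: algebra_simps)
    moreover note Suc.IH
    ultimately show ?case using Suc.prems by simp
  qed
  have "\<bar>x (real i * h) - euler (cut_drift \<gamma> \<delta>) h d i\<bar> \<le> T * (L * \<rho>) * exp (h * L * real i)"
  proof (rule euler_perturbation[where x="\<lambda>j. x (real j * h)"])
    show "\<bar>cut_drift \<gamma> \<delta> x - cut_drift \<gamma> \<delta> y\<bar> \<le> L * \<bar>x - y\<bar>" for x y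
      unfolding L_def by (rule cut_drift_Lipschitz[OF \<gamma> \<delta>])
    fix j assume j: "j \<le> i"
    have "real j * h \<le> T" using j T h by (meson mult_right_mono of_nat_mono less_imp_le order.trans)
    then have "real j * h * (L * \<rho>) \<le> T * (L * \<rho>)" using L \<rho> by (intro mult_right_mono) auto
    with err[OF j] show "\<bar>x (real j * h) - (1 + (\<Sum>l<j. d l + h * cut_drift \<gamma> \<delta> (x (real l * h))))\<bar> \<le> T * (L * \<rho>)"
      by (rule order.trans)
  qed (use L h in auto)
  also have "exp (h * L * real i) \<le> exp (L * T)"
    using mult_left_mono[OF T L] by (simp add: mult_ac)
  finally show ?thesis using T0 L \<rho> by (simp add: mult_left_mono mult.assoc)
qed

text \<open>The positivity of the solution comes out by induction along the grid: a scheme that stays above \<open>2 \<delta>\<close> keeps the solution above \<open>\<delta>\<close>: up to the current node the two are close, and on the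
next interval the solution moves little.\<close>

lemma integral_equation_euler_path:
  fixes x W :: "real \<Rightarrow> real"
  assumes \<gamma>: "\<gamma> \<ge> 0" and \<delta>: "\<delta> > 0" and T: "T > 0" and \<kappa>: "\<kappa> > 0"
    and cont: "continuous_on {0..} x" and nn: "\<And>t. t \<ge> 0 \<Longrightarrow> x t \<ge> 0" and W0: "W 0 = 0"
    and eq: "\<And>t. t \<ge> 0 \<Longrightarrow> x t = 1 + W t + (LINT s:{0..t}|lborel. \<gamma> / x s)"
  shows "\<forall>\<^sub>F m in sequentially. let h = T / real m; e = euler (cut_drift \<gamma> \<delta>) h (\<lambda>l. W (real (Suc l) * h) - W (real l * h))
      in (\<exists>i\<le>m. e i \<le> 2 * \<delta>) \<or> (\<forall>t\<in>{0..T}. \<bar>lin_interp h (\<lambda>i. max 0 (e i)) t - x t\<bar> \<le> \<kappa>)"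
proof -
  define L where "L = \<gamma> / \<delta>\<^sup>2"
  have L: "L \<ge> 0" unfolding L_def using \<gamma> by simp
  \<comment> \<open>with modulus of continuity \<open>\<rho>\<close>, all errors together are at most \<open>K * \<rho>\<close>\<close>
  define K where "K = T * L * exp (L * T) + 2"
  have K: "K \<ge> 2" unfolding K_def using T L by simp
  define \<rho> where "\<rho> = min \<delta> \<kappa> / K"
  have \<rho>0: "\<rho> > 0" unfolding \<rho>_def using \<delta> \<kappa> K by simp
  have "K * \<rho> = min \<delta> \<kappa>" unfolding \<rho>_def using K by simp
  then have K\<rho>: "T * L * \<rho> * exp (L * T) + 2 * \<rho> = min \<delta> \<kappa>" unfolding K_def by (simp add: algebra_simps)
  have "uniformly_continuous_on {0..T} x"
    by (intro compact_uniformly_continuous continuous_on_subset[OF cont]) auto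
  then obtain \<eta> where \<eta>: "\<eta> > 0" "\<And>s t. s \<in> {0..T} \<Longrightarrow> t \<in> {0..T} \<Longrightarrow> dist t s < \<eta> \<Longrightarrow> dist (x t) (x s) < \<rho>"
    using \<rho>0 by (elim uniformly_continuous_onE[of _ _ \<rho>]) auto
  have "(\<lambda>m. T * inverse (real m)) \<longlonglongrightarrow> T * 0" by (intro tendsto_intros lim_inverse_n)
  then have "\<forall>\<^sub>F m in sequentially. T * inverse (real m) < \<eta>" by (rule order_tendstoD) (use \<eta> in simp)
  with eventually_gt_at_top[of 0] show ?thesis
  proof eventually_elim
    case (elim m)
    define h where "h = T / real m"
    define e where "e = euler (cut_drift \<gamma> \<delta>) h (\<lambda>l. W (real (Suc l) * h) - W (real l * h))"
    have h: "h > 0" "h < \<eta>" "real m * h = T" using elim T unfolding h_def by (auto simp: divide_inverse)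
    have modulus: "\<bar>x s - x t\<bar> \<le> \<rho>" if "s \<in> {0..T}" "t \<in> {0..T}" "\<bar>s - t\<bar> \<le> h" for s t
      using \<eta>(2)[of t s] that h by (auto simp: dist_real_def)
    have main: "\<forall>t\<in>{0..T}. \<bar>lin_interp h (\<lambda>i. max 0 (e i)) t - x t\<bar> \<le> \<kappa>" if big: "\<forall>i\<le>m. e i > 2 * \<delta>"
    proof -
      have iT: "real i * h \<le> T" if "i \<le> m" for i using h that by (metis mult_right_mono of_nat_mono less_imp_le)
      have close: "\<bar>x (real i * h) - e i\<bar> \<le> T * L * \<rho> * exp (L * T)"
        if "i \<le> m" "\<And>s. s \<in> {0..real i * h} \<Longrightarrow> x s \<ge> \<delta>" for i
        unfolding e_def L_def by (rule integral_equation_euler[OF \<gamma> \<delta> h(1) iT[OF that(1)] cont W0 eq that(2) modulus])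
      have low: "\<forall>s\<in>{0..real i * h}. x s \<ge> \<delta>" if "i \<le> m" for i
        using that
      proof (induction i)
        case 0
        have "x 0 = 1 + W 0 + (LINT s:{0..0}|lborel. \<gamma> / x s)" by (rule eq) simp
        also have "(LINT s:{0..0}|lborel. \<gamma> / x s) = 0"
          using set_borel_integral_eq_integral(2)[OF borel_integrable_atLeastAtMost'[of 0 0 "\<lambda>s. \<gamma> / x s"]] by simp
        finally have "x 0 = 1" using W0 by simp
        moreover have "e 0 = 1" unfolding e_def by simp
        ultimately show ?case using big \<delta> by force
      next
        case (Suc i)
        show ?case
        proof
          fix s assume s: "s \<in> {0..real (Suc i) * h}"
          show "x s \<ge> \<delta>"
          proof (cases "s \<le> real i * h")
            case True
            then show ?thesis using Suc s by auto
          next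
            case False
            have "\<bar>x s - x (real i * h)\<bar> \<le> \<rho>"
              using iT[OF Suc.prems] False s h by (intro modulus) (auto simp: distrib_right)
            moreover have "\<bar>x (real i * h) - e i\<bar> \<le> T * L * \<rho> * exp (L * T)"
              using Suc by (intro close) auto
            moreover have "e i > 2 * \<delta>" using big Suc.prems by auto
            ultimately show ?thesis using K\<rho> \<rho>0 by linarith
          qed
        qed
      qed
      have near: "\<bar>max 0 (e i) - x t\<bar> \<le> \<kappa>" if "i \<le> m" "t \<in> {0..T}" "\<bar>real i * h - t\<bar> \<le> h" for i t
      proof -
        have "\<bar>x (real i * h) - e i\<bar> \<le> T * L * \<rho> * exp (L * T)" using low that by (intro close) auto
        moreover have "\<bar>x (real i * h) - x t\<bar> \<le> \<rho>" using iT that h by (intro modulus) auto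
        ultimately show ?thesis using nn[of t] that(2) K\<rho> \<rho>0 by (auto simp: max_def)
      qed
      show ?thesis
      proof
        fix t assume t: "t \<in> {0..T}"
        show "\<bar>lin_interp h (\<lambda>i. max 0 (e i)) t - x t\<bar> \<le> \<kappa>"
        proof (rule lin_interp_close[OF _ T h_def _ t])
          fix i t assume i: "i < m" and t: "t \<in> {real i * h..real (Suc i) * h}"
          have "0 \<le> real i * h" using h by simp
          moreover have "real (Suc i) * h \<le> T" by (rule iT) (use i in simp)
          ultimately have "t \<in> {0..T}" using t by auto
          then show "\<bar>max 0 (e i) - x t\<bar> \<le> \<kappa> \<and> \<bar>max 0 (e (Suc i)) - x t\<bar> \<le> \<kappa>"
            using i t by (intro conjI near) (auto simp: distrib_right)
        qed (use elim in simp)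
      qed
    qed
    show ?case unfolding Let_def h_def[symmetric] e_def[symmetric]
    proof (cases "\<forall>i\<le>m. e i > 2 * \<delta>")
      case True
      then show "(\<exists>i\<le>m. e i \<le> 2 * \<delta>) \<or> (\<forall>t\<in>{0..T}. \<bar>lin_interp h (\<lambda>i. max 0 (e i)) t - x t\<bar> \<le> \<kappa>)"
        using main by blast
    next
      case False
      then obtain i where "i \<le> m" "e i \<le> 2 * \<delta>" unfolding not_all not_imp not_less by blast
      then show "(\<exists>i\<le>m. e i \<le> 2 * \<delta>) \<or> (\<forall>t\<in>{0..T}. \<bar>lin_interp h (\<lambda>i. max 0 (e i)) t - x t\<bar> \<le> \<kappa>)"
        by blast
    qed
  qed
qed

section \<open>The chain follows the Euler scheme\<close>

text \<open>The deterministic core of the comparison of the chain with the Euler scheme: \<open>s\<close> is the time step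
\<open>\<epsilon>\<^sup>2\<close>, \<open>u\<close> the noise, \<open>\<psi>\<close> the corrections, and \<open>n i\<close> the first step of the \<open>i\<close>-th block. Within a
block, noise, drift and corrections move the recursion by at most \<open>\<eta> + 2 \<eta> + 4 \<eta>\<close>, which bounds the
error of freezing the drift.\<close>

lemma perturbed_recursion_euler:
  fixes R u \<psi> :: "nat \<Rightarrow> real" and n :: "nat \<Rightarrow> nat" and b :: "real \<Rightarrow> real"
  assumes R0: "R 0 = 1" and rec: "\<And>k. k < K \<Longrightarrow> R (Suc k) = R k + u k + s * b (R k) + \<psi> k"
    and s: "s > 0" and h: "h > 0" and \<eta>: "\<eta> > 0" and L: "L \<ge> 0"
    and bL: "\<And>x y. \<bar>b x - b y\<bar> \<le> L * \<bar>x - y\<bar>" and bB: "\<And>x. 0 \<le> b x" "\<And>x. b x \<le> B"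
    and \<psi>: "\<And>k. k \<le> K \<Longrightarrow> \<bar>\<Sum>j<k. \<psi> j\<bar> \<le> 2 * \<eta>"
    and n0: "n 0 = 0" and n: "mono n" and nm: "Suc (n m) \<le> K"
    and len: "\<And>i. \<bar>s * real (n (Suc i) - n i) - h\<bar> \<le> s"
    and u: "\<And>i k. i < m \<Longrightarrow> n i \<le> k \<Longrightarrow> k \<le> Suc (n (Suc i)) \<Longrightarrow> \<bar>\<Sum>j\<in>{n i..<k}. u j\<bar> \<le> \<eta>"
    and small: "(h + 2 * s) * B \<le> 2 * \<eta>" "real m * (s * B) \<le> \<eta>" and nT: "s * real (n m) \<le> T" and mh: "real m * h \<le> T"
  shows "\<And>i k. i < m \<Longrightarrow> n i \<le> k \<Longrightarrow> k \<le> Suc (n (Suc i)) \<Longrightarrow> \<bar>R k - R (n i)\<bar> \<le> 7 * \<eta>"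
    and "\<And>i. i \<le> m \<Longrightarrow> \<bar>R (n i) - euler b h (\<lambda>l. \<Sum>j\<in>{n l..<n (Suc l)}. u j) i\<bar> \<le> (7 * T * L + 3) * \<eta> * exp (L * T)"
proof -
  define \<Psi> where "\<Psi> k = (\<Sum>j<k. \<psi> j)" for k
  have B0: "B \<ge> 0" using bB[of 0] by linarith
  have step: "R k = R l + (\<Sum>j\<in>{l..<k}. u j) + (\<Sum>j\<in>{l..<k}. s * b (R j)) + (\<Psi> k - \<Psi> l)"
    if "l \<le> k" "k \<le> K" for l k
    using that
  proof (induction k rule: dec_induct)
    case (step k)
    then show ?case using rec[of k] by (simp add: \<Psi>_def)
  qed simp
  have nK: "n i \<le> n m" if "i \<le> m" for i using monoD[OF n that] .
  show osc: "\<bar>R k - R (n i)\<bar> \<le> 7 * \<eta>" if i: "i < m" and k: "n i \<le> k" "k \<le> Suc (n (Suc i))" for i k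
  proof -
    have kK: "k \<le> K" "n i \<le> K" using k nK[of "Suc i"] i nm by auto
    have "\<bar>R k - R (n i)\<bar> \<le> \<bar>\<Sum>j\<in>{n i..<k}. u j\<bar> + \<bar>\<Sum>j\<in>{n i..<k}. s * b (R j)\<bar> + \<bar>\<Psi> k\<bar> + \<bar>\<Psi> (n i)\<bar>"
      using step[OF k(1) kK(1)] by linarith
    moreover have "\<bar>\<Sum>j\<in>{n i..<k}. s * b (R j)\<bar> \<le> (h + 2 * s) * B"
    proof -
      have "\<bar>\<Sum>j\<in>{n i..<k}. s * b (R j)\<bar> \<le> (\<Sum>j\<in>{n i..<k}. s * B)"
        using s bB by (intro order.trans[OF sum_abs] sum_mono) (simp add: abs_mult)
      also have "\<dots> = s * real (k - n i) * B" by simp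
      also have "\<dots> \<le> s * (real (n (Suc i) - n i) + 1) * B"
        using k s B0 monoD[OF n, of i "Suc i"] by (intro mult_right_mono mult_left_mono) auto
      also have "\<dots> \<le> (h + 2 * s) * B"
      proof (rule mult_right_mono[OF _ B0])
        have "s * real (n (Suc i) - n i) \<le> h + s" using len[of i] by linarith
        then show "s * (real (n (Suc i) - n i) + 1) \<le> h + 2 * s" by (simp add: distrib_left)
      qed
      finally show ?thesis .
    qed
    ultimately show ?thesis
      using u[OF i k] \<psi>[OF kK(1)] \<psi>[OF kK(2)] small(1) unfolding \<Psi>_def by linarith
  qed
  define d where "d l = (\<Sum>j\<in>{n l..<n (Suc l)}. u j)" for l
  have main: "\<bar>R (n i) - (1 + (\<Sum>l<i. d l + h * b (R (n l)))) - \<Psi> (n i)\<bar> \<le> s * real (n i) * (L * (7 * \<eta>)) + real i * (s * B)"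
    if "i \<le> m" for i
    using that
  proof (induction i)
    case 0
    then show ?case by (simp add: R0 n0 \<Psi>_def)
  next
    case (Suc i)
    have le: "n i \<le> n (Suc i)" using monoD[OF n, of i "Suc i"] by simp
    have nSK: "n (Suc i) \<le> K" using nK[OF Suc.prems] nm by simp
    let ?I = "{n i..<n (Suc i)}" and ?l = "real (n (Suc i) - n i)"
    have "R (n (Suc i)) = R (n i) + d i + (\<Sum>j\<in>?I. s * b (R j)) + (\<Psi> (n (Suc i)) - \<Psi> (n i))"
      unfolding d_def by (rule step[OF le nSK])
    moreover have "\<bar>(\<Sum>j\<in>?I. s * b (R j)) - s * ?l * b (R (n i))\<bar> \<le> s * ?l * (L * (7 * \<eta>))"
    proof -
      have "(\<Sum>j\<in>?I. s * b (R j)) - s * ?l * b (R (n i)) = (\<Sum>j\<in>?I. s * (b (R j) - b (R (n i))))"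
        by (simp add: right_diff_distrib sum_subtractf)
      also have "\<bar>\<dots>\<bar> \<le> (\<Sum>j\<in>?I. s * (L * (7 * \<eta>)))"
      proof (rule order.trans[OF sum_abs sum_mono])
        fix j assume j: "j \<in> ?I"
        have "\<bar>b (R j) - b (R (n i))\<bar> \<le> L * \<bar>R j - R (n i)\<bar>" by (rule bL)
        also have "\<dots> \<le> L * (7 * \<eta>)" using j Suc.prems by (intro mult_left_mono L osc) auto
        finally show "\<bar>s * (b (R j) - b (R (n i)))\<bar> \<le> s * (L * (7 * \<eta>))" using s by (simp add: abs_mult)
      qed
      also have "\<dots> = s * ?l * (L * (7 * \<eta>))" by simp
      finally show ?thesis .
    qed
    moreover have "\<bar>s * ?l * b (R (n i)) - h * b (R (n i))\<bar> \<le> s * B"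
    proof -
      have "\<bar>s * ?l * b (R (n i)) - h * b (R (n i))\<bar> = \<bar>s * ?l - h\<bar> * b (R (n i))"
        using bB(1) by (simp add: left_diff_distrib[symmetric] abs_mult)
      also have "\<dots> \<le> s * B" using len bB s by (intro mult_mono) auto
      finally show ?thesis .
    qed
    moreover have "s * real (n (Suc i)) * (L * (7 * \<eta>)) = s * real (n i) * (L * (7 * \<eta>)) + s * ?l * (L * (7 * \<eta>))"
      using le by (simp add: of_nat_diff algebra_simps)
    moreover have "real (Suc i) * (s * B) = real i * (s * B) + s * B" by (simp add: algebra_simps)
    moreover have "\<bar>R (n i) - (1 + (\<Sum>l<i. d l + h * b (R (n l)))) - \<Psi> (n i)\<bar> \<le> s * real (n i) * (L * (7 * \<eta>)) + real i * (s * B)"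
      using Suc by simp
    moreover have "(\<Sum>l<Suc i. d l + h * b (R (n l))) = (\<Sum>l<i. d l + h * b (R (n l))) + d i + h * b (R (n i))" by simp
    ultimately show ?case by linarith
  qed
  show "\<bar>R (n i) - euler b h (\<lambda>l. \<Sum>j\<in>{n l..<n (Suc l)}. u j) i\<bar> \<le> (7 * T * L + 3) * \<eta> * exp (L * T)" if i: "i \<le> m" for i
  proof -
    have "\<bar>R (n i) - euler b h d i\<bar> \<le> (7 * T * L + 3) * \<eta> * exp (h * L * real i)"
    proof (rule euler_perturbation[where x="\<lambda>j. R (n j)", OF bL L _ _ i])
      fix j assume j: "j \<le> m"
      have "s * real (n j) \<le> s * real (n m)" using nK[of j] j s by (intro mult_left_mono) auto
      then have "s * real (n j) * (L * (7 * \<eta>)) \<le> T * (L * (7 * \<eta>))"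
        using nT L \<eta> by (intro mult_right_mono) auto
      moreover have "real j * (s * B) \<le> real m * (s * B)" using j s B0 by (intro mult_right_mono) auto
      moreover have "\<bar>\<Psi> (n j)\<bar> \<le> 2 * \<eta>" unfolding \<Psi>_def using nK[of j] j nm by (intro \<psi>) auto
      moreover have "(7 * T * L + 3) * \<eta> = T * (L * (7 * \<eta>)) + 3 * \<eta>" by (simp add: algebra_simps)
      ultimately show "\<bar>R (n j) - (1 + (\<Sum>l<j. d l + h * b (R (n l))))\<bar> \<le> (7 * T * L + 3) * \<eta>"
        using main[of j] j small(2) by linarith
    qed (use h in simp)
    also have "\<dots> \<le> (7 * T * L + 3) * \<eta> * exp (L * T)"
    proof -
      have "real i * h \<le> real m * h" using i h by (intro mult_right_mono) auto
      then have "L * (real i * h) \<le> L * T" using mh L by (intro mult_left_mono) auto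
      then have 1: "exp (h * L * real i) \<le> exp (L * T)" by (simp add: mult_ac)
      have "0 \<le> real m * h" using h by simp
      then have "0 \<le> T" using mh by linarith
      then have 2: "0 \<le> (7 * T * L + 3) * \<eta>" using L \<eta> by simp
      show ?thesis by (rule mult_left_mono[OF 1 2])
    qed
    finally show ?thesis unfolding d_def .
  qed
qed

context bessel_chain
begin

text \<open>The walk moves within a block by more than \<open>\<eta>\<close> with a probability that is exponentially small in
\<open>1 / h\<close>. The block length \<open>l\<close> allows for the rounding at both ends and for the step beyond the block
that the interpolation uses.\<close>

lemma block_noise_bound:
  assumes \<epsilon>: "\<epsilon> > 0" and h: "h > 0" and \<eta>: "\<eta> > 0" and small: "3 * \<epsilon>\<^sup>2 \<le> h"
  defines "l \<equiv> nat \<lceil>h / \<epsilon>\<^sup>2\<rceil> + 2"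
  shows "{x\<in>space P. \<exists>k\<le>K. \<eta> / \<epsilon> \<le> \<bar>\<Sum>j<k. if j \<in> {s..<s + l} then w j x else 0\<bar>} \<in> events"
    "prob {x\<in>space P. \<exists>k\<le>K. \<eta> / \<epsilon> \<le> \<bar>\<Sum>j<k. if j \<in> {s..<s + l} then w j x else 0\<bar>}
        \<le> 2 * exp (- \<eta>\<^sup>2 / (4 * h * (M + 1)\<^sup>2))"
proof -
  define \<phi> where "\<phi> k x u = (if k \<in> {s..<s + l} then u else 0 :: real)" for k :: nat and x :: 'a and u
  define c where "c k = (if k \<in> {s..<s + l} then M + 1 else 0)" for k
  have meas: "(\<lambda>(x, u). \<phi> k x u) \<in> borel_measurable (hist k \<Otimes>\<^sub>M borel)" for k
    unfolding \<phi>_def by (cases "k \<in> {s..<s + l}") auto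
  have bd: "\<bar>\<phi> k x (w k y)\<bar> \<le> c k" if "y \<in> space P" for k x y
    using bounded[OF that, of k] unfolding \<phi>_def c_def by auto
  have mean0: "expectation (\<lambda>y. \<phi> k x (w k y)) = 0" for k x
    unfolding \<phi>_def using mean[of k] by (cases "k \<in> {s..<s + l}") auto
  have "(\<Sum>k<K. (c k)\<^sup>2) = (\<Sum>k\<in>{..<K} \<inter> {s..<s + l}. (M + 1)\<^sup>2)"
    unfolding c_def by (rule sum.mono_neutral_cong_right) auto
  also have "\<dots> \<le> real l * (M + 1)\<^sup>2"
    using card_mono[of "{s..<s + l}" "{..<K} \<inter> {s..<s + l}"] by (simp add: mult_right_mono)
  finally have v: "(\<Sum>k<K. (c k)\<^sup>2) \<le> real l * (M + 1)\<^sup>2" .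
  have v0: "real l * (M + 1)\<^sup>2 > 0" using M_nonneg unfolding l_def by simp
  have a: "\<eta> / \<epsilon> > 0" using \<eta> \<epsilon> by simp
  note az = azuma_maximal_abs[OF meas bd mean0 v v0 a]
  show "{x\<in>space P. \<exists>k\<le>K. \<eta> / \<epsilon> \<le> \<bar>\<Sum>j<k. if j \<in> {s..<s + l} then w j x else 0\<bar>} \<in> events"
    using az(1) unfolding \<phi>_def by simp
  have "prob {x\<in>space P. \<exists>k\<le>K. \<eta> / \<epsilon> \<le> \<bar>\<Sum>j<k. if j \<in> {s..<s + l} then w j x else 0\<bar>}
      \<le> 2 * exp (- (\<eta> / \<epsilon>)\<^sup>2 / (2 * (real l * (M + 1)\<^sup>2)))"
    using az(2) unfolding \<phi>_def by simp
  also have "\<dots> \<le> 2 * exp (- \<eta>\<^sup>2 / (4 * h * (M + 1)\<^sup>2))"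
  proof -
    have ceil: "real (nat \<lceil>z\<rceil>) \<le> z + 1" if "z \<ge> 0" for z :: real using that by linarith
    have "real l \<le> h / \<epsilon>\<^sup>2 + 3" using ceil[OF divide_nonneg_nonneg[OF less_imp_le[OF h] zero_le_power2[of \<epsilon>]]]
      unfolding l_def of_nat_add of_nat_numeral by linarith
    then have "\<epsilon>\<^sup>2 * real l \<le> \<epsilon>\<^sup>2 * (h / \<epsilon>\<^sup>2 + 3)" by (rule mult_left_mono) simp
    also have "\<dots> = h + 3 * \<epsilon>\<^sup>2" using \<epsilon> by (simp add: distrib_left)
    finally have "\<epsilon>\<^sup>2 * real l \<le> 2 * h" using small by simp
    then have "2 * (\<epsilon>\<^sup>2 * real l) \<le> 4 * h" by linarith
    then have le: "2 * (\<epsilon>\<^sup>2 * real l) * (M + 1)\<^sup>2 \<le> 4 * h * (M + 1)\<^sup>2" by (rule mult_right_mono) simp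
    have pos: "2 * (\<epsilon>\<^sup>2 * real l) * (M + 1)\<^sup>2 > 0" using \<epsilon> v0 by (simp add: zero_less_mult_iff)
    have "\<eta>\<^sup>2 / (4 * h * (M + 1)\<^sup>2) \<le> \<eta>\<^sup>2 / (2 * (\<epsilon>\<^sup>2 * real l) * (M + 1)\<^sup>2)"
      by (rule divide_left_mono[OF le zero_le_power2 mult_pos_pos[OF less_le_trans[OF pos le] pos]])
    also have "\<dots> = (\<eta> / \<epsilon>)\<^sup>2 / (2 * (real l * (M + 1)\<^sup>2))" by (simp add: power_divide mult_ac)
    finally show ?thesis by simp
  qed
  finally show "prob {x\<in>space P. \<exists>k\<le>K. \<eta> / \<epsilon> \<le> \<bar>\<Sum>j<k. if j \<in> {s..<s + l} then w j x else 0\<bar>}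
        \<le> 2 * exp (- \<eta>\<^sup>2 / (4 * h * (M + 1)\<^sup>2))" .
qed

text \<open>The corrections with mean zero are kept only where the chain is high, so that their size is uniformly
of order \<open>\<epsilon>\<^sup>a\<close>; on the event of interest nothing is lost.\<close>

lemma correction_noise_bound:
  assumes \<epsilon>: "\<epsilon> > 0" and \<delta>: "\<delta> > 0" and low: "\<delta> / \<epsilon> \<ge> A" and \<eta>: "\<eta> > 0" and T: "T > 0" and K: "\<epsilon>\<^sup>2 * real K \<le> 2 * T"
  shows "{x\<in>space P. \<exists>k\<le>K. \<eta> / \<epsilon> \<le> \<bar>\<Sum>j<k. if \<delta> / \<epsilon> \<le> X \<epsilon> j x then D (X \<epsilon> j x) (w j x) else 0\<bar>} \<in> events"
    "prob {x\<in>space P. \<exists>k\<le>K. \<eta> / \<epsilon> \<le> \<bar>\<Sum>j<k. if \<delta> / \<epsilon> \<le> X \<epsilon> j x then D (X \<epsilon> j x) (w j x) else 0\<bar>}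
       \<le> 2 * exp (- \<eta>\<^sup>2 / (4 * T * ((C + 1) * (\<delta> / \<epsilon>) powr (-a))\<^sup>2))"
proof -
  define \<phi> where "\<phi> k x u = (if \<delta> / \<epsilon> \<le> X \<epsilon> k x then D (X \<epsilon> k x) u else 0)" for k x u
  define c where "c = (C + 1) * (\<delta> / \<epsilon>) powr (-a)"
  have c0: "c > 0" unfolding c_def using C_nonneg \<delta> \<epsilon> by simp
  have meas: "(\<lambda>(x, u). \<phi> k x u) \<in> borel_measurable (hist k \<Otimes>\<^sub>M borel)" for k
  proof -
    have [measurable]: "X \<epsilon> k \<in> borel_measurable (hist k)" by (rule chain_measurable_hist[OF order_refl])
    have 1: "(\<lambda>(x, u). (X \<epsilon> k x, u)) \<in> measurable (hist k \<Otimes>\<^sub>M borel) (borel \<Otimes>\<^sub>M borel)" by measurable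
    have [measurable]: "(\<lambda>z. D (X \<epsilon> k (fst z)) (snd z)) \<in> borel_measurable (hist k \<Otimes>\<^sub>M borel)"
      using measurable_compose[OF 1 D_meas] by (simp add: case_prod_beta')
    show ?thesis unfolding \<phi>_def case_prod_beta' by measurable
  qed
  have bd: "\<bar>\<phi> k x (w k y)\<bar> \<le> c" if y: "y \<in> space P" for k x y
  proof (cases "\<delta> / \<epsilon> \<le> X \<epsilon> k x")
    case True
    then have "\<bar>D (X \<epsilon> k x) (w k y)\<bar> \<le> C * X \<epsilon> k x powr (-a)" using low by (intro D_bound bounded[OF y]) auto
    also have "\<dots> \<le> (C + 1) * (\<delta> / \<epsilon>) powr (-a)"
      using True a_pos C_nonneg \<delta> \<epsilon> by (intro mult_mono powr_mono2') auto
    finally show ?thesis unfolding \<phi>_def c_def using True by simp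
  qed (use c0 in \<open>simp add: \<phi>_def\<close>)
  have mean0: "expectation (\<lambda>y. \<phi> k x (w k y)) = 0" for k x
    unfolding \<phi>_def using D_mean[of "X \<epsilon> k x" k] low by (cases "\<delta> / \<epsilon> \<le> X \<epsilon> k x") auto
  have e2: "\<epsilon>\<^sup>2 > 0" using \<epsilon> by simp
  have "real K \<le> 2 * T / \<epsilon>\<^sup>2" using K unfolding pos_le_divide_eq[OF e2] by (simp add: mult.commute)
  from mult_right_mono[OF this, of "c\<^sup>2"]
  have v: "(\<Sum>k<K. c\<^sup>2) \<le> 2 * T / \<epsilon>\<^sup>2 * c\<^sup>2" by simp
  have v0: "2 * T / \<epsilon>\<^sup>2 * c\<^sup>2 > 0" using T e2 c0 by simp
  have a0: "\<eta> / \<epsilon> > 0" using \<eta> \<epsilon> by simp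
  note az = azuma_maximal_abs[OF meas bd mean0 v v0 a0]
  have eq: "(\<eta> / \<epsilon>)\<^sup>2 / (2 * (2 * T / \<epsilon>\<^sup>2 * c\<^sup>2)) = \<eta>\<^sup>2 / (4 * T * c\<^sup>2)"
  proof -
    have "2 * (2 * T / \<epsilon>\<^sup>2 * c\<^sup>2) = 4 * T * c\<^sup>2 / \<epsilon>\<^sup>2" by simp
    then show ?thesis using \<epsilon> by (simp add: power_divide)
  qed
  show "{x\<in>space P. \<exists>k\<le>K. \<eta> / \<epsilon> \<le> \<bar>\<Sum>j<k. if \<delta> / \<epsilon> \<le> X \<epsilon> j x then D (X \<epsilon> j x) (w j x) else 0\<bar>} \<in> events"
    using az(1) unfolding \<phi>_def .
  show "prob {x\<in>space P. \<exists>k\<le>K. \<eta> / \<epsilon> \<le> \<bar>\<Sum>j<k. if \<delta> / \<epsilon> \<le> X \<epsilon> j x then D (X \<epsilon> j x) (w j x) else 0\<bar>}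
       \<le> 2 * exp (- \<eta>\<^sup>2 / (4 * T * ((C + 1) * (\<delta> / \<epsilon>) powr (-a))\<^sup>2))"
    using az(2) eq unfolding \<phi>_def c_def by (simp only: minus_divide_left[symmetric])
qed

text \<open>The level \<open>3 \<delta>\<close> lies between \<open>4 \<delta>\<close>, below which the chain is unlikely to go, and \<open>2 \<delta>\<close>, which the
scheme has to exceed in order to keep the Bessel process above \<open>\<delta>\<close>.\<close>

definition tracks :: "real \<Rightarrow> nat \<Rightarrow> real \<Rightarrow> real \<Rightarrow> real \<Rightarrow> 'a \<Rightarrow> bool" where
  "tracks T m \<delta> \<kappa> \<epsilon> x \<longleftrightarrow>
     (let h = T / real m; e = euler (cut_drift \<gamma> \<delta>) h (\<lambda>i. increment h \<epsilon> i x) in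
       (\<forall>i\<le>m. e i > 3 * \<delta>) \<and>
       (\<forall>t\<in>{0..T}. \<bar>lin_interp h (\<lambda>i. max 0 (e i)) t - interp_chain f w \<epsilon> t x\<bar> \<le> \<kappa>))"

text \<open>The exceptional event is the union of three: the chain gets low, the corrections accumulate, or the walk
oscillates within one of the \<open>m\<close> blocks. Off this event, the argument is deterministic.\<close>

lemma chain_near_euler_event:
  fixes T \<delta> \<eta> \<epsilon> h \<kappa> q :: real and m :: nat
  defines "L \<equiv> \<gamma> / \<delta>\<^sup>2" and "B \<equiv> \<gamma> / \<delta>"
  assumes \<epsilon>: "\<epsilon> > 0" and \<delta>: "\<delta> > 0" and T: "T > 0" and m: "m > 0" and h: "h = T / real m" and \<eta>: "\<eta> > 0"
    and high: "4 * \<delta> / \<epsilon> \<ge> A" and eT: "\<epsilon>\<^sup>2 \<le> T" and eh: "3 * \<epsilon>\<^sup>2 \<le> h"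
    and small: "(h + 2 * \<epsilon>\<^sup>2) * B \<le> 2 * \<eta>" "real m * (\<epsilon>\<^sup>2 * B) \<le> \<eta>"
    and rem: "2 * T / \<epsilon> * (C * (4 * \<delta> / \<epsilon>) powr (-b)) \<le> \<eta>"
    and err: "((7 * T * L + 3) * exp (L * T) + 14) * \<eta> \<le> min \<delta> \<kappa>"
    and low: "prob {x\<in>space P. \<exists>k\<le>Suc (grid_index h \<epsilon> m). X \<epsilon> k x \<le> 4 * \<delta> / \<epsilon>} \<le> q"
  shows "\<exists>G\<in>events. prob G \<ge> 1 - (q + 2 * exp (- \<eta>\<^sup>2 / (4 * T * ((C + 1) * (4 * \<delta> / \<epsilon>) powr (-a))\<^sup>2))
       + real m * (2 * exp (- \<eta>\<^sup>2 / (4 * h * (M + 1)\<^sup>2)))) \<and>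
     (\<forall>x\<in>G. tracks T m \<delta> \<kappa> \<epsilon> x)"
proof -
  define n where "n = grid_index h \<epsilon>"
  define K where "K = Suc (n m)"
  define l where "l = nat \<lceil>h / \<epsilon>\<^sup>2\<rceil> + 2"
  have h0: "h > 0" and mh: "real m * h = T" using m T h by auto
  have e2: "\<epsilon>\<^sup>2 > 0" using \<epsilon> by simp
  have \<gamma>0: "\<gamma> \<ge> 0" using gamma by simp
  have L: "L \<ge> 0" unfolding L_def using \<gamma>0 by simp
  note nb = grid_index_bounds[OF less_imp_le[OF h0] \<epsilon>, folded n_def]
  have n: "mono n" unfolding n_def using h0 by (intro grid_index_mono) simp
  have n0: "n 0 = 0" unfolding n_def grid_index_def by simp
  have KT: "\<epsilon>\<^sup>2 * real K \<le> 2 * T"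
    using nb(1)[of m] eT mh unfolding K_def by (simp add: distrib_left)
  have high': "4 * \<delta> / \<epsilon> > 0" using \<delta> \<epsilon> by simp
  define \<phi> where "\<phi> j x = (if 4 * \<delta> / \<epsilon> \<le> X \<epsilon> j x then D (X \<epsilon> j x) (w j x) else 0)" for j x
  define Bad1 where "Bad1 = {x\<in>space P. \<exists>k\<le>K. X \<epsilon> k x \<le> 4 * \<delta> / \<epsilon>}"
  define Bad2 where "Bad2 = {x\<in>space P. \<exists>k\<le>K. \<eta> / \<epsilon> \<le> \<bar>\<Sum>j<k. \<phi> j x\<bar>}"
  define Bad3 where "Bad3 i = {x\<in>space P. \<exists>k\<le>K. \<eta> / \<epsilon> \<le> \<bar>\<Sum>j<k. if j \<in> {n i..<n i + l} then w j x else 0\<bar>}" for i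
  have b1: "Bad1 \<in> events" unfolding Bad1_def by measurable
  have b2: "Bad2 \<in> events" "prob Bad2 \<le> 2 * exp (- \<eta>\<^sup>2 / (4 * T * ((C + 1) * (4 * \<delta> / \<epsilon>) powr (-a))\<^sup>2))"
  proof -
    have d4: "4 * \<delta> > 0" using \<delta> by simp
    show "Bad2 \<in> events" "prob Bad2 \<le> 2 * exp (- \<eta>\<^sup>2 / (4 * T * ((C + 1) * (4 * \<delta> / \<epsilon>) powr (-a))\<^sup>2))"
      unfolding Bad2_def \<phi>_def by (rule correction_noise_bound[OF \<epsilon> d4 high \<eta> T KT])+
  qed
  have b3: "Bad3 i \<in> events" "prob (Bad3 i) \<le> 2 * exp (- \<eta>\<^sup>2 / (4 * h * (M + 1)\<^sup>2))" for i
    unfolding Bad3_def l_def by (rule block_noise_bound[OF \<epsilon> h0 \<eta> eh])+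
  define Bad where "Bad = Bad1 \<union> Bad2 \<union> (\<Union>i<m. Bad3 i)"
  have bad: "Bad \<in> events" unfolding Bad_def using b1 b2 b3 by auto
  have "prob Bad \<le> prob Bad1 + prob Bad2 + prob (\<Union>i<m. Bad3 i)"
    unfolding Bad_def using b1 b2 b3 by (intro order.trans[OF measure_Un_le] add_mono measure_Un_le) auto
  also have "prob (\<Union>i<m. Bad3 i) \<le> (\<Sum>i<m. prob (Bad3 i))"
    using b3 by (intro finite_measure_subadditive_finite) auto
  also have "\<dots> \<le> (\<Sum>i<m. 2 * exp (- \<eta>\<^sup>2 / (4 * h * (M + 1)\<^sup>2)))" by (intro sum_mono b3)
  finally have pBad: "prob Bad \<le> q + 2 * exp (- \<eta>\<^sup>2 / (4 * T * ((C + 1) * (4 * \<delta> / \<epsilon>) powr (-a))\<^sup>2))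
       + real m * (2 * exp (- \<eta>\<^sup>2 / (4 * h * (M + 1)\<^sup>2)))"
    using b2(2) low unfolding Bad1_def K_def n_def by simp
  have good: "tracks T m \<delta> \<kappa> \<epsilon> x" if x: "x \<in> space P - Bad" for x
  proof -
    have xP: "x \<in> space P" using x by simp
    have g1: "X \<epsilon> k x > 4 * \<delta> / \<epsilon>" if "k \<le> K" for k
      using x that unfolding Bad_def Bad1_def by force
    have g2: "\<bar>\<Sum>j<k. \<phi> j x\<bar> < \<eta> / \<epsilon>" if "k \<le> K" for k
      using x that unfolding Bad_def Bad2_def by force
    have g3: "\<bar>\<Sum>j<k. if j \<in> {n i..<n i + l} then w j x else 0\<bar> < \<eta> / \<epsilon>" if "k \<le> K" "i < m" for k i
    proof (rule ccontr)
      assume "\<not> ?thesis"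
      then have "x \<in> Bad3 i" unfolding Bad3_def not_less using xP that(1) by blast
      then show False using x that(2) unfolding Bad_def by blast
    qed
    define R where "R k = \<epsilon> * X \<epsilon> k x" for k
    define u where "u k = \<epsilon> * w k x" for k
    define \<psi> where "\<psi> k = \<epsilon> * \<phi> k x + \<epsilon> * r (X \<epsilon> k x)" for k
    define e where "e = euler (cut_drift \<gamma> \<delta>) h (\<lambda>i. increment h \<epsilon> i x)"
    have inc: "increment h \<epsilon> i x = (\<Sum>j\<in>{n i..<n (Suc i)}. u j)" for i
      unfolding increment_def n_def u_def by (simp add: sum_distrib_left)
    have Rpos: "R k > 0" for k unfolding R_def using chain_pos[OF \<epsilon>] \<epsilon> by simp
    have Rlow: "R k > 4 * \<delta>" if "k \<le> K" for k
      using mult_strict_left_mono[OF g1[OF that] \<epsilon>] \<epsilon> unfolding R_def by simp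
    have R0: "R 0 = 1" unfolding R_def using \<epsilon> by simp
    have rec: "R (Suc k) = R k + u k + \<epsilon>\<^sup>2 * cut_drift \<gamma> \<delta> (R k) + \<psi> k" if k: "k < K" for k
    proof -
      have kK: "k \<le> K" using k by simp
      have hi: "X \<epsilon> k x \<ge> A" "4 * \<delta> / \<epsilon> \<le> X \<epsilon> k x" using g1[OF kK] high by auto
      have "cut_drift \<gamma> \<delta> (R k) = \<gamma> / R k" using Rlow[OF kK] \<delta> by (intro cut_drift_eq) simp
      then have "\<epsilon>\<^sup>2 * cut_drift \<gamma> \<delta> (R k) = \<epsilon> * (\<gamma> / X \<epsilon> k x)"
        unfolding R_def using \<epsilon> by (simp add: power2_eq_square)
      moreover have "X \<epsilon> (Suc k) x = X \<epsilon> k x + w k x + \<gamma> / X \<epsilon> k x + D (X \<epsilon> k x) (w k x) + r (X \<epsilon> k x)"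
        using f_eq[OF hi(1) bounded[OF xP, of k]] by simp
      ultimately show ?thesis unfolding R_def u_def \<psi>_def \<phi>_def using hi(2) by (simp only: if_True distrib_left)
    qed
    have \<psi>: "\<bar>\<Sum>j<k. \<psi> j\<bar> \<le> 2 * \<eta>" if k: "k \<le> K" for k
    proof -
      have "(\<Sum>j<k. \<psi> j) = \<epsilon> * (\<Sum>j<k. \<phi> j x) + (\<Sum>j<k. \<epsilon> * r (X \<epsilon> j x))"
        unfolding \<psi>_def by (simp add: sum.distrib sum_distrib_left)
      moreover have "\<bar>\<epsilon> * (\<Sum>j<k. \<phi> j x)\<bar> \<le> \<eta>"
        using g2[OF k] \<epsilon> by (simp add: abs_mult field_simps)
      moreover have "\<bar>\<Sum>j<k. \<epsilon> * r (X \<epsilon> j x)\<bar> \<le> \<eta>"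
      proof -
        have "\<bar>\<Sum>j<k. \<epsilon> * r (X \<epsilon> j x)\<bar> \<le> (\<Sum>j<k. \<epsilon> * (C * (4 * \<delta> / \<epsilon>) powr (-b)))"
        proof (rule order.trans[OF sum_abs sum_mono])
          fix j assume j: "j \<in> {..<k}"
          then have hi: "X \<epsilon> j x > 4 * \<delta> / \<epsilon>" using k by (intro g1) auto
          have "\<bar>r (X \<epsilon> j x)\<bar> \<le> C * X \<epsilon> j x powr (-b)" using hi high by (intro r_bound) simp
          also have "\<dots> \<le> C * (4 * \<delta> / \<epsilon>) powr (-b)"
            using hi high' b_gt1 by (intro mult_left_mono C_nonneg powr_mono2') auto
          finally show "\<bar>\<epsilon> * r (X \<epsilon> j x)\<bar> \<le> \<epsilon> * (C * (4 * \<delta> / \<epsilon>) powr (-b))"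
            using \<epsilon> by (simp add: abs_mult)
        qed
        also have "\<dots> = real k * \<epsilon> * (C * (4 * \<delta> / \<epsilon>) powr (-b))" by simp
        also have "\<dots> \<le> 2 * T / \<epsilon> * (C * (4 * \<delta> / \<epsilon>) powr (-b))"
        proof (rule mult_right_mono)
          have "real k * \<epsilon> \<le> real K * \<epsilon>" using k \<epsilon> by simp
          also have "real K * \<epsilon> \<le> 2 * T / \<epsilon>" using KT \<epsilon> by (simp add: pos_le_divide_eq power2_eq_square mult_ac)
          finally show "real k * \<epsilon> \<le> 2 * T / \<epsilon>" .
        qed (use C_nonneg in simp)
        finally show ?thesis using rem by simp
      qed
      ultimately show ?thesis by linarith
    qed
    have len: "\<bar>\<epsilon>\<^sup>2 * real (n (Suc i) - n i) - h\<bar> \<le> \<epsilon>\<^sup>2" for i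
    proof -
      have "\<epsilon>\<^sup>2 * real (n (Suc i) - n i) = \<epsilon>\<^sup>2 * real (n (Suc i)) - \<epsilon>\<^sup>2 * real (n i)"
        using monoD[OF n, of i "Suc i"] by (simp add: of_nat_diff right_diff_distrib)
      moreover have "real (Suc i) * h = real i * h + h" by (simp add: distrib_right)
      ultimately show ?thesis using nb(1)[of i] nb(2)[of i] nb(1)[of "Suc i"] nb(2)[of "Suc i"] by linarith
    qed
    have u: "\<bar>\<Sum>j\<in>{n i..<k}. u j\<bar> \<le> \<eta>" if i: "i < m" and k: "n i \<le> k" "k \<le> Suc (n (Suc i))" for i k
    proof -
      have "k \<le> n i + l"
      proof -
        have "\<epsilon>\<^sup>2 * real (n (Suc i) - n i) \<le> h + \<epsilon>\<^sup>2" using len[of i] by linarith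
        then have "real (n (Suc i) - n i) \<le> h / \<epsilon>\<^sup>2 + 1"
          using e2 by (simp add: field_simps)
        also have "\<dots> \<le> real (nat \<lceil>h / \<epsilon>\<^sup>2\<rceil>) + 1" by (simp add: real_nat_ceiling_ge)
        finally have "n (Suc i) - n i \<le> nat \<lceil>h / \<epsilon>\<^sup>2\<rceil> + 1" by linarith
        then show ?thesis using k unfolding l_def by linarith
      qed
      moreover have kK: "k \<le> K" using k monoD[OF n, of "Suc i" m] i unfolding K_def by auto
      ultimately have "(\<Sum>j<k. if j \<in> {n i..<n i + l} then w j x else 0) = (\<Sum>j\<in>{n i..<k}. w j x)"
        by (intro sum.mono_neutral_cong_right) auto
      moreover have "(\<Sum>j\<in>{n i..<k}. u j) = \<epsilon> * (\<Sum>j\<in>{n i..<k}. w j x)" unfolding u_def by (simp add: sum_distrib_left)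
      ultimately show ?thesis using g3[OF kK i] \<epsilon> by (simp add: abs_mult field_simps)
    qed
    have nT: "\<epsilon>\<^sup>2 * real (n m) \<le> T" using nb(1)[of m] mh by simp
    note pr = perturbed_recursion_euler[where R=R and u=u and \<psi>=\<psi> and n=n and b="cut_drift \<gamma> \<delta>" and K=K and s="\<epsilon>\<^sup>2" and h=h
        and \<eta>=\<eta> and L=L and B=B and m=m and T=T, OF R0 rec e2 h0 \<eta> L _ _ _ \<psi> n0 n _ len u small nT]
    have side: "\<bar>cut_drift \<gamma> \<delta> y - cut_drift \<gamma> \<delta> z\<bar> \<le> L * \<bar>y - z\<bar>" "0 \<le> cut_drift \<gamma> \<delta> y" "cut_drift \<gamma> \<delta> y \<le> B" for y z
      unfolding L_def B_def using cut_drift_Lipschitz[OF \<gamma>0 \<delta>] cut_drift_bounds[OF \<gamma>0 \<delta>] by auto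
    have osc: "\<bar>R k - R (n i)\<bar> \<le> 7 * \<eta>" if "i < m" "n i \<le> k" "k \<le> Suc (n (Suc i))" for i k
      by (rule pr(1)) (use side that mh K_def in auto)
    define c where "c = (7 * T * L + 3) * \<eta> * exp (L * T)"
    have close: "\<bar>R (n i) - e i\<bar> \<le> c" if "i \<le> m" for i
      unfolding e_def inc c_def by (rule pr(2)) (use side that mh K_def in auto)
    have c: "c + 14 * \<eta> \<le> min \<delta> \<kappa>" using err unfolding c_def by (simp add: algebra_simps)
    have nm: "n i \<le> K" if "i \<le> m" for i using monoD[OF n that] unfolding K_def by simp
    have maxle: "\<bar>max 0 (e i) - y\<bar> \<le> \<bar>e i - y\<bar>" if "y > 0" for i y using that by (auto simp: max_def)
    have part1: "e i > 3 * \<delta>" if "i \<le> m" for i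
      using close[OF that] Rlow[OF nm[OF that]] c \<eta> by linarith
    have part2: "\<bar>lin_interp h (\<lambda>i. max 0 (e i)) t - interp_chain f w \<epsilon> t x\<bar> \<le> \<kappa>" if t: "t \<in> {0..T}" for t
    proof (rule lin_interp_close[OF m T h _ t])
      fix i t assume i: "i < m" and t: "t \<in> {real i * h..real (Suc i) * h}"
      have t0: "t \<ge> 0" using t h0 by (meson atLeastAtMost_iff less_imp_le mult_nonneg_nonneg of_nat_0_le_iff order.trans)
      define k where "k = nat \<lfloor>t / \<epsilon>\<^sup>2\<rfloor>"
      have k: "n i \<le> k" "k \<le> n (Suc i)"
        unfolding k_def n_def grid_index_def using t e2
        by (auto intro!: nat_mono floor_mono divide_right_mono simp del: of_nat_Suc)
      have "\<bar>interp_chain f w \<epsilon> t x - R (n i)\<bar> \<le> 7 * \<eta>"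
        unfolding interp_chain_eq_lin_interp[OF \<epsilon>] R_def[symmetric]
      proof (rule lin_interp_near[OF e2 t0])
        show "\<bar>R (nat \<lfloor>t / \<epsilon>\<^sup>2\<rfloor>) - R (n i)\<bar> \<le> 7 * \<eta>" unfolding k_def[symmetric] using k by (intro osc i) auto
        show "\<bar>R (Suc (nat \<lfloor>t / \<epsilon>\<^sup>2\<rfloor>)) - R (n i)\<bar> \<le> 7 * \<eta>" unfolding k_def[symmetric] using k by (intro osc i) auto
      qed
      moreover have "\<bar>R (n (Suc i)) - R (n i)\<bar> \<le> 7 * \<eta>"
        using monoD[OF n, of i "Suc i"] by (intro osc i) auto
      moreover have "\<bar>max 0 (e i) - R (n i)\<bar> \<le> c" "\<bar>max 0 (e (Suc i)) - R (n (Suc i))\<bar> \<le> c"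
        using maxle[OF Rpos, of i "n i"] maxle[OF Rpos, of "Suc i" "n (Suc i)"] close[of i] close[of "Suc i"] i
        by (auto simp: abs_minus_commute)
      ultimately show "\<bar>max 0 (e i) - interp_chain f w \<epsilon> t x\<bar> \<le> \<kappa> \<and> \<bar>max 0 (e (Suc i)) - interp_chain f w \<epsilon> t x\<bar> \<le> \<kappa>"
        using c \<eta> by linarith
    qed
    show ?thesis using part1 part2 unfolding tracks_def Let_def h[symmetric] e_def by blast
  qed
  show ?thesis
  proof (intro bexI[of _ "space P - Bad"] conjI)
    show "prob (space P - Bad) \<ge> 1 - (q + 2 * exp (- \<eta>\<^sup>2 / (4 * T * ((C + 1) * (4 * \<delta> / \<epsilon>) powr (-a))\<^sup>2))
       + real m * (2 * exp (- \<eta>\<^sup>2 / (4 * h * (M + 1)\<^sup>2))))"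
      using pBad prob_compl[OF bad] by linarith
  qed (use good bad in blast)+
qed

text \<open>The order of the limits: given \<open>\<delta>\<close> and \<open>\<kappa>\<close>, the tolerance \<open>\<eta>\<close> is fixed such that the Gronwall factor
is harmless, then \<open>m\<close> is taken large enough for the block oscillations, and finally \<open>\<epsilon>\<close> small
enough for the corrections and the rounding.\<close>

lemma chain_near_euler:
  fixes T :: real
  assumes T: "T > 0"
  shows "\<exists>p>0. \<forall>\<delta>>0. \<forall>\<kappa>>0. \<forall>\<^sub>F m in sequentially. \<forall>\<^sub>F \<epsilon> in at_right 0.
    \<exists>G\<in>events. prob G \<ge> 1 - ((4 * \<delta>) powr p + \<kappa>) \<and>
     (\<forall>x\<in>G. tracks T m \<delta> \<kappa> \<epsilon> x)"
proof -
  obtain p A' where p: "p > 0" and A': "A' \<ge> A" and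
    low: "\<And>\<epsilon> \<delta> n. \<epsilon> > 0 \<Longrightarrow> \<delta> > 0 \<Longrightarrow> \<delta> / \<epsilon> \<ge> A' \<Longrightarrow> prob {x\<in>space P. \<exists>k\<le>n. X \<epsilon> k x \<le> \<delta> / \<epsilon>} \<le> \<delta> powr p"
    using prob_chain_low by blast
  have "\<forall>\<^sub>F m in sequentially. \<forall>\<^sub>F \<epsilon> in at_right 0.
    \<exists>G\<in>events. prob G \<ge> 1 - ((4 * \<delta>) powr p + \<kappa>) \<and>
     (\<forall>x\<in>G. tracks T m \<delta> \<kappa> \<epsilon> x)" if \<delta>: "\<delta> > 0" and \<kappa>: "\<kappa> > 0" for \<delta> \<kappa>
  proof -
    define L where "L = \<gamma> / \<delta>\<^sup>2"
    define B where "B = \<gamma> / \<delta>"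
    have L: "L \<ge> 0" and B: "B > 0" unfolding L_def B_def using gamma \<delta> by auto
    \<comment> \<open>all errors together are at most \<open>c * \<eta>\<close>\<close>
    define c where "c = (7 * T * L + 3) * exp (L * T) + 14"
    have "c \<ge> 14" unfolding c_def using T L by simp
    define \<eta> where "\<eta> = min \<delta> \<kappa> / c"
    have \<eta>: "\<eta> > 0" unfolding \<eta>_def using \<open>c \<ge> 14\<close> \<delta> \<kappa> by simp
    have err: "((7 * T * L + 3) * exp (L * T) + 14) * \<eta> \<le> min \<delta> \<kappa>"
      unfolding c_def[symmetric] \<eta>_def using \<open>c \<ge> 14\<close> by simp
    have "(\<lambda>m. T * B * inverse (real m)) \<longlonglongrightarrow> T * B * 0" by (intro tendsto_intros lim_inverse_n)
    then have m1: "\<forall>\<^sub>F m in sequentially. T * B * inverse (real m) < \<eta>" by (rule order_tendstoD) (use \<eta> in simp)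
    have q0: "\<eta>\<^sup>2 / (4 * T * (M + 1)\<^sup>2) > 0" using \<eta> T M_nonneg by simp
    have "(\<lambda>m::nat. real m * (2 * exp (- s * real m))) \<longlonglongrightarrow> 0" if "s > 0" for s :: real
      using that by real_asymp
    from this[OF q0] have m2: "\<forall>\<^sub>F m in sequentially. real m * (2 * exp (- (\<eta>\<^sup>2 / (4 * T * (M + 1)\<^sup>2)) * real m)) < \<kappa> / 2"
      by (rule order_tendstoD) (use \<kappa> in simp)
    from m1 m2 eventually_gt_at_top[of 0] show ?thesis
    proof eventually_elim
      case (elim m)
      define h where "h = T / real m"
      have h0: "h > 0" unfolding h_def using elim(3) T by simp
      have hB: "h * B < \<eta>" using elim(1) unfolding h_def by (simp add: divide_inverse mult_ac)
      have ep: "- \<eta>\<^sup>2 / (4 * h * (M + 1)\<^sup>2) = - (\<eta>\<^sup>2 / (4 * T * (M + 1)\<^sup>2)) * real m"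
        unfolding h_def using elim(3) T by simp
      have mk: "real m * (2 * exp (- \<eta>\<^sup>2 / (4 * h * (M + 1)\<^sup>2))) < \<kappa> / 2" unfolding ep by (rule elim(2))
      have pos: "\<forall>\<^sub>F \<epsilon> in at_right 0. \<epsilon> > (0::real)" by (rule eventually_at_right_less)
      have inf: "filterlim (\<lambda>\<epsilon>. 4 * \<delta> / \<epsilon>) at_top (at_right 0)"
        using \<delta> by real_asymp
      have sq: "((\<lambda>\<epsilon>::real. \<epsilon>\<^sup>2) \<longlongrightarrow> 0) (at_right 0)" by real_asymp
      have e1: "\<forall>\<^sub>F \<epsilon> in at_right 0. 4 * \<delta> / \<epsilon> \<ge> A'" using inf unfolding filterlim_at_top by blast
      have sm: "\<forall>\<^sub>F \<epsilon> in at_right 0. c * \<epsilon>\<^sup>2 < d" if "d > 0" for c d :: real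
        using order_tendstoD(2)[OF tendsto_mult_left[OF sq, of c], of d] that by simp
      have "((\<lambda>\<epsilon>. 2 * T * C * (4 * \<delta>) powr (-b) * \<epsilon> powr (b - 1)) \<longlongrightarrow> 2 * T * C * (4 * \<delta>) powr (-b) * 0) (at_right 0)"
      proof (intro tendsto_intros)
        show "((\<lambda>\<epsilon>::real. \<epsilon> powr (b - 1)) \<longlongrightarrow> 0) (at_right 0)" using b_gt1 by real_asymp
      qed
      then have e5: "\<forall>\<^sub>F \<epsilon> in at_right 0. 2 * T * C * (4 * \<delta>) powr (-b) * \<epsilon> powr (b - 1) < \<eta>"
        by (rule order_tendstoD) (use \<eta> in simp)
      have "((\<lambda>\<epsilon>. 2 * exp (- (\<eta>\<^sup>2 / (4 * T * (C + 1)\<^sup>2) * ((4 * \<delta> / \<epsilon>) powr a)\<^sup>2))) \<longlongrightarrow> 0) (at_right 0)"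
      proof -
        have k: "\<eta>\<^sup>2 / (4 * T * (C + 1)\<^sup>2) > 0" using \<eta> T C_nonneg by simp
        have "((\<lambda>y. 2 * exp (- (s * (y powr a)\<^sup>2))) \<longlongrightarrow> 0) at_top" if "s > 0" for s :: real
          using that a_pos by real_asymp
        from filterlim_compose[OF this[OF k] inf] show ?thesis .
      qed
      then have e6: "\<forall>\<^sub>F \<epsilon> in at_right 0. 2 * exp (- (\<eta>\<^sup>2 / (4 * T * (C + 1)\<^sup>2) * ((4 * \<delta> / \<epsilon>) powr a)\<^sup>2)) < \<kappa> / 2"
        by (rule order_tendstoD) (use \<kappa> in simp)
      from pos e1 sm[OF T, of 1] sm[OF h0, of 3] sm[OF \<eta>, of "2 * B"] sm[OF \<eta>, of "real m * B"] e5 e6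
      show ?case
      proof eventually_elim
        case (elim \<epsilon>)
        note \<epsilon> = elim(1)
        have d4: "4 * \<delta> > 0" using \<delta> by simp
        have "2 * T / \<epsilon> * (C * (4 * \<delta> / \<epsilon>) powr (-b)) = 2 * T * C * (4 * \<delta>) powr (-b) * \<epsilon> powr (b - 1)"
        proof -
          have 1: "(4 * \<delta> / \<epsilon>) powr (-b) = (4 * \<delta>) powr (-b) / \<epsilon> powr (-b)"
            by (rule powr_divide)
          have 2: "1 / \<epsilon> powr (-b) = \<epsilon> powr b" by (simp add: powr_minus_divide)
          have 3: "\<epsilon> powr b = \<epsilon> powr (b - 1) * \<epsilon>" using powr_add[of \<epsilon> "b - 1" 1] \<epsilon> by simp
          have "2 * T / \<epsilon> * (C * (4 * \<delta> / \<epsilon>) powr (-b)) = 2 * T * C * (4 * \<delta>) powr (-b) * (1 / \<epsilon> powr (-b)) / \<epsilon>"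
            unfolding 1 by (simp add: mult_ac)
          also have "\<dots> = 2 * T * C * (4 * \<delta>) powr (-b) * \<epsilon> powr (b - 1)"
            unfolding 2 3 using \<epsilon> by simp
          finally show ?thesis .
        qed
        then have rem: "2 * T / \<epsilon> * (C * (4 * \<delta> / \<epsilon>) powr (-b)) \<le> \<eta>" using elim(7) by linarith
        have corr: "- \<eta>\<^sup>2 / (4 * T * ((C + 1) * (4 * \<delta> / \<epsilon>) powr (-a))\<^sup>2) =
            - (\<eta>\<^sup>2 / (4 * T * (C + 1)\<^sup>2) * ((4 * \<delta> / \<epsilon>) powr a)\<^sup>2)"
        proof -
          have "- \<eta>\<^sup>2 / (4 * T * ((C + 1) * inverse z)\<^sup>2) = - (\<eta>\<^sup>2 / (4 * T * (C + 1)\<^sup>2) * z\<^sup>2)" for z :: real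
          proof -
            have "4 * T * ((C + 1) * inverse z)\<^sup>2 = (4 * T * (C + 1)\<^sup>2) * inverse (z\<^sup>2)"
              by (simp only: power_mult_distrib power_inverse mult.assoc)
            then show ?thesis by (simp only: divide_inverse inverse_mult_distrib inverse_inverse_eq mult.assoc mult_minus_left)
          qed
          then show ?thesis unfolding powr_minus .
        qed
        have "\<exists>G\<in>events. prob G \<ge> 1 - ((4 * \<delta>) powr p + 2 * exp (- \<eta>\<^sup>2 / (4 * T * ((C + 1) * (4 * \<delta> / \<epsilon>) powr (-a))\<^sup>2))
             + real m * (2 * exp (- \<eta>\<^sup>2 / (4 * h * (M + 1)\<^sup>2)))) \<and>
           (\<forall>x\<in>G. tracks T m \<delta> \<kappa> \<epsilon> x)"
        proof (rule chain_near_euler_event[OF \<epsilon> \<delta> T _ h_def \<eta>])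
          show "prob {x\<in>space P. \<exists>k\<le>Suc (grid_index h \<epsilon> m). X \<epsilon> k x \<le> 4 * \<delta> / \<epsilon>} \<le> (4 * \<delta>) powr p"
            using elim(2) by (intro low \<epsilon> d4)
          show "(h + 2 * \<epsilon>\<^sup>2) * (\<gamma> / \<delta>) \<le> 2 * \<eta>" unfolding B_def[symmetric]
            using elim(5) hB by (simp add: algebra_simps)
          show "real m * (\<epsilon>\<^sup>2 * (\<gamma> / \<delta>)) \<le> \<eta>" unfolding B_def[symmetric]
            using elim(6) by (simp add: mult_ac)
          show "4 * \<delta> / \<epsilon> \<ge> A" using elim(2) A' by simp
          show "\<epsilon>\<^sup>2 \<le> T" "3 * \<epsilon>\<^sup>2 \<le> h" using elim(3,4) by simp_all
          show "0 < m" by fact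
          show "2 * T / \<epsilon> * (C * (4 * \<delta> / \<epsilon>) powr (-b)) \<le> \<eta>" by (rule rem)
          show "((7 * T * (\<gamma> / \<delta>\<^sup>2) + 3) * exp (\<gamma> / \<delta>\<^sup>2 * T) + 14) * \<eta> \<le> min \<delta> \<kappa>"
            using err unfolding L_def .
        qed
        then obtain G where G: "G \<in> events"
          "prob G \<ge> 1 - ((4 * \<delta>) powr p + 2 * exp (- \<eta>\<^sup>2 / (4 * T * ((C + 1) * (4 * \<delta> / \<epsilon>) powr (-a))\<^sup>2))
             + real m * (2 * exp (- \<eta>\<^sup>2 / (4 * h * (M + 1)\<^sup>2))))"
          "\<forall>x\<in>G. tracks T m \<delta> \<kappa> \<epsilon> x" by blast
        have "1 - ((4 * \<delta>) powr p + \<kappa>) \<le> prob G"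
          using G(2) mk elim(8) unfolding corr by linarith
        with G(1,3) show ?case by (intro bexI[of _ G] conjI)
      qed
    qed
  qed
  then show ?thesis using p by blast
qed

end

section \<open>Measurability and continuity of the Euler path\<close>

definition euler_path :: "real \<Rightarrow> real \<Rightarrow> real \<Rightarrow> nat \<Rightarrow> (nat \<Rightarrow> real) \<Rightarrow> real \<Rightarrow> real" where
  "euler_path \<gamma> \<delta> T m d =
     interp_path T (T / real m) (\<lambda>i. max 0 (euler (cut_drift \<gamma> \<delta>) (T / real m) d i))"

lemma cut_drift_isCont: "\<delta> > 0 \<Longrightarrow> isCont (cut_drift \<gamma> \<delta>) x"
  using continuous_on_cut_drift[of \<delta> UNIV \<gamma>] by (simp add: continuous_on_eq_continuous_at)

lemma euler_measurable:
  assumes "\<delta> > 0" "\<And>i. (\<lambda>y. d y i) \<in> borel_measurable N"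
  shows "(\<lambda>y. euler (cut_drift \<gamma> \<delta>) h (d y) i) \<in> borel_measurable N"
proof (induction i)
  case (Suc i)
  have "cut_drift \<gamma> \<delta> \<in> borel_measurable borel"
    by (rule borel_measurable_continuous_onI[OF continuous_on_cut_drift[OF assms(1)]])
  from measurable_compose[OF Suc.IH this] Suc.IH assms(2)[of i] show ?case by simp
qed simp

lemma euler_tendsto:
  assumes "\<delta> > 0" "\<And>i. (\<lambda>k. d k i) \<longlonglongrightarrow> d' i"
  shows "(\<lambda>k. euler (cut_drift \<gamma> \<delta>) h (d k) i) \<longlonglongrightarrow> euler (cut_drift \<gamma> \<delta>) h d' i"
proof (induction i)
  case (Suc i)
  have "(\<lambda>k. cut_drift \<gamma> \<delta> (euler (cut_drift \<gamma> \<delta>) h (d k) i)) \<longlonglongrightarrow> cut_drift \<gamma> \<delta> (euler (cut_drift \<gamma> \<delta>) h d' i)"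
    by (rule isCont_tendsto_compose[OF cut_drift_isCont[OF assms(1)] Suc.IH])
  then show ?case unfolding euler.simps by (intro tendsto_intros Suc.IH assms(2))
qed simp

lemma euler_path_in_path_space: "T > 0 \<Longrightarrow> m > 0 \<Longrightarrow> euler_path \<gamma> \<delta> T m d \<in> mspace (path_space T)"
  unfolding euler_path_def by (intro interp_path_in_path_space) auto

lemma euler_path_measurable:
  assumes "\<delta> > 0" "T > 0" "m > 0" "\<And>i. (\<lambda>y. d y i) \<in> borel_measurable N"
  shows "(\<lambda>y. euler_path \<gamma> \<delta> T m (d y)) \<in> measurable N (metric_borel (path_space T))"
  unfolding euler_path_def using assms euler_measurable[OF assms(1,4)]
  by (intro measurable_interp_path borel_measurable_max) auto

lemma Lipschitz_euler_path_tendsto: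
  assumes "\<delta> > 0" "T > 0" "m > 0" and d: "\<And>i. (\<lambda>k. d k i) \<longlonglongrightarrow> d' i"
    and lip: "\<And>x y. x \<in> mspace (path_space T) \<Longrightarrow> y \<in> mspace (path_space T) \<Longrightarrow> \<bar>\<Phi> x - \<Phi> y\<bar> \<le> K * mdist (path_space T) x y"
  shows "(\<lambda>k. \<Phi> (euler_path \<gamma> \<delta> T m (d k)) :: real) \<longlonglongrightarrow> \<Phi> (euler_path \<gamma> \<delta> T m d')"
proof -
  have "(\<lambda>k. mdist (path_space T) (euler_path \<gamma> \<delta> T m (d k)) (euler_path \<gamma> \<delta> T m d')) \<longlonglongrightarrow> 0"
    unfolding euler_path_def using assms
    by (intro tendsto_mdist_interp_path tendsto_max tendsto_const euler_tendsto) auto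
  from tendsto_mult_left[OF this, of K]
  have lim: "(\<lambda>k. K * mdist (path_space T) (euler_path \<gamma> \<delta> T m (d k)) (euler_path \<gamma> \<delta> T m d')) \<longlonglongrightarrow> 0" by simp
  have "(\<lambda>k. \<Phi> (euler_path \<gamma> \<delta> T m (d k)) - \<Phi> (euler_path \<gamma> \<delta> T m d')) \<longlonglongrightarrow> 0"
    by (rule Lim_null_comparison[OF _ lim])
       (simp add: lip euler_path_in_path_space assms)
  then show ?thesis by (rule LIM_zero_cancel)
qed

section \<open>The Bessel process follows the Euler scheme\<close>

text \<open>The closeness is pathwise, hence dominated convergence applies. The event on which the scheme stays above
\<open>2 \<delta>\<close> remains in the statement; its probability is estimated later, from the side of the chain.\<close>

lemma bessel_near_euler:
  assumes bp: "bessel_process (2 * \<gamma> + 1) 1 N \<F> B R" and \<gamma>: "\<gamma> \<ge> 0" and \<delta>: "\<delta> > 0" and T: "T > 0"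
    and bd: "\<And>x. x \<in> mspace (path_space T) \<Longrightarrow> \<bar>\<Phi> x\<bar> \<le> c"
    and lip: "\<And>x y. x \<in> mspace (path_space T) \<Longrightarrow> y \<in> mspace (path_space T) \<Longrightarrow> \<bar>\<Phi> x - \<Phi> y\<bar> \<le> K * mdist (path_space T) x y"
  defines "Z \<equiv> (\<lambda>h i y. B (real (Suc i) * h) y - B (real i * h) y)"
  shows "(\<lambda>m. \<integral>y. \<bar>\<Phi> (euler_path \<gamma> \<delta> T m (\<lambda>i. Z (T / real m) i y)) - \<Phi> (restrict (\<lambda>t. R t y) {0..T})\<bar>
      * indicator {y. \<forall>i\<le>m. euler (cut_drift \<gamma> \<delta>) (T / real m) (\<lambda>i. Z (T / real m) i y) i > 2 * \<delta>} y \<partial>N) \<longlonglongrightarrow> 0"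
proof -
  have bm: "brownian_motion N \<F> B"
    and Rm: "\<And>t. t \<ge> 0 \<Longrightarrow> R t \<in> borel_measurable (\<F> t)"
    and Rc: "\<And>y. y \<in> space N \<Longrightarrow> continuous_on {0..} (\<lambda>t. R t y)"
    and R0: "\<And>y t. y \<in> space N \<Longrightarrow> t \<ge> 0 \<Longrightarrow> 0 \<le> R t y"
    and Req: "AE y in N. \<forall>t\<ge>0. R t y = 1 + B t y + (LINT s:{0..t}|lborel. \<gamma> / R s y)"
    using bp unfolding bessel_process_def by auto
  interpret prob_space N using bm unfolding brownian_motion_def by simp
  have sub: "\<And>t. subalgebra N (\<F> t)" and Bm: "\<And>t. t \<ge> 0 \<Longrightarrow> B t \<in> borel_measurable (\<F> t)"
    and B0: "\<And>y. y \<in> space N \<Longrightarrow> B 0 y = 0"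
    using bm unfolding brownian_motion_def by auto
  have RN: "R t \<in> borel_measurable N" and BN: "B t \<in> borel_measurable N" if "t \<ge> 0" for t
    using measurable_from_subalg[OF sub Rm[OF that]] measurable_from_subalg[OF sub Bm[OF that]] by auto
  let ?R = "\<lambda>y. restrict (\<lambda>t. R t y) {0..T}"
  let ?e = "\<lambda>m y. euler (cut_drift \<gamma> \<delta>) (T / real m) (\<lambda>i. Z (T / real m) i y)"
  let ?E = "\<lambda>m y. euler_path \<gamma> \<delta> T m (\<lambda>i. Z (T / real m) i y)"
  have Rpath: "?R \<in> measurable N (metric_borel (path_space T))" by (rule measurable_path[OF RN Rc R0])
  have Rsp: "?R y \<in> mspace (path_space T)" if "y \<in> space N" for y
    using measurable_space[OF Rpath that] by (simp add: space_metric_borel)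
  have Zm: "(\<lambda>y. Z (T / real m) i y) \<in> borel_measurable N" for m i
    unfolding Z_def using T by (intro borel_measurable_diff BN) auto
  have \<Phi>m: "\<Phi> \<in> borel_measurable (metric_borel (path_space T))" by (rule Lipschitz_measurable[OF lip])
  define s where "s m y = \<bar>\<Phi> (?E m y) - \<Phi> (?R y)\<bar> * indicator {y. \<forall>i\<le>m. ?e m y i > 2 * \<delta>} y" for m y
  have c0: "c \<ge> 0" using bd[OF Rsp] not_empty by (metis abs_ge_zero all_not_in_conv order.trans)
  have sb: "\<bar>s m y\<bar> \<le> 2 * c" if "m > 0" "y \<in> space N" for m y
    using bd[OF Rsp[OF that(2)]] bd[OF euler_path_in_path_space[OF T that(1)], of \<gamma> \<delta> "\<lambda>i. Z (T / real m) i y"] c0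
    unfolding s_def by (auto simp: indicator_def)
  have sm: "s m \<in> borel_measurable N" if "m > 0" for m
  proof -
    have 1: "(\<lambda>y. \<Phi> (?E m y)) \<in> borel_measurable N"
      by (rule measurable_compose[OF euler_path_measurable[OF \<delta> T that Zm] \<Phi>m])
    have 2: "(\<lambda>y. \<Phi> (?R y)) \<in> borel_measurable N" by (rule measurable_compose[OF Rpath \<Phi>m])
    have em [measurable]: "(\<lambda>y. ?e m y i) \<in> borel_measurable N" for i by (rule euler_measurable[OF \<delta> Zm])
    have "{y \<in> space N. \<forall>i\<in>{..m}. ?e m y i > 2 * \<delta>} \<in> sets N" by measurable
    then have "{y \<in> space N. y \<in> {y. \<forall>i\<le>m. ?e m y i > 2 * \<delta>}} \<in> sets N"
      by (simp only: mem_Collect_eq Ball_def atMost_iff)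
    then have 3: "(\<lambda>y. indicator {y. \<forall>i\<le>m. ?e m y i > 2 * \<delta>} y :: real) \<in> borel_measurable N"
      by (rule borel_measurable_indicator')
    show ?thesis unfolding s_def
      by (intro borel_measurable_times borel_measurable_abs borel_measurable_diff 1 2 3)
  qed
  have slim: "AE y in N. (\<lambda>m. s m y) \<longlonglongrightarrow> 0"
    using Req AE_space
  proof eventually_elim
    case (elim y)
    show ?case
    proof (rule LIMSEQ_I)
      fix r :: real assume r: "r > 0"
      define \<kappa> where "\<kappa> = r / (2 * (\<bar>K\<bar> + 1))"
      have \<kappa>: "\<kappa> > 0" unfolding \<kappa>_def using r by simp
      have K\<kappa>: "\<bar>K\<bar> * \<kappa> < r"
      proof -
        have "\<bar>K\<bar> * \<kappa> \<le> (\<bar>K\<bar> + 1) * \<kappa>" using \<kappa> by simp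
        also have "(\<bar>K\<bar> + 1) * \<kappa> = r / 2" unfolding \<kappa>_def by (simp add: field_simps)
        finally show ?thesis using r by simp
      qed
      have "\<forall>\<^sub>F m in sequentially. let h = T / real m; e = euler (cut_drift \<gamma> \<delta>) h (\<lambda>l. B (real (Suc l) * h) y - B (real l * h) y)
        in (\<exists>i\<le>m. e i \<le> 2 * \<delta>) \<or> (\<forall>t\<in>{0..T}. \<bar>lin_interp h (\<lambda>i. max 0 (e i)) t - R t y\<bar> \<le> \<kappa>)"
        using elim by (intro integral_equation_euler_path[OF \<gamma> \<delta> T \<kappa>] Rc R0 B0) auto
      with eventually_gt_at_top[of 0] have "\<forall>\<^sub>F m in sequentially. norm (s m y - 0) < r"
      proof eventually_elim
        case (elim m)
        show ?case
        proof (cases "\<exists>i\<le>m. ?e m y i \<le> 2 * \<delta>")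
          case True
          then have "s m y = 0" unfolding s_def by (auto simp: indicator_def not_less[symmetric])
          then show ?thesis using r by simp
        next
          case False
          then have close: "\<And>t. t \<in> {0..T} \<Longrightarrow> \<bar>lin_interp (T / real m) (\<lambda>i. max 0 (?e m y i)) t - R t y\<bar> \<le> \<kappa>"
            using elim(2) unfolding Let_def Z_def by blast
          have ms: "mdist (path_space T) (?E m y) (?R y) \<le> \<kappa>"
            unfolding euler_path_def using \<kappa> close by (intro mdist_path_space_le) simp_all
          have "\<bar>\<Phi> (?E m y) - \<Phi> (?R y)\<bar> \<le> K * mdist (path_space T) (?E m y) (?R y)"
            by (intro lip euler_path_in_path_space T elim(1) Rsp) fact
          also have "\<dots> \<le> \<bar>K\<bar> * \<kappa>" using ms by (intro mult_mono) auto
          finally have "\<bar>\<Phi> (?E m y) - \<Phi> (?R y)\<bar> < r" using K\<kappa> by simp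
          then show ?thesis unfolding s_def using r by (auto simp: indicator_def)
        qed
      qed
      then show "\<exists>no. \<forall>n\<ge>no. norm (s n y - 0) < r" by (simp add: eventually_sequentially)
    qed
  qed
  have "(\<lambda>m. \<integral>y. s (Suc m) y \<partial>N) \<longlonglongrightarrow> (\<integral>y. 0 \<partial>N)"
  proof (rule integral_dominated_convergence[where w="\<lambda>_. 2 * c"])
    show "AE y in N. (\<lambda>m. s (Suc m) y) \<longlonglongrightarrow> 0" using slim by eventually_elim (rule LIMSEQ_Suc)
    show "AE y in N. norm (s (Suc m) y) \<le> 2 * c" for m using sb[of "Suc m"] by auto
  qed (use sm in auto)
  then have "(\<lambda>m. \<integral>y. s (Suc m) y \<partial>N) \<longlonglongrightarrow> 0" by simp
  from LIMSEQ_imp_Suc[OF this] show ?thesis unfolding s_def .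
qed

section \<open>Convergence of the chain\<close>

context bessel_chain
begin

lemma chain_path_eq:
  "\<epsilon> > 0 \<Longrightarrow> (\<lambda>t\<in>{0..T}. interp_chain f w \<epsilon> t x) = interp_path T (\<epsilon>\<^sup>2) (\<lambda>n. \<epsilon> * X \<epsilon> n x)"
  by (rule restrict_ext) (rule interp_chain_eq_lin_interp)

lemma chain_path_measurable:
  assumes \<epsilon>: "\<epsilon> > 0"
  shows "(\<lambda>x. \<lambda>t\<in>{0..T}. interp_chain f w \<epsilon> t x) \<in> measurable P (metric_borel (path_space T))"
  unfolding chain_path_eq[OF \<epsilon>] using chain_pos[OF \<epsilon>] \<epsilon>
  by (intro measurable_interp_path) (auto simp: less_imp_le)

text \<open>For a bounded Lipschitz functional, the expectations for chain and Bessel process are compared through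
those for the two Euler schemes, which are close by convergence of the increments. The same convergence,
applied to a continuous function \<open>q\<close> of the increments between the indicators of the events that the
scheme stays above \<open>3 \<delta>\<close> and above \<open>2 \<delta>\<close>, bounds the probability that the scheme for the Bessel process
gets low by the corresponding bound for the chain.\<close>

theorem chain_converges_to_bessel:
  assumes T: "T > 0" and bp: "bessel_process (2 * \<gamma> + 1) 1 N \<F> B R"
  shows "converges_in_distribution (path_space T) (at_right 0)
           P (\<lambda>\<epsilon> x. \<lambda>t\<in>{0..T}. interp_chain f w \<epsilon> t x)
           N (\<lambda>y. \<lambda>t\<in>{0..T}. R t y)"
proof -
  have \<gamma>: "\<gamma> \<ge> 0" using gamma by simp
  have bm: "brownian_motion N \<F> B"
    and Rm: "\<And>t. t \<ge> 0 \<Longrightarrow> R t \<in> borel_measurable (\<F> t)"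
    and Rc: "\<And>y. y \<in> space N \<Longrightarrow> continuous_on {0..} (\<lambda>t. R t y)"
    and R0: "\<And>y t. y \<in> space N \<Longrightarrow> t \<ge> 0 \<Longrightarrow> 0 \<le> R t y"
    using bp unfolding bessel_process_def by auto
  have sub: "\<And>t. subalgebra N (\<F> t)" and Np: "prob_space N"
    using bm unfolding brownian_motion_def by auto
  interpret N: prob_space N by (rule Np)
  have RN: "R t \<in> borel_measurable N" if "t \<ge> 0" for t
    by (rule measurable_from_subalg[OF sub Rm[OF that]])
  have Rpath: "(\<lambda>y. \<lambda>t\<in>{0..T}. R t y) \<in> measurable N (metric_borel (path_space T))"
    by (rule measurable_path[OF RN Rc R0])
  obtain p where p: "p > 0" and near: "\<And>\<delta> \<kappa>. \<delta> > 0 \<Longrightarrow> \<kappa> > 0 \<Longrightarrow> \<forall>\<^sub>F m in sequentially. \<forall>\<^sub>F \<epsilon> in at_right 0.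
    \<exists>G\<in>events. prob G \<ge> 1 - ((4 * \<delta>) powr p + \<kappa>) \<and>
     (\<forall>x\<in>G. tracks T m \<delta> \<kappa> \<epsilon> x)"
    using chain_near_euler[OF T] by blast
  show ?thesis
  proof (rule converges_in_distributionI_Lipschitz[OF prob_space_axioms Np _ Rpath])
    show "\<forall>\<^sub>F \<epsilon> in at_right 0. (\<lambda>x. \<lambda>t\<in>{0..T}. interp_chain f w \<epsilon> t x) \<in> measurable P (metric_borel (path_space T))"
      using eventually_at_right_less[of 0] by eventually_elim (rule chain_path_measurable)
    fix \<Phi> :: "(real \<Rightarrow> real) \<Rightarrow> real" and c K
    assume bd: "\<And>x. x \<in> mspace (path_space T) \<Longrightarrow> \<bar>\<Phi> x\<bar> \<le> c"
      and lip: "\<And>x y. x \<in> mspace (path_space T) \<Longrightarrow> y \<in> mspace (path_space T) \<Longrightarrow> \<bar>\<Phi> x - \<Phi> y\<bar> \<le> K * mdist (path_space T) x y"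
    have \<Phi>m: "\<Phi> \<in> borel_measurable (metric_borel (path_space T))" by (rule Lipschitz_measurable[OF lip])
    let ?Xp = "\<lambda>\<epsilon> x. \<lambda>t\<in>{0..T}. interp_chain f w \<epsilon> t x"
    let ?R = "\<lambda>y. \<lambda>t\<in>{0..T}. R t y"
    have Rsp: "?R y \<in> mspace (path_space T)" if "y \<in> space N" for y
      using measurable_space[OF Rpath that] by (simp add: space_metric_borel)
    have c0: "c \<ge> 0" using bd[OF Rsp] N.not_empty by (metis abs_ge_zero all_not_in_conv order.trans)
    show "((\<lambda>\<epsilon>. \<integral>x. \<Phi> (?Xp \<epsilon> x) \<partial>P) \<longlongrightarrow> (\<integral>y. \<Phi> (?R y) \<partial>N)) (at_right 0)"
    proof (rule tendstoI)
      fix e :: real assume e: "e > 0"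
      \<comment> \<open>the chain contributes an error of \<open>\<bar>K\<bar> * \<kappa> + 4 * c * \<kappa>\<close> and the Bessel process one of \<open>4 * c * \<kappa>\<close>\<close>
      define \<kappa> where "\<kappa> = e / (16 * (\<bar>K\<bar> + c + 1))"
      \<comment> \<open>such that the probability \<open>(4 \<delta>)\<^sup>p\<close> of a low chain is \<open>\<kappa>\<close>\<close>
      define \<delta> where "\<delta> = \<kappa> powr (1 / p) / 4"
      have kc: "\<bar>K\<bar> + c + 1 > 0" using c0 by (simp add: add_nonneg_pos)
      have \<kappa>: "\<kappa> > 0" unfolding \<kappa>_def using e kc by simp
      have \<delta>: "\<delta> > 0" unfolding \<delta>_def using \<kappa> by simp
      have "4 * \<delta> = \<kappa> powr (1 / p)" unfolding \<delta>_def by simp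
      then have \<delta>p: "(4 * \<delta>) powr p = \<kappa>" using p \<kappa> by (simp add: powr_powr)
      have \<kappa>e: "\<bar>K\<bar> * \<kappa> + 8 * c * \<kappa> \<le> e / 2"
      proof -
        have "\<bar>K\<bar> * \<kappa> + 8 * c * \<kappa> \<le> 8 * ((\<bar>K\<bar> + c + 1) * \<kappa>)" using \<kappa> by (simp add: algebra_simps)
        also have "(\<bar>K\<bar> + c + 1) * \<kappa> = e / 16" unfolding \<kappa>_def using kc by (simp add: field_simps)
        finally show ?thesis by simp
      qed
      let ?Z = "\<lambda>h i y. B (real (Suc i) * h) y - B (real i * h) y"
      let ?gap = "\<lambda>m. \<integral>y. \<bar>\<Phi> (euler_path \<gamma> \<delta> T m (\<lambda>i. ?Z (T / real m) i y)) - \<Phi> (?R y)\<bar>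
          * indicator {y. \<forall>i\<le>m. euler (cut_drift \<gamma> \<delta>) (T / real m) (\<lambda>i. ?Z (T / real m) i y) i > 2 * \<delta>} y \<partial>N"
      have "\<forall>\<^sub>F m in sequentially. ?gap m < e / 8"
        by (rule order_tendstoD(2)[OF bessel_near_euler[OF bp \<gamma> \<delta> T bd lip]]) (use e in simp_all)
      with near[OF \<delta> \<kappa>] eventually_gt_at_top[of 0]
      have "\<forall>\<^sub>F m in sequentially. 0 < m \<and> (\<forall>\<^sub>F \<epsilon> in at_right 0.
          \<exists>G\<in>events. prob G \<ge> 1 - ((4 * \<delta>) powr p + \<kappa>) \<and> (\<forall>x\<in>G. tracks T m \<delta> \<kappa> \<epsilon> x)) \<and> ?gap m < e / 8"
        by eventually_elim blast
      then obtain m :: nat where m: "m > 0" and good: "\<forall>\<^sub>F \<epsilon> in at_right 0.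
          \<exists>G\<in>events. prob G \<ge> 1 - ((4 * \<delta>) powr p + \<kappa>) \<and> (\<forall>x\<in>G. tracks T m \<delta> \<kappa> \<epsilon> x)"
        and Nclose: "?gap m < e / 8"
        using eventually_happens'[OF sequentially_bot] by blast
      define h where "h = T / real m"
      have h: "h > 0" unfolding h_def using T m by simp
      define eu where "eu d = euler (cut_drift \<gamma> \<delta>) h d" for d
      define E where "E d = euler_path \<gamma> \<delta> T m d" for d
      define Zh where "Zh = ?Z h"
      have Zi: "N.indep_vars (\<lambda>_. borel) Zh UNIV" "\<And>i. distributed N lborel (Zh i) (normal_density 0 (sqrt h))"
        unfolding Zh_def by (rule brownian_increments[OF bm h])+
      have Esp: "E d \<in> mspace (path_space T)" for d unfolding E_def by (rule euler_path_in_path_space[OF T m])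
      have Zm: "Zh i \<in> borel_measurable N" for i using distributed_measurable[OF Zi(2)[of i]] by simp
      have Em: "(\<lambda>y. \<Phi> (E (d y))) \<in> borel_measurable Q" if "\<And>i. (\<lambda>y. d y i) \<in> borel_measurable Q" for d and Q :: "'z measure"
        unfolding E_def by (rule measurable_compose[OF euler_path_measurable[OF \<delta> T m that] \<Phi>m])
      have eum: "(\<lambda>y. eu (d y) i) \<in> borel_measurable Q" if "\<And>i. (\<lambda>y. d y i) \<in> borel_measurable Q" for d i and Q :: "'z measure"
        unfolding eu_def by (rule euler_measurable[OF \<delta> that])
      have coord: "(\<lambda>d. d i) \<in> borel_measurable (PiM (UNIV :: nat set) (\<lambda>_. borel :: real measure))" for i
        by (rule measurable_component_singleton) simp
      \<comment> \<open>a continuous function of the increments, equal to 1 if the Euler scheme stays above 3 \<delta>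
        and 0 if it goes below 2 \<delta>\<close>
      define q where "q d = (\<Prod>i\<le>m. 1 - max 0 (min 1 ((3 * \<delta> - eu d i) / \<delta>)))" for d
      have q01: "0 \<le> q d" "q d \<le> 1" for d
        unfolding q_def by (auto intro!: prod_nonneg prod_le_1)
      have q1: "q d = 1" if "\<forall>i\<le>m. eu d i > 3 * \<delta>" for d
        unfolding q_def
      proof (rule prod.neutral, rule ballI)
        fix i assume "i \<in> {..m}"
        then have "(3 * \<delta> - eu d i) / \<delta> \<le> 0" using that \<delta> by (intro divide_nonpos_pos) (auto simp: less_imp_le)
        then show "1 - max 0 (min 1 ((3 * \<delta> - eu d i) / \<delta>)) = 1" by simp
      qed
      have q0: "q d = 0" if "i \<le> m" "eu d i \<le> 2 * \<delta>" for d i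
      proof -
        have "(3 * \<delta> - eu d i) / \<delta> \<ge> 1" using that \<delta> by (simp add: le_divide_eq)
        then have "1 - max 0 (min 1 ((3 * \<delta> - eu d i) / \<delta>)) = 0" by simp
        then show ?thesis unfolding q_def using that by (intro prod_zero) auto
      qed
      have qm: "(\<lambda>y. q (d y)) \<in> borel_measurable Q" if "\<And>i. (\<lambda>y. d y i) \<in> borel_measurable Q" for d and Q :: "'z measure"
        unfolding q_def
        by (intro borel_measurable_prod borel_measurable_diff borel_measurable_max borel_measurable_min
            borel_measurable_divide borel_measurable_const eum that)
      have lim1: "((\<lambda>\<epsilon>. \<integral>x. \<Phi> (E (\<lambda>i. increment h \<epsilon> i x)) \<partial>P) \<longlongrightarrow> (\<integral>y. \<Phi> (E (\<lambda>i. Zh i y)) \<partial>N)) (at_right 0)"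
      proof (rule increments_converge[where g="\<lambda>d. \<Phi> (E d)" and K=c, OF h Np Zi Em[OF coord]])
        show "\<bar>\<Phi> (E d)\<bar> \<le> c" for d by (rule bd[OF Esp])
        show "(\<lambda>k. \<Phi> (E (d k))) \<longlonglongrightarrow> \<Phi> (E d')" if "\<And>i. (\<lambda>k. d k i) \<longlonglongrightarrow> d' i" for d d'
          unfolding E_def by (rule Lipschitz_euler_path_tendsto[OF \<delta> T m that lip])
      qed
      have lim2: "((\<lambda>\<epsilon>. \<integral>x. q (\<lambda>i. increment h \<epsilon> i x) \<partial>P) \<longlongrightarrow> (\<integral>y. q (\<lambda>i. Zh i y) \<partial>N)) (at_right 0)"
      proof (rule increments_converge[where g=q and K=1, OF h Np Zi qm[OF coord]])
        show "\<bar>q d\<bar> \<le> 1" for d using q01[of d] by simp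
        show "(\<lambda>k. q (d k)) \<longlonglongrightarrow> q d'" if "\<And>i. (\<lambda>k. d k i) \<longlonglongrightarrow> d' i" for d d'
          unfolding q_def eu_def using \<delta> by (intro tendsto_intros tendsto_max tendsto_min euler_tendsto[OF \<delta> that]) auto
      qed
      have Pclose: "\<forall>\<^sub>F \<epsilon> in at_right 0. \<bar>(\<integral>x. \<Phi> (?Xp \<epsilon> x) \<partial>P) - (\<integral>x. \<Phi> (E (\<lambda>i. increment h \<epsilon> i x)) \<partial>P)\<bar> \<le> \<bar>K\<bar> * \<kappa> + 4 * c * \<kappa>
          \<and> 1 - 2 * \<kappa> \<le> (\<integral>x. q (\<lambda>i. increment h \<epsilon> i x) \<partial>P)"
        using good eventually_at_right_less[of 0]
      proof eventually_elim
        case (elim \<epsilon>)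
        let ?d = "\<lambda>x i. increment h \<epsilon> i x"
        obtain G where G0: "G \<in> events" "1 - (\<kappa> + \<kappa>) \<le> prob G"
          and big: "\<forall>x\<in>G. tracks T m \<delta> \<kappa> \<epsilon> x"
          using elim(1) unfolding \<delta>p by blast
        have G: "G \<in> events" "prob G \<ge> 1 - 2 * \<kappa>" using G0 by simp_all
        have Ge: "eu (?d x) i > 3 * \<delta>" if "x \<in> G" "i \<le> m" for x i
          using bspec[OF big that(1)] that(2) unfolding tracks_def Let_def h_def[symmetric] eu_def[symmetric] by blast
        have Gc: "\<bar>lin_interp h (\<lambda>i. max 0 (eu (?d x) i)) t - interp_chain f w \<epsilon> t x\<bar> \<le> \<kappa>"
          if "x \<in> G" "t \<in> {0..T}" for x t
          using bspec[OF big that(1)] that(2) unfolding tracks_def Let_def h_def[symmetric] eu_def[symmetric] by blast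
        have Xsp: "?Xp \<epsilon> x \<in> mspace (path_space T)" if "x \<in> space P" for x
          using measurable_space[OF chain_path_measurable[OF elim(2)] that] by (simp add: space_metric_borel)
        have m1: "(\<lambda>x. \<Phi> (?Xp \<epsilon> x)) \<in> borel_measurable P"
          by (rule measurable_compose[OF chain_path_measurable[OF elim(2)] \<Phi>m])
        have m2: "(\<lambda>x. \<Phi> (E (?d x))) \<in> borel_measurable P" by (rule Em) measurable
        have i1: "integrable P (\<lambda>x. \<Phi> (?Xp \<epsilon> x))"
          using bd[OF Xsp] by (intro integrable_const_bound[where B=c] m1) auto
        have i2: "integrable P (\<lambda>x. \<Phi> (E (?d x)))"
          using bd[OF Esp] by (intro integrable_const_bound[where B=c] m2) auto
        have iG: "integrable P (\<lambda>x. indicator G x :: real)" using G(1) by (intro integrable_const_bound[where B=1]) auto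
        have pw: "\<bar>\<Phi> (?Xp \<epsilon> x) - \<Phi> (E (?d x))\<bar> \<le> \<bar>K\<bar> * \<kappa> + 2 * c * (1 - indicator G x)" if x: "x \<in> space P" for x
        proof (cases "x \<in> G")
          case True
          have "mdist (path_space T) (?Xp \<epsilon> x) (E (?d x)) \<le> \<kappa>"
            unfolding E_def euler_path_def h_def[symmetric] eu_def[symmetric]
            using Gc[OF True] \<kappa> by (intro mdist_path_space_le) (simp_all add: abs_minus_commute)
          then have "K * mdist (path_space T) (?Xp \<epsilon> x) (E (?d x)) \<le> \<bar>K\<bar> * \<kappa>" by (intro mult_mono) auto
          with lip[OF Xsp[OF x] Esp, of "?d x"] show ?thesis using True by simp
        next
          case False
          then show ?thesis using bd[OF Xsp[OF x]] bd[OF Esp, of "?d x"] \<kappa> by (simp add: abs_le_iff add_increasing)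
        qed
        have "\<bar>(\<integral>x. \<Phi> (?Xp \<epsilon> x) \<partial>P) - (\<integral>x. \<Phi> (E (?d x)) \<partial>P)\<bar> = \<bar>\<integral>x. \<Phi> (?Xp \<epsilon> x) - \<Phi> (E (?d x)) \<partial>P\<bar>"
          using i1 i2 by simp
        also have "\<dots> \<le> (\<integral>x. \<bar>\<Phi> (?Xp \<epsilon> x) - \<Phi> (E (?d x))\<bar> \<partial>P)" by (rule integral_abs_bound)
        also have "\<dots> \<le> (\<integral>x. \<bar>K\<bar> * \<kappa> + 2 * c * (1 - indicator G x) \<partial>P)"
          using i1 i2 iG pw by (intro integral_mono) auto
        also have "\<dots> = \<bar>K\<bar> * \<kappa> + 2 * c * (1 - prob G)"
          using iG G(1) by (simp add: prob_space)
        also have "\<dots> \<le> \<bar>K\<bar> * \<kappa> + 2 * c * (2 * \<kappa>)"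
          using G(2) c0 by (intro add_left_mono mult_left_mono) auto
        finally have A: "\<bar>(\<integral>x. \<Phi> (?Xp \<epsilon> x) \<partial>P) - (\<integral>x. \<Phi> (E (?d x)) \<partial>P)\<bar> \<le> \<bar>K\<bar> * \<kappa> + 4 * c * \<kappa>" by simp
        have mq: "(\<lambda>x. q (?d x)) \<in> borel_measurable P" by (rule qm) measurable
        have iq: "integrable P (\<lambda>x. q (?d x))" using q01 by (intro integrable_const_bound[where B=1] mq) auto
        have "1 - 2 * \<kappa> \<le> (\<integral>x. indicator G x \<partial>P)" using G by simp
        also have "\<dots> \<le> (\<integral>x. q (?d x) \<partial>P)"
        proof (rule integral_mono[OF iG iq])
          show "indicator G x \<le> q (?d x)" for x using q1[of "?d x"] Ge[of x] q01[of "?d x"] by (auto simp: indicator_def)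
        qed
        finally show ?case using A by blast
      qed
      \<comment> \<open>the lower bound for the walk passes to the limit \<open>\<epsilon> \<rightarrow> 0\<close>\<close>
      have qN: "1 - 2 * \<kappa> \<le> (\<integral>y. q (\<lambda>i. Zh i y) \<partial>N)"
        by (rule tendsto_lowerbound[OF lim2]) (use Pclose in \<open>auto elim: eventually_mono\<close>)
      have Nc: "\<bar>(\<integral>y. \<Phi> (E (\<lambda>i. Zh i y)) \<partial>N) - (\<integral>y. \<Phi> (?R y) \<partial>N)\<bar> \<le> e / 8 + 4 * c * \<kappa>"
      proof -
        let ?d = "\<lambda>y i. Zh i y"
        let ?H = "{y. \<forall>i\<le>m. eu (?d y) i > 2 * \<delta>}"
        have m1: "(\<lambda>y. \<Phi> (?R y)) \<in> borel_measurable N" by (rule measurable_compose[OF Rpath \<Phi>m])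
        have m2: "(\<lambda>y. \<Phi> (E (?d y))) \<in> borel_measurable N" by (rule Em) (rule Zm)
        have em [measurable]: "(\<lambda>y. eu (?d y) i) \<in> borel_measurable N" for i by (rule eum) (rule Zm)
        have "{y \<in> space N. \<forall>i\<in>{..m}. eu (?d y) i > 2 * \<delta>} \<in> sets N" by measurable
        then have "{y \<in> space N. y \<in> ?H} \<in> sets N" by (simp only: mem_Collect_eq Ball_def atMost_iff)
        then have m3: "(\<lambda>y. indicator ?H y :: real) \<in> borel_measurable N" by (rule borel_measurable_indicator')
        have mq: "(\<lambda>y. q (?d y)) \<in> borel_measurable N" by (rule qm) (rule Zm)
        have i1: "integrable N (\<lambda>y. \<Phi> (?R y))"
          using bd[OF Rsp] by (intro N.integrable_const_bound[where B=c] m1) auto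
        have i2: "integrable N (\<lambda>y. \<Phi> (E (?d y)))"
          using bd[OF Esp] by (intro N.integrable_const_bound[where B=c] m2) auto
        have iq: "integrable N (\<lambda>y. q (?d y))" using q01 by (intro N.integrable_const_bound[where B=1] mq) auto
        have db: "\<bar>\<Phi> (E (?d y)) - \<Phi> (?R y)\<bar> \<le> 2 * c" if "y \<in> space N" for y
          using bd[OF Rsp[OF that]] bd[OF Esp, of "?d y"] by linarith
        have i3: "integrable N (\<lambda>y. \<bar>\<Phi> (E (?d y)) - \<Phi> (?R y)\<bar> * indicator ?H y)"
          using db c0 by (intro N.integrable_const_bound[where B="2 * c"] borel_measurable_times borel_measurable_abs borel_measurable_diff m1 m2 m3 AE_I2)
             (auto simp: indicator_def)
        have pw: "\<bar>\<Phi> (E (?d y)) - \<Phi> (?R y)\<bar> \<le> \<bar>\<Phi> (E (?d y)) - \<Phi> (?R y)\<bar> * indicator ?H y + 2 * c * (1 - q (?d y))"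
          if y: "y \<in> space N" for y
        proof (cases "y \<in> ?H")
          case True
          then show ?thesis using c0 q01[of "?d y"] by simp
        next
          case False
          then obtain i where "i \<le> m" "eu (?d y) i \<le> 2 * \<delta>" by (auto simp: not_less)
          then have "q (?d y) = 0" by (rule q0)
          then show ?thesis using db[OF y] False by simp
        qed
        have "\<bar>(\<integral>y. \<Phi> (E (?d y)) \<partial>N) - (\<integral>y. \<Phi> (?R y) \<partial>N)\<bar> = \<bar>\<integral>y. \<Phi> (E (?d y)) - \<Phi> (?R y) \<partial>N\<bar>"
          using i1 i2 by simp
        also have "\<dots> \<le> (\<integral>y. \<bar>\<Phi> (E (?d y)) - \<Phi> (?R y)\<bar> \<partial>N)" by (rule integral_abs_bound)
        also have "\<dots> \<le> (\<integral>y. \<bar>\<Phi> (E (?d y)) - \<Phi> (?R y)\<bar> * indicator ?H y + 2 * c * (1 - q (?d y)) \<partial>N)"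
          using i1 i2 i3 iq by (intro integral_mono pw) auto
        also have "\<dots> = (\<integral>y. \<bar>\<Phi> (E (?d y)) - \<Phi> (?R y)\<bar> * indicator ?H y \<partial>N) + 2 * c * (1 - (\<integral>y. q (?d y) \<partial>N))"
          using i3 iq by (simp add: N.prob_space)
        also have "\<dots> \<le> e / 8 + 2 * c * (2 * \<kappa>)"
        proof (intro add_mono mult_left_mono)
          show "(\<integral>y. \<bar>\<Phi> (E (?d y)) - \<Phi> (?R y)\<bar> * indicator ?H y \<partial>N) \<le> e / 8"
            using Nclose unfolding E_def eu_def Zh_def h_def by (rule less_imp_le)
          show "1 - (\<integral>y. q (?d y) \<partial>N) \<le> 2 * \<kappa>" using qN by simp
        qed (use c0 in simp)
        finally show ?thesis by simp
      qed
      have "\<forall>\<^sub>F \<epsilon> in at_right 0. dist (\<integral>x. \<Phi> (E (\<lambda>i. increment h \<epsilon> i x)) \<partial>P) (\<integral>y. \<Phi> (E (\<lambda>i. Zh i y)) \<partial>N) < e / 8"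
        by (rule tendstoD[OF lim1]) (use e in simp)
      with Pclose show "\<forall>\<^sub>F \<epsilon> in at_right 0. dist (\<integral>x. \<Phi> (?Xp \<epsilon> x) \<partial>P) (\<integral>y. \<Phi> (?R y) \<partial>N) < e"
      proof eventually_elim
        case (elim \<epsilon>)
        then show ?case using Nc \<kappa>e e unfolding dist_real_def by linarith
      qed
    qed
  qed
qed

end

section \<open>Reduction to a globally defined chain\<close>

lemma sup_bigo_bound:
  assumes "sup_bigo S G a"
  shows "\<exists>C\<ge>0. \<exists>A. \<forall>\<xi>\<ge>A. \<forall>u\<in>S. \<bar>G \<xi> u\<bar> \<le> C * \<xi> powr (-a)"
proof -
  have bdd: "\<forall>\<^sub>F \<xi> in at_top. bdd_above ((\<lambda>u. \<bar>G \<xi> u\<bar>) ` S)"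
    and O: "(\<lambda>\<xi>. SUP u\<in>S. \<bar>G \<xi> u\<bar>) \<in> O[at_top](\<lambda>\<xi>. \<xi> powr (- a))"
    using assms unfolding sup_bigo_def by auto
  from landau_o.bigE[OF O] obtain C where C: "C > 0"
    "\<forall>\<^sub>F \<xi> in at_top. norm (SUP u\<in>S. \<bar>G \<xi> u\<bar>) \<le> C * norm (\<xi> powr (-a))" by blast
  from bdd C(2) have "\<forall>\<^sub>F \<xi> in at_top. \<forall>u\<in>S. \<bar>G \<xi> u\<bar> \<le> C * \<xi> powr (-a)"
  proof eventually_elim
    case (elim \<xi>)
    show ?case
    proof
      fix u assume "u \<in> S"
      then have "\<bar>G \<xi> u\<bar> \<le> (SUP u\<in>S. \<bar>G \<xi> u\<bar>)" by (rule cSUP_upper) (rule elim(1))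
      then show "\<bar>G \<xi> u\<bar> \<le> C * \<xi> powr (-a)" using elim(2) by simp
    qed
  qed
  then obtain A where "\<forall>\<xi>\<ge>A. \<forall>u\<in>S. \<bar>G \<xi> u\<bar> \<le> C * \<xi> powr (-a)"
    unfolding eventually_at_top_linorder by blast
  then show ?thesis using C(1) by (intro exI[of _ C] conjI exI[of _ A]) auto
qed

lemma converges_in_distribution_cong:
  fixes m :: "'c metric"
  assumes "\<forall>\<^sub>F i in L. \<forall>x\<in>space P. X i x = X' i x" and "converges_in_distribution m L P X' N Y"
  shows "converges_in_distribution m L P X N Y"
  unfolding converges_in_distribution_def
proof (intro conjI allI impI)
  have c: "\<forall>\<^sub>F i in L. X' i \<in> measurable P (metric_borel m)" and Y: "Y \<in> measurable N (metric_borel m)"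
    using assms(2) unfolding converges_in_distribution_def by blast+
  show "Y \<in> measurable N (metric_borel m)" by (rule Y)
  from assms(1) c show "\<forall>\<^sub>F i in L. X i \<in> measurable P (metric_borel m)"
  proof eventually_elim
    case (elim i)
    then show ?case using measurable_cong[of P "X i" "X' i"] by blast
  qed
  fix \<Phi> :: "'c \<Rightarrow> real"
  assume "continuous_map (mtopology_of m) euclideanreal \<Phi> \<and> bounded (\<Phi> ` mspace m)"
  then have lim: "((\<lambda>i. \<integral>x. \<Phi> (X' i x) \<partial>P) \<longlongrightarrow> (\<integral>y. \<Phi> (Y y) \<partial>N)) L"
    using assms(2) unfolding converges_in_distribution_def by blast
  have "\<forall>\<^sub>F i in L. (\<integral>x. \<Phi> (X' i x) \<partial>P) = (\<integral>x. \<Phi> (X i x) \<partial>P)"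
    using assms(1) by eventually_elim (intro Bochner_Integration.integral_cong; simp)
  from Lim_transform_eventually[OF lim this]
  show "((\<lambda>i. \<integral>x. \<Phi> (X i x) \<partial>P) \<longlongrightarrow> (\<integral>y. \<Phi> (Y y) \<partial>N)) L" .
qed

lemma chain_cong_positive:
  assumes "\<epsilon> > 0" and "\<And>\<xi> u. f \<xi> u > 0" and "\<And>k. \<bar>\<omega> k x\<bar> \<le> M"
    and "\<And>\<xi> u. \<xi> > 0 \<Longrightarrow> \<bar>u\<bar> \<le> M \<Longrightarrow> F \<xi> u = f \<xi> u"
  shows "chain F \<omega> \<epsilon> n x = chain f \<omega> \<epsilon> n x"
proof (induction n)
  case (Suc n)
  have "chain f \<omega> \<epsilon> n x > 0" using assms(1,2) by (cases n) auto
  then show ?case using Suc assms(3,4) by simp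
qed simp

text \<open>The step function is extended by \<open>1\<close> outside the domain where the chain lives, which makes it measurable
and positive everywhere without changing the chain. The measurability of \<open>G\<^sub>0\<close> and \<open>G\<^sub>1\<close> in the position
is not known, so the centred part of the step is taken to be \<open>D = F - E F - \<omega>\<close> instead of \<open>G\<^sub>0\<close>. It
differs from \<open>G\<^sub>0\<close> by the centred part of \<open>G\<^sub>1\<close>, hence is of order \<open>\<xi> powr (- min \<alpha> \<beta>)\<close>, and the
rest \<open>r = E F - \<xi> - \<gamma> / \<xi>\<close> is the expectation of \<open>G\<^sub>1\<close>.\<close>

theorem theorem4p1:
  fixes P :: "'a measure" and \<omega> :: "nat \<Rightarrow> 'a \<Rightarrow> real"
    and F G\<^sub>0 G\<^sub>1 :: "real \<Rightarrow> real \<Rightarrow> real"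
    and M \<gamma> \<xi>\<^sub>m \<xi>\<^sub>p \<alpha> \<beta> T :: real
    and N :: "'b measure" and \<F> :: "real \<Rightarrow> 'b measure" and B R :: "real \<Rightarrow> 'b \<Rightarrow> real"
  assumes "prob_space P"
    and "prob_space.indep_vars P (\<lambda>_. borel) \<omega> UNIV"
    and "\<And>k. distr P borel (\<omega> k) = distr P borel (\<omega> 0)"
    and "\<And>k. prob_space.expectation P (\<omega> k) = 0"
    and "\<And>k. prob_space.expectation P (\<lambda>x. (\<omega> k x)\<^sup>2) = 1"
    and "M \<ge> 1"
    and "\<And>k x. x \<in> space P \<Longrightarrow> \<bar>\<omega> k x\<bar> \<le> M"
    and "(\<lambda>(\<xi>, w). F \<xi> w) \<in> borel_measurable (restrict_space borel ({0<..} \<times> {-M..M}))"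
    and "\<And>\<xi> w. \<xi> > 0 \<Longrightarrow> w \<in> {-M..M} \<Longrightarrow> F \<xi> w > 0"
    and "0 < \<xi>\<^sub>m" and "\<xi>\<^sub>m < \<xi>\<^sub>p" and "\<alpha> > 0" and "\<beta> > 1"
    and "continuous_on ({\<xi>\<^sub>m..} \<times> {-M..M}) (\<lambda>(\<xi>, w). F \<xi> w)"
    and "\<And>\<xi> w. \<xi> > \<xi>\<^sub>p \<Longrightarrow> w \<in> {-M..M} \<Longrightarrow>
           F \<xi> w = \<xi> + w + \<gamma> / \<xi> + G\<^sub>0 \<xi> w + G\<^sub>1 \<xi> w"
    and "sup_bigo {-M..M} G\<^sub>0 \<alpha>"
    and "sup_bigo {-M..M} G\<^sub>1 \<beta>"
    and "\<And>\<xi> k. \<xi> > \<xi>\<^sub>p \<Longrightarrow> integrable P (\<lambda>x. G\<^sub>0 \<xi> (\<omega> k x))"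
    and "\<And>\<xi> k. \<xi> > \<xi>\<^sub>p \<Longrightarrow> prob_space.expectation P (\<lambda>x. G\<^sub>0 \<xi> (\<omega> k x)) = 0"
    and "T > 0"
    and "\<gamma> > 1 / 2"
    and "bessel_process (2 * \<gamma> + 1) 1 N \<F> B R"
  shows "converges_in_distribution (path_space T) (at_right 0)
           P (\<lambda>\<epsilon> x. \<lambda>t\<in>{0..T}. interp_chain F \<omega> \<epsilon> t x)
           N (\<lambda>y. \<lambda>t\<in>{0..T}. R t y)"
proof -
  interpret iid: bounded_iid P \<omega> M
    unfolding bounded_iid_def bounded_iid_axioms_def using assms(1-5,7) by blast
  define f where "f \<xi> u = (if \<xi> > 0 \<and> \<bar>u\<bar> \<le> M then F \<xi> u else 1)" for \<xi> u
  have f_pos: "f \<xi> u > 0" for \<xi> u unfolding f_def using assms(9)[of \<xi> u] by (auto simp: abs_le_iff)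
  have f_F: "F \<xi> u = f \<xi> u" if "\<xi> > 0" "\<bar>u\<bar> \<le> M" for \<xi> u unfolding f_def using that by simp
  let ?\<Omega> = "{0<..} \<times> {-M..M} :: (real \<times> real) set"
  have f_meas: "(\<lambda>(\<xi>, u). f \<xi> u) \<in> borel_measurable (borel \<Otimes>\<^sub>M borel)"
  proof -
    have \<Omega>: "?\<Omega> \<in> sets (borel :: (real \<times> real) measure)"
      unfolding borel_prod[symmetric] by (intro pair_measureI) auto
    have 1: "(\<lambda>z. indicator ?\<Omega> z *\<^sub>R (case z of (\<xi>, u) \<Rightarrow> F \<xi> u)) \<in> borel_measurable borel"
      using assms(8) \<Omega> by (subst (asm) borel_measurable_restrict_space_iff) auto
    have 2: "(\<lambda>z. indicator (- ?\<Omega>) z :: real) \<in> borel_measurable borel" using \<Omega> by (intro borel_measurable_indicator) auto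
    have "(\<lambda>(\<xi>, u). f \<xi> u) = (\<lambda>z. indicator ?\<Omega> z *\<^sub>R (case z of (\<xi>, u) \<Rightarrow> F \<xi> u) + indicator (- ?\<Omega>) z)"
      unfolding f_def by (auto simp: fun_eq_iff indicator_def abs_le_iff)
    then show ?thesis using borel_measurable_add[OF 1 2] unfolding borel_prod by simp
  qed
  have f_section: "f \<xi> \<in> borel_measurable borel" for \<xi>
    using measurable_compose[OF measurable_Pair1' f_meas, of \<xi>] by simp
  obtain C0 A0 where C0: "C0 \<ge> 0" "\<And>\<xi> u. \<xi> \<ge> A0 \<Longrightarrow> u \<in> {-M..M} \<Longrightarrow> \<bar>G\<^sub>0 \<xi> u\<bar> \<le> C0 * \<xi> powr (-\<alpha>)"
    using sup_bigo_bound[OF assms(16)] by blast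
  obtain C1 A1 where C1: "C1 \<ge> 0" "\<And>\<xi> u. \<xi> \<ge> A1 \<Longrightarrow> u \<in> {-M..M} \<Longrightarrow> \<bar>G\<^sub>1 \<xi> u\<bar> \<le> C1 * \<xi> powr (-\<beta>)"
    using sup_bigo_bound[OF assms(17)] by blast
  define A where "A = max 1 (max (\<xi>\<^sub>p + 1) (max A0 A1))"
  have A: "A \<ge> 1" "A > \<xi>\<^sub>p" "A \<ge> A0" "A \<ge> A1" unfolding A_def by auto
  define \<mu> where "\<mu> \<xi> = (\<integral>x. f \<xi> (\<omega> 0 x) \<partial>P)" for \<xi>
  define r where "r \<xi> = \<mu> \<xi> - \<xi> - \<gamma> / \<xi>" for \<xi>
  define D where "D \<xi> u = f \<xi> u - u - \<mu> \<xi>" for \<xi> u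
  have \<mu>_meas: "\<mu> \<in> borel_measurable borel"
  proof -
    have 1: "(\<lambda>z. (fst z, \<omega> 0 (snd z))) \<in> measurable (borel \<Otimes>\<^sub>M P) (borel \<Otimes>\<^sub>M borel)" by measurable
    have "(\<lambda>(\<xi>, x). f \<xi> (\<omega> 0 x)) \<in> borel_measurable (borel \<Otimes>\<^sub>M P)"
      using measurable_compose[OF 1 f_meas] by (simp add: case_prod_beta')
    then show ?thesis unfolding \<mu>_def by (rule iid.borel_measurable_lebesgue_integral)
  qed
  have f_G: "f \<xi> u = \<xi> + u + \<gamma> / \<xi> + G\<^sub>0 \<xi> u + G\<^sub>1 \<xi> u" if "\<xi> \<ge> A" "\<bar>u\<bar> \<le> M" for \<xi> u
    using assms(15)[of \<xi> u] that A unfolding f_def by (auto simp: abs_le_iff)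
  have G0_bd: "\<bar>G\<^sub>0 \<xi> u\<bar> \<le> C0 * \<xi> powr (-\<alpha>)" and G1_bd: "\<bar>G\<^sub>1 \<xi> u\<bar> \<le> C1 * \<xi> powr (-\<beta>)"
    if "\<xi> \<ge> A" "\<bar>u\<bar> \<le> M" for \<xi> u
    using C0(2)[of \<xi> u] C1(2)[of \<xi> u] that A by (auto simp: abs_le_iff)
  have f_int: "integrable P (\<lambda>x. f \<xi> (\<omega> k x))" if \<xi>: "\<xi> \<ge> A" for \<xi> k
  proof (rule iid.integrable_const_bound)
    show "AE x in P. norm (f \<xi> (\<omega> k x)) \<le> \<xi> + M + \<bar>\<gamma> / \<xi>\<bar> + C0 * \<xi> powr (-\<alpha>) + C1 * \<xi> powr (-\<beta>)"
    proof (rule AE_I2)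
      fix x assume "x \<in> space P"
      then have u: "\<bar>\<omega> k x\<bar> \<le> M" by (rule iid.bounded)
      show "norm (f \<xi> (\<omega> k x)) \<le> \<xi> + M + \<bar>\<gamma> / \<xi>\<bar> + C0 * \<xi> powr (-\<alpha>) + C1 * \<xi> powr (-\<beta>)"
        unfolding real_norm_def f_G[OF \<xi> u] using u G0_bd[OF \<xi> u] G1_bd[OF \<xi> u] \<xi> A(1) by linarith
    qed
    show "(\<lambda>x. f \<xi> (\<omega> k x)) \<in> borel_measurable P" using measurable_compose[OF iid.w_measurable f_section] .
  qed
  have \<mu>_eq: "(\<integral>x. f \<xi> (\<omega> k x) \<partial>P) = \<mu> \<xi>" for \<xi> k
  proof -
    have "(\<integral>x. f \<xi> (\<omega> k x) \<partial>P) = (\<integral>u. f \<xi> u \<partial>distr P borel (\<omega> k))" for k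
      by (rule integral_distr[symmetric, OF iid.w_measurable f_section])
    then show ?thesis unfolding \<mu>_def using iid.ident[of k] by simp
  qed
  have r_eq: "r \<xi> = (\<integral>x. G\<^sub>1 \<xi> (\<omega> 0 x) \<partial>P)" and G1_int: "integrable P (\<lambda>x. G\<^sub>1 \<xi> (\<omega> 0 x))" if \<xi>: "\<xi> \<ge> A" for \<xi>
  proof -
    have G0i: "integrable P (\<lambda>x. G\<^sub>0 \<xi> (\<omega> 0 x))" and G0e: "(\<integral>x. G\<^sub>0 \<xi> (\<omega> 0 x) \<partial>P) = 0"
      using assms(18,19)[of \<xi> 0] \<xi> A by auto
    have wi: "integrable P (\<omega> 0)" using iid.bounded by (intro iid.integrable_const_bound[where B=M]) auto
    have eq: "G\<^sub>1 \<xi> (\<omega> 0 x) = f \<xi> (\<omega> 0 x) - \<xi> - \<omega> 0 x - \<gamma> / \<xi> - G\<^sub>0 \<xi> (\<omega> 0 x)" if "x \<in> space P" for x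
      using f_G[OF \<xi> iid.bounded[OF that, of 0]] by simp
    have "integrable P (\<lambda>x. f \<xi> (\<omega> 0 x) - \<xi> - \<omega> 0 x - \<gamma> / \<xi> - G\<^sub>0 \<xi> (\<omega> 0 x))"
      using f_int[OF \<xi>, of 0] wi G0i by auto
    then show "integrable P (\<lambda>x. G\<^sub>1 \<xi> (\<omega> 0 x))"
      using Bochner_Integration.integrable_cong[of P P "\<lambda>x. G\<^sub>1 \<xi> (\<omega> 0 x)", OF refl eq] by blast
    have "(\<integral>x. G\<^sub>1 \<xi> (\<omega> 0 x) \<partial>P) = (\<integral>x. f \<xi> (\<omega> 0 x) - \<xi> - \<omega> 0 x - \<gamma> / \<xi> - G\<^sub>0 \<xi> (\<omega> 0 x) \<partial>P)"
      by (rule Bochner_Integration.integral_cong) (use eq in auto)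
    also have "\<dots> = \<mu> \<xi> - \<xi> - \<gamma> / \<xi>"
      using f_int[OF \<xi>, of 0] wi G0i by (simp add: \<mu>_def iid.mean G0e iid.prob_space)
    finally show "r \<xi> = (\<integral>x. G\<^sub>1 \<xi> (\<omega> 0 x) \<partial>P)" unfolding r_def by simp
  qed
  have r1: "\<bar>r \<xi>\<bar> \<le> C1 * \<xi> powr (-\<beta>)" if \<xi>: "\<xi> \<ge> A" for \<xi>
  proof -
    have "\<bar>r \<xi>\<bar> \<le> (\<integral>x. \<bar>G\<^sub>1 \<xi> (\<omega> 0 x)\<bar> \<partial>P)" unfolding r_eq[OF \<xi>] by (rule integral_abs_bound)
    also have "\<dots> \<le> (\<integral>x. C1 * \<xi> powr (-\<beta>) \<partial>P)"
      using G1_int[OF \<xi>] G1_bd[OF \<xi> iid.bounded] by (intro integral_mono) auto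
    finally show ?thesis by (simp add: iid.prob_space)
  qed
  interpret bc: bessel_chain P \<omega> M f D r \<gamma> A "C0 + 2 * C1" "min \<alpha> \<beta>" \<beta>
  proof unfold_locales
    show "(\<lambda>(\<xi>, u). f \<xi> u) \<in> borel_measurable (borel \<Otimes>\<^sub>M borel)" by (rule f_meas)
    show "f \<xi> u > 0" for \<xi> u by (rule f_pos)
    have [measurable]: "(\<lambda>z. f (fst z) (snd z)) \<in> borel_measurable (borel \<Otimes>\<^sub>M borel)"
      using f_meas by (simp add: case_prod_beta')
    show "(\<lambda>(\<xi>, u). D \<xi> u) \<in> borel_measurable (borel \<Otimes>\<^sub>M borel)"
      unfolding D_def case_prod_beta' using \<mu>_meas by measurable
    show "A > 0" "min \<alpha> \<beta> > 0" "\<beta> > 1" "\<gamma> > 1 / 2" "0 \<le> C0 + 2 * C1"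
      using A assms(12,13,21) C0(1) C1(1) by auto
    fix \<xi> assume \<xi>: "\<xi> \<ge> A"
    show "f \<xi> u = \<xi> + u + \<gamma> / \<xi> + D \<xi> u + r \<xi>" for u unfolding D_def r_def by simp
    show "(\<integral>x. D \<xi> (\<omega> k x) \<partial>P) = 0" for k
    proof -
      have "integrable P (\<omega> k)" using iid.bounded by (intro iid.integrable_const_bound[where B=M]) auto
      then show ?thesis unfolding D_def using f_int[OF \<xi>, of k] by (simp add: \<mu>_eq iid.mean iid.prob_space)
    qed
    have \<xi>1: "\<xi> \<ge> 1" using \<xi> A by simp
    have pw: "\<xi> powr (-\<alpha>) \<le> \<xi> powr (- min \<alpha> \<beta>)" "\<xi> powr (-\<beta>) \<le> \<xi> powr (- min \<alpha> \<beta>)"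
      using \<xi>1 by (intro powr_mono; simp)+
    show "\<bar>D \<xi> u\<bar> \<le> (C0 + 2 * C1) * \<xi> powr (- min \<alpha> \<beta>)" if u: "\<bar>u\<bar> \<le> M" for u
    proof -
      have "D \<xi> u = G\<^sub>0 \<xi> u + G\<^sub>1 \<xi> u - r \<xi>" unfolding D_def r_def f_G[OF \<xi> u] by simp
      then have "\<bar>D \<xi> u\<bar> \<le> C0 * \<xi> powr (-\<alpha>) + 2 * (C1 * \<xi> powr (-\<beta>))"
        using G0_bd[OF \<xi> u] G1_bd[OF \<xi> u] r1[OF \<xi>] by linarith
      also have "\<dots> \<le> C0 * \<xi> powr (- min \<alpha> \<beta>) + 2 * (C1 * \<xi> powr (- min \<alpha> \<beta>))"
        using C0(1) C1(1) pw by (intro add_mono mult_left_mono) auto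
      finally show ?thesis by (simp add: algebra_simps)
    qed
    show "\<bar>r \<xi>\<bar> \<le> (C0 + 2 * C1) * \<xi> powr (- \<beta>)"
      using r1[OF \<xi>] mult_right_mono[of C1 "C0 + 2 * C1" "\<xi> powr (- \<beta>)"] C0(1) C1(1) by simp
  qed
  have "\<forall>\<^sub>F \<epsilon> in at_right 0. \<forall>x\<in>space P.
      (\<lambda>t\<in>{0..T}. interp_chain F \<omega> \<epsilon> t x) = (\<lambda>t\<in>{0..T}. interp_chain f \<omega> \<epsilon> t x)"
    using eventually_at_right_less[of 0]
  proof eventually_elim
    case (elim \<epsilon>)
    show ?case
    proof
      fix x assume x: "x \<in> space P"
      have "chain F \<omega> \<epsilon> n x = chain f \<omega> \<epsilon> n x" for n
        by (rule chain_cong_positive[where M=M, OF elim])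
           (use f_pos iid.bounded[OF x] f_F in auto)
      then show "(\<lambda>t\<in>{0..T}. interp_chain F \<omega> \<epsilon> t x) = (\<lambda>t\<in>{0..T}. interp_chain f \<omega> \<epsilon> t x)"
        unfolding interp_chain_def by (simp only:)
    qed
  qed
  from converges_in_distribution_cong[OF this bc.chain_converges_to_bessel[OF assms(20,22)]]
  show ?thesis .
qed

end
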